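(* Let $X$ be a proper extended metric space and $\mathcal H_X$ an ample discrete $X$-module. Then ${\rm Aut}(C^*_{\rm cp}(\mathcal H_X))={\rm Aut}(C^*_{\rm Roe}(\mathcal H_X))$, where equality is understood through the implementing unitaries of $\mathcal H_X$: every $*$-automorphism of either algebra is the restriction of ${\rm Ad}(U)$ for some unitary $U$ of $\mathcal H_X$, and for a unitary $U$ of $\mathcal H_X$, ${\rm Ad}(U)$ restricts to an automorphism of $C^*_{\rm cp}(\mathcal H_X)$ if and only if it restricts to an automorphism of $C^*_{\rm Roe}(\mathcal H_X)$.
   Context: An extended metric space is a set with a metric allowed to take the value $+\infty$; it is proper if all closed balls of finite radius are compact. A subset is bounded if it has finite diameter; $D\subseteq X$ is coarsely dense if there is $R<\infty$ such that every point of $X$ is within distance $R$ of $D$. An $X$-module is a Hilbert space $\mathcal H_X$ with a unital Boolean algebra $\mathfrak A$ of subsets of $X$ (the measurable sets) and a map $A\mapsto 1_A$ from $\mathfrak A$ to projections in $\mathcal B(\mathcal H_X)$ with $1_{A\cap A'}=1_A1_{A'}$, $1_{A\sqcup A'}=1_A+1_{A'}$ for disjoint $A,A'$, $1_X=\mathrm{id}$, and such that for some $r\geq 0$ the subspaces $1_A(\mathcal H_X)$, with $A$ measurable of diameter $\le r$, span a dense subspace. It is discrete if there are $r\ge0$ and a partition $X=\bigsqcup_i A_i$ into measurable sets of diameter $\le r$ with $\sum_i 1_{A_i}=1$ strongly and such that $C\subseteq X$ is measurable whenever every $C\cap A_i$ is. It is ample if for some $r\ge 0$ the union of the measurable sets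 $A$ of diameter $\le r$ with $1_A$ of infinite rank is coarsely dense in $X$. An operator $t\in\mathcal B(\mathcal H_X)$ has propagation at most $r$ if $1_{A'}t1_A=0$ for all measurable $A,A'$ with $d(a',a)>r$ for all $a\in A,a'\in A'$; it is locally compact if $t1_A$ and $1_At$ are compact for every bounded measurable $A$. $C^*_{\rm cp}(\mathcal H_X)$ is the norm closure of the operators of finite propagation, $C^*_{\rm Roe}(\mathcal H_X)$ the norm closure of the locally compact operators of finite propagation. ${\rm Ad}(U)(t)=UtU^*$. *)

theory Defs
  imports "HOL-Analysis.Analysis"
begin

section \<open>Complex Hilbert spaces and their operators\<close>

text \<open>The library only has real inner product spaces.  A complex Hilbert space is a Banach space
  whose norm comes from a sesquilinear inner product, antilinear in the first argument and linear
  in the second.\<close>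

class scaleC =
  fixes scaleC :: "complex \<Rightarrow> 'a \<Rightarrow> 'a" (infixr "*\<^sub>C" 75)

class chilbert_space = banach + scaleC +
  fixes cinner :: "'a \<Rightarrow> 'a \<Rightarrow> complex"
  assumes scaleC_add_right: "a *\<^sub>C (x + y) = a *\<^sub>C x + a *\<^sub>C y"
    and scaleC_add_left: "(a + b) *\<^sub>C x = a *\<^sub>C x + b *\<^sub>C x"
    and scaleC_scaleC: "a *\<^sub>C (b *\<^sub>C x) = (a * b) *\<^sub>C x"
    and scaleC_one: "1 *\<^sub>C x = x"
    and scaleR_scaleC: "r *\<^sub>R x = complex_of_real r *\<^sub>C x"
    and cinner_commute: "cinner x y = cnj (cinner y x)"
    and cinner_add_right: "cinner x (y + z) = cinner x y + cinner x z"
    and cinner_scaleC_right: "cinner x (a *\<^sub>C y) = a * cinner x y"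
    and norm_eq_sqrt_cinner: "norm x = sqrt (Re (cinner x x))"

global_interpretation complex_vector:
  vector_space "scaleC :: complex \<Rightarrow> 'a \<Rightarrow> 'a::chilbert_space"
  defines cspan = "module.span (scaleC :: complex \<Rightarrow> 'a \<Rightarrow> 'a)"
  by standard (simp_all add: scaleC_add_right scaleC_add_left scaleC_scaleC scaleC_one)

lemma norm_scaleC: "norm (a *\<^sub>C x) = cmod a * norm (x :: 'h::chilbert_space)"
proof -
  have "cinner (a *\<^sub>C x) (a *\<^sub>C x) = a * cnj a * cinner x x"
    using cinner_scaleC_right[of x a x] cinner_commute[of x x] cinner_commute[of x "a *\<^sub>C x"]
    by (metis (no_types, lifting) cinner_commute cinner_scaleC_right complex_cnj_mult mult.assoc)
  also have "a * cnj a = complex_of_real ((cmod a)\<^sup>2)"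
    by (rule complex_norm_square[symmetric])
  finally have "Re (cinner (a *\<^sub>C x) (a *\<^sub>C x)) = (cmod a)\<^sup>2 * Re (cinner x x)"
    by simp
  then show ?thesis
    by (simp add: norm_eq_sqrt_cinner real_sqrt_mult)
qed

text \<open>The type \<open>'h \<Rightarrow>\<^sub>L 'h\<close> consists of the bounded real-linear operators with the operator norm;
  \<open>\<B>(\<H>)\<close> is the norm closed subset of the complex-linear ones.\<close>

definition bounded_ops :: "('h::chilbert_space \<Rightarrow>\<^sub>L 'h) set" where
  "bounded_ops = {t. \<forall>c x. blinfun_apply t (c *\<^sub>C x) = c *\<^sub>C blinfun_apply t x}"

lift_definition scaleC_op :: "complex \<Rightarrow> ('h::chilbert_space \<Rightarrow>\<^sub>L 'h) \<Rightarrow> ('h \<Rightarrow>\<^sub>L 'h)"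
  is "\<lambda>c t x. c *\<^sub>C t x"
proof -
  fix c :: complex and t :: "'h \<Rightarrow> 'h"
  assume t: "bounded_linear t"
  have "bounded_linear (scaleC c :: 'h \<Rightarrow> 'h)"
    by (rule bounded_linear_intro[where K = "cmod c"])
      (simp_all add: scaleC_add_right scaleR_scaleC scaleC_scaleC norm_scaleC mult.commute)
  from bounded_linear_compose[OF this t] show "bounded_linear (\<lambda>x. c *\<^sub>C t x)" .
qed

definition adj :: "('h::chilbert_space \<Rightarrow>\<^sub>L 'h) \<Rightarrow> ('h \<Rightarrow>\<^sub>L 'h)" where
  "adj t = (THE s. \<forall>x y. cinner (blinfun_apply s x) y = cinner x (blinfun_apply t y))"

definition projection_op :: "('h::chilbert_space \<Rightarrow>\<^sub>L 'h) \<Rightarrow> bool" where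
  "projection_op p \<longleftrightarrow> p \<in> bounded_ops \<and> p o\<^sub>L p = p \<and> adj p = p"

definition unitary_op :: "('h::chilbert_space \<Rightarrow>\<^sub>L 'h) \<Rightarrow> bool" where
  "unitary_op u \<longleftrightarrow>
     u \<in> bounded_ops \<and> adj u o\<^sub>L u = id_blinfun \<and> u o\<^sub>L adj u = id_blinfun"

definition compact_op :: "('h::chilbert_space \<Rightarrow>\<^sub>L 'h) \<Rightarrow> bool" where
  "compact_op t \<longleftrightarrow> t \<in> bounded_ops \<and> compact (closure (blinfun_apply t ` cball 0 1))"

definition infinite_rank :: "('h::chilbert_space \<Rightarrow>\<^sub>L 'h) \<Rightarrow> bool" where
  "infinite_rank t \<longleftrightarrow> \<not> (\<exists>B. finite B \<and> range (blinfun_apply t) \<subseteq> cspan B)"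

definition Ad :: "('h::chilbert_space \<Rightarrow>\<^sub>L 'h) \<Rightarrow> ('h \<Rightarrow>\<^sub>L 'h) \<Rightarrow> ('h \<Rightarrow>\<^sub>L 'h)" where
  "Ad u t = u o\<^sub>L t o\<^sub>L adj u"

text \<open>Only the values of \<open>\<Phi>\<close> on \<open>\<A>\<close> matter here.\<close>

definition star_automorphism ::
    "('h::chilbert_space \<Rightarrow>\<^sub>L 'h) set \<Rightarrow> (('h \<Rightarrow>\<^sub>L 'h) \<Rightarrow> ('h \<Rightarrow>\<^sub>L 'h)) \<Rightarrow> bool" where
  "star_automorphism \<A> \<Phi> \<longleftrightarrow>
     bij_betw \<Phi> \<A> \<A> \<and>
     (\<forall>s\<in>\<A>. \<forall>t\<in>\<A>. \<Phi> (s + t) = \<Phi> s + \<Phi> t) \<and>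
     (\<forall>c. \<forall>t\<in>\<A>. \<Phi> (scaleC_op c t) = scaleC_op c (\<Phi> t)) \<and>
     (\<forall>s\<in>\<A>. \<forall>t\<in>\<A>. \<Phi> (s o\<^sub>L t) = \<Phi> s o\<^sub>L \<Phi> t) \<and>
     (\<forall>t\<in>\<A>. \<Phi> (adj t) = adj (\<Phi> t))"

section \<open>Extended metric spaces\<close>

locale extended_metric_space =
  fixes X :: "'x set" and d :: "'x \<Rightarrow> 'x \<Rightarrow> ennreal"
  assumes d_eq_0: "\<lbrakk>x \<in> X; y \<in> X\<rbrakk> \<Longrightarrow> d x y = 0 \<longleftrightarrow> x = y"
    and d_commute: "\<lbrakk>x \<in> X; y \<in> X\<rbrakk> \<Longrightarrow> d x y = d y x"
    and d_triangle: "\<lbrakk>x \<in> X; y \<in> X; z \<in> X\<rbrakk> \<Longrightarrow> d x z \<le> d x y + d y z"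

definition emtopology :: "'x set \<Rightarrow> ('x \<Rightarrow> 'x \<Rightarrow> ennreal) \<Rightarrow> 'x topology" where
  "emtopology X d =
     topology (\<lambda>U. U \<subseteq> X \<and> (\<forall>x\<in>U. \<exists>\<epsilon>>0::real. {y \<in> X. d x y < ennreal \<epsilon>} \<subseteq> U))"

lemma openin_emtopology:
  "openin (emtopology X d) U \<longleftrightarrow>
     U \<subseteq> X \<and> (\<forall>x\<in>U. \<exists>\<epsilon>>0::real. {y \<in> X. d x y < ennreal \<epsilon>} \<subseteq> U)"
proof -
  let ?P = "\<lambda>U. U \<subseteq> X \<and> (\<forall>x\<in>U. \<exists>\<epsilon>>0::real. {y \<in> X. d x y < ennreal \<epsilon>} \<subseteq> U)"
  have int: "?P (S \<inter> T)" if S: "?P S" and T: "?P T" for S T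
  proof (intro conjI ballI)
    show "S \<inter> T \<subseteq> X" using S by blast
    fix x assume x: "x \<in> S \<inter> T"
    from S x obtain a where a: "a > 0" "{y \<in> X. d x y < ennreal a} \<subseteq> S" by blast
    from T x obtain b where b: "b > 0" "{y \<in> X. d x y < ennreal b} \<subseteq> T" by blast
    have "ennreal (min a b) \<le> ennreal a" "ennreal (min a b) \<le> ennreal b"
      by (simp_all add: ennreal_leI)
    then have "{y \<in> X. d x y < ennreal (min a b)} \<subseteq> S \<inter> T"
      using a(2) b(2) by (blast intro: order.strict_trans2)
    then show "\<exists>\<epsilon>>0. {y \<in> X. d x y < ennreal \<epsilon>} \<subseteq> S \<inter> T"
      using a(1) b(1) by (intro exI[of _ "min a b"]) simp
  qed
  have un: "?P (\<Union>\<K>)" if all: "\<forall>K\<in>\<K>. ?P K" for \<K>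
  proof (intro conjI ballI)
    show "\<Union>\<K> \<subseteq> X" using all by blast
    fix x assume "x \<in> \<Union>\<K>"
    then obtain K where K: "K \<in> \<K>" "x \<in> K" by blast
    from all K(1) have "?P K" by (rule bspec)
    with K(2) obtain a where a: "a > 0" "{y \<in> X. d x y < ennreal a} \<subseteq> K" by blast
    from a(2) K(1) have "{y \<in> X. d x y < ennreal a} \<subseteq> \<Union>\<K>" by blast
    with a(1) show "\<exists>\<epsilon>>0. {y \<in> X. d x y < ennreal \<epsilon>} \<subseteq> \<Union>\<K>" by (intro exI conjI)
  qed
  have "istopology ?P"
    unfolding istopology_def by (rule conjI) (assumption | rule allI impI int un)+
  then show ?thesis
    by (simp add: emtopology_def topology_inverse')
qed

locale proper_extended_metric_space = extended_metric_space +
  assumes compact_cballs: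
    "\<lbrakk>x \<in> X; (r::real) \<ge> 0\<rbrakk> \<Longrightarrow> compactin (emtopology X d) {y \<in> X. d x y \<le> ennreal r}"

definition ediam :: "('x \<Rightarrow> 'x \<Rightarrow> ennreal) \<Rightarrow> 'x set \<Rightarrow> ennreal" where
  "ediam d A = (SUP p\<in>A \<times> A. d (fst p) (snd p))"

definition ebounded :: "('x \<Rightarrow> 'x \<Rightarrow> ennreal) \<Rightarrow> 'x set \<Rightarrow> bool" where
  "ebounded d A \<longleftrightarrow> ediam d A < \<infinity>"

definition coarsely_dense :: "'x set \<Rightarrow> ('x \<Rightarrow> 'x \<Rightarrow> ennreal) \<Rightarrow> 'x set \<Rightarrow> bool" where
  "coarsely_dense X d D \<longleftrightarrow>
     D \<subseteq> X \<and> (\<exists>R\<ge>0::real. \<forall>x\<in>X. \<exists>y\<in>D. d x y \<le> ennreal R)"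

section \<open>Modules\<close>

text \<open>\<open>E A\<close> is the projection \<open>1\<^sub>A\<close>; it is only meaningful for \<open>A \<in> \<AA>\<close>.\<close>

locale coarse_module = extended_metric_space X d + algebra X \<AA>
  for X :: "'x set" and d :: "'x \<Rightarrow> 'x \<Rightarrow> ennreal" and \<AA> :: "'x set set" +
  fixes E :: "'x set \<Rightarrow> ('h::chilbert_space \<Rightarrow>\<^sub>L 'h)"
  assumes E_projection: "A \<in> \<AA> \<Longrightarrow> projection_op (E A)"
    and E_Int: "\<lbrakk>A \<in> \<AA>; A' \<in> \<AA>\<rbrakk> \<Longrightarrow> E (A \<inter> A') = E A o\<^sub>L E A'"
    and E_disjoint_Un: "\<lbrakk>A \<in> \<AA>; A' \<in> \<AA>; A \<inter> A' = {}\<rbrakk> \<Longrightarrow> E (A \<union> A') = E A + E A'"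
    and E_space: "E X = id_blinfun"
    and E_nondegenerate:
      "\<exists>r\<ge>0::real. closure (cspan
         (\<Union>A \<in> {A \<in> \<AA>. ediam d A \<le> ennreal r}. range (blinfun_apply (E A)))) = UNIV"

locale discrete_coarse_module = coarse_module +
  assumes discrete:
    "\<exists>r\<ge>0::real. \<exists>P. partition_on X P \<and> P \<subseteq> \<AA> \<and> (\<forall>A\<in>P. ediam d A \<le> ennreal r) \<and>
       (\<forall>v. ((\<lambda>A. blinfun_apply (E A) v) has_sum v) P) \<and>
       (\<forall>C\<subseteq>X. (\<forall>A\<in>P. C \<inter> A \<in> \<AA>) \<longrightarrow> C \<in> \<AA>)"

locale ample_coarse_module = coarse_module +
  assumes ample:
    "\<exists>r\<ge>0::real. coarsely_dense X d
       (\<Union> {A \<in> \<AA>. ediam d A \<le> ennreal r \<and> infinite_rank (E A)})"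

section \<open>Roe algebras\<close>

definition propagation_le :: "('x \<Rightarrow> 'x \<Rightarrow> ennreal) \<Rightarrow> 'x set set \<Rightarrow>
    ('x set \<Rightarrow> ('h::chilbert_space \<Rightarrow>\<^sub>L 'h)) \<Rightarrow> real \<Rightarrow> ('h \<Rightarrow>\<^sub>L 'h) \<Rightarrow> bool" where
  "propagation_le d \<AA> E r t \<longleftrightarrow>
     (\<forall>A\<in>\<AA>. \<forall>A'\<in>\<AA>. (\<forall>a\<in>A. \<forall>a'\<in>A'. d a' a > ennreal r) \<longrightarrow> E A' o\<^sub>L t o\<^sub>L E A = 0)"

definition finite_propagation :: "('x \<Rightarrow> 'x \<Rightarrow> ennreal) \<Rightarrow> 'x set set \<Rightarrow>
    ('x set \<Rightarrow> ('h::chilbert_space \<Rightarrow>\<^sub>L 'h)) \<Rightarrow> ('h \<Rightarrow>\<^sub>L 'h) \<Rightarrow> bool" where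
  "finite_propagation d \<AA> E t \<longleftrightarrow> (\<exists>r\<ge>0. propagation_le d \<AA> E r t)"

definition locally_compact_op :: "('x \<Rightarrow> 'x \<Rightarrow> ennreal) \<Rightarrow> 'x set set \<Rightarrow>
    ('x set \<Rightarrow> ('h::chilbert_space \<Rightarrow>\<^sub>L 'h)) \<Rightarrow> ('h \<Rightarrow>\<^sub>L 'h) \<Rightarrow> bool" where
  "locally_compact_op d \<AA> E t \<longleftrightarrow>
     (\<forall>A\<in>\<AA>. ebounded d A \<longrightarrow> compact_op (t o\<^sub>L E A) \<and> compact_op (E A o\<^sub>L t))"

definition Cstar_cp :: "('x \<Rightarrow> 'x \<Rightarrow> ennreal) \<Rightarrow> 'x set set \<Rightarrow>
    ('x set \<Rightarrow> ('h::chilbert_space \<Rightarrow>\<^sub>L 'h)) \<Rightarrow> ('h \<Rightarrow>\<^sub>L 'h) set" where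
  "Cstar_cp d \<AA> E = closure {t \<in> bounded_ops. finite_propagation d \<AA> E t}"

definition Cstar_Roe :: "('x \<Rightarrow> 'x \<Rightarrow> ennreal) \<Rightarrow> 'x set set \<Rightarrow>
    ('x set \<Rightarrow> ('h::chilbert_space \<Rightarrow>\<^sub>L 'h)) \<Rightarrow> ('h \<Rightarrow>\<^sub>L 'h) set" where
  "Cstar_Roe d \<AA> E =
     closure {t \<in> bounded_ops. finite_propagation d \<AA> E t \<and> locally_compact_op d \<AA> E t}"

end

theory Submission
  imports Defs
begin

text \<open>The partition of the discrete module is coarsened to a locally finite one, so that everything can be
  expressed in terms of the projections onto its blocks.  Both algebras contain the rank one operators
  between blocks of the same coarse component; hence an automorphism permutes the rank one projections,
  which yields the implementing unitary.

  If \<open>Ad(U)\<close> preserves the Roe algebra, it preserves its multipliers, and these are exactly the elements of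
  \<open>C\<^sup>*\<^sub>c\<^sub>p\<close>: otherwise a gliding hump produces a block diagonal, locally compact projection \<open>p\<close> for which \<open>t p\<close>
  is not approximable.  Conversely, if \<open>Ad(U)\<close> preserves \<open>C\<^sup>*\<^sub>c\<^sub>p\<close>, then the projection \<open>q = U\<^sup>* 1\<^sub>A U\<close> for a block
  \<open>A\<close> satisfies \<open>q \<B>(\<H>) q \<subseteq> C\<^sup>*\<^sub>c\<^sub>p\<close>, and a second gliding hump shows that \<open>q\<close> is concentrated on finitely many
  blocks.  Thus \<open>q t\<close> is compact for \<open>t\<close> in the Roe algebra, so \<open>U t U\<^sup>*\<close> is locally compact.\<close>

section \<open>Hilbert spaces\<close>

text \<open>Distances may be infinite, so indices fall into classes of mutually finite distance, and
  neither algebra need contain all compact operators. Properness makes each class countable, but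
  there may be uncountably many classes, and an automorphism may permute them. Errors are therefore
  made summable inside a class and combined by orthogonality across classes; the unitary is built
  from one reference vector per class.

  The obstacle on the multiplier side is uniformity: one propagation bound must serve all of
  \<open>t\<close>. It is first sought on finite sets of vectors, each lying in one block. If no
  bound works, blocks already used can be discarded at the cost of half of epsilon, so failures
  accumulate over disjoint finite sets of blocks. Disjointness leaves finitely many vectors per
  block, and one projection of finite rank on each block fixes them all. A bound valid for all
  finite sets then passes to \<open>t\<close> by weak compactness, with the same epsilon and the
  same propagation.\<close>

lemma cinner_add_left: "cinner (x + y) z = cinner x z + cinner (y :: 'h::chilbert_space) z"
  by (metis cinner_add_right cinner_commute complex_cnj_add)

lemma cinner_scaleC_left: "cinner (a *\<^sub>C x) y = cnj a * cinner (x :: 'h::chilbert_space) y"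
  by (metis cinner_commute cinner_scaleC_right complex_cnj_mult)

lemma scaleC_scaleR_left: "complex_of_real r *\<^sub>C (x :: 'h::chilbert_space) = r *\<^sub>R x"
  by (simp add: scaleR_scaleC)

lemma scaleC_minus1: "(- 1) *\<^sub>C (x :: 'h::chilbert_space) = - x"
  using scaleC_scaleR_left[of "-1" x] by simp

lemma scaleC_zero_right [simp]: "a *\<^sub>C (0 :: 'h::chilbert_space) = 0"
  by (rule complex_vector.scale_zero_right)

lemma scaleC_zero_left [simp]: "0 *\<^sub>C (x :: 'h::chilbert_space) = 0"
  by (rule complex_vector.scale_zero_left)

lemma scaleC_diff_right: "a *\<^sub>C (x - y) = a *\<^sub>C x - a *\<^sub>C (y :: 'h::chilbert_space)"
  by (rule complex_vector.scale_right_diff_distrib)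

lemma cinner_minus_right: "cinner x (- y) = - cinner x (y :: 'h::chilbert_space)"
  by (metis cinner_scaleC_right scaleC_minus1 mult_minus1)

lemma cinner_minus_left: "cinner (- x) y = - cinner x (y :: 'h::chilbert_space)"
  by (metis cinner_commute cinner_minus_right complex_cnj_minus)

lemma cinner_diff_right: "cinner x (y - z) = cinner x y - cinner x (z :: 'h::chilbert_space)"
  using cinner_add_right[of x y "- z"] by (simp add: cinner_minus_right)

lemma cinner_diff_left: "cinner (x - y) z = cinner x z - cinner (y :: 'h::chilbert_space) z"
  using cinner_add_left[of x "- y" z] by (simp add: cinner_minus_left)

lemma cinner_zero_right [simp]: "cinner x (0 :: 'h::chilbert_space) = 0"
  using cinner_diff_right[of x 0 0] by simp

lemma cinner_zero_left [simp]: "cinner 0 (x :: 'h::chilbert_space) = 0"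
  using cinner_diff_left[of 0 0 x] by simp

lemma cinner_sum_right: "cinner x (sum f A) = (\<Sum>i\<in>A. cinner x (f i :: 'h::chilbert_space))"
  by (induction A rule: infinite_finite_induct) (auto simp: cinner_add_right)

lemma cinner_eq_norm: "cinner x x = complex_of_real ((norm (x :: 'h::chilbert_space))\<^sup>2)"
proof -
  have "Im (cinner x x) = 0"
    using cinner_commute[of x x] by (metis complex_cnj_cancel_iff Im_complex_of_real Reals_cnj_iff complex_is_Real_iff)
  \<comment> \<open>Positivity is hidden in the norm: \<open>sqrt\<close> takes negative values on
    negative reals, so \<open>norm x \<ge> 0\<close> forces it.\<close>
  moreover have "Re (cinner x x) \<ge> 0"
    using norm_eq_sqrt_cinner[of x] by (metis norm_ge_zero real_sqrt_ge_0_iff)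
  then have "Re (cinner x x) = (norm x)\<^sup>2"
    by (simp add: norm_eq_sqrt_cinner)
  ultimately show ?thesis
    by (simp add: complex_eq_iff)
qed

lemma cinner_eq_zero_iff: "cinner x x = 0 \<longleftrightarrow> (x :: 'h::chilbert_space) = 0"
  by (simp add: cinner_eq_norm)

lemma norm_add_sq:
  "(norm (x + y :: 'h::chilbert_space))\<^sup>2 = (norm x)\<^sup>2 + 2 * Re (cinner x y) + (norm y)\<^sup>2"
proof -
  have "cinner (x + y) (x + y) = cinner x x + (cinner x y + cnj (cinner x y)) + cinner y y"
    by (simp add: cinner_add_left cinner_add_right cinner_commute[of y x])
  from arg_cong[OF this, of Re] show ?thesis
    by (simp add: cinner_eq_norm del: of_real_power)
qed

lemma norm_diff_sq:
  "(norm (x - y :: 'h::chilbert_space))\<^sup>2 = (norm x)\<^sup>2 - 2 * Re (cinner x y) + (norm y)\<^sup>2"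
  using norm_add_sq[of x "- y"] by (simp add: cinner_minus_right)

text \<open>The vector subtracted is the orthogonal projection of \<open>x\<close> onto the line of
  \<open>y\<close>. The loss of norm yields the Cauchy-Schwarz inequality and, in the Riesz theorem,
  the orthogonality of a minimizer to the kernel.\<close>

lemma norm_sub_scaleC_sq:
  assumes "(y :: 'h::chilbert_space) \<noteq> 0"
  shows "(norm (x - (cinner y x / (norm y)\<^sup>2) *\<^sub>C y))\<^sup>2 = (norm x)\<^sup>2 - (cmod (cinner y x))\<^sup>2 / (norm y)\<^sup>2"
proof -
  have 1: "Re (cinner x y * cinner y x) = (cmod (cinner y x))\<^sup>2"
    by (metis cinner_commute complex_norm_square mult.commute Re_complex_of_real)
  have "cinner x ((cinner y x / (norm y)\<^sup>2) *\<^sub>C y) = (cinner x y * cinner y x) / complex_of_real ((norm y)\<^sup>2)"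
    by (simp add: cinner_scaleC_right mult.commute)
  then have "Re (cinner x ((cinner y x / (norm y)\<^sup>2) *\<^sub>C y)) = (cmod (cinner y x))\<^sup>2 / (norm y)\<^sup>2"
    using 1 by (metis Re_divide_of_real)
  moreover have "(norm ((cinner y x / (norm y)\<^sup>2) *\<^sub>C y))\<^sup>2 = (cmod (cinner y x))\<^sup>2 / (norm y)\<^sup>2"
    using assms by (simp add: norm_scaleC norm_divide norm_mult power_mult_distrib power_divide norm_power field_simps power2_eq_square)
  ultimately show ?thesis
    by (simp add: norm_diff_sq)
qed

lemma Cauchy_Schwarz: "cmod (cinner x y) \<le> norm x * norm (y :: 'h::chilbert_space)"
proof (cases "x = 0")
  case False
  have "0 \<le> (norm y)\<^sup>2 - (cmod (cinner x y))\<^sup>2 / (norm x)\<^sup>2"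
    using norm_sub_scaleC_sq[OF False, of y] by (metis zero_le_power2)
  then have "(cmod (cinner x y))\<^sup>2 \<le> (norm x * norm y)\<^sup>2"
    using False by (simp add: field_simps power_mult_distrib)
  then show ?thesis
    by (rule power2_le_imp_le) simp
qed simp

lemma cinner_ext:
  assumes "\<And>z. cinner z x = cinner z (y :: 'h::chilbert_space)" shows "x = y"
proof -
  have "cinner (x - y) (x - y) = 0"
    using assms[of "x - y"] by (simp add: cinner_diff_right)
  then show ?thesis by (simp add: cinner_eq_zero_iff)
qed

lemma bounded_linear_cinner_right: "bounded_linear (cinner (x :: 'h::chilbert_space))"
  by (rule bounded_linear_intro[where K = "norm x"])
    (auto simp: cinner_add_right scaleR_scaleC cinner_scaleC_right scaleR_conv_of_real
        intro: order_trans[OF Cauchy_Schwarz] simp: mult.commute)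

lemma bounded_linear_cinner_left: "bounded_linear (\<lambda>x. cinner x (y :: 'h::chilbert_space))"
  by (rule bounded_linear_intro[where K = "norm y"])
    (auto simp: cinner_add_left scaleR_scaleC cinner_scaleC_left scaleR_conv_of_real Cauchy_Schwarz)

lemma norm_le_of_cinner:
  assumes "0 \<le> M" "\<And>y. cmod (cinner y x) \<le> M * norm y" shows "norm (x :: 'h::chilbert_space) \<le> M"
proof (cases "x = 0")
  case False
  have "norm x * norm x \<le> M * norm x"
    using assms(2)[of x] by (simp add: cinner_eq_norm norm_power power2_eq_square norm_mult)
  then show ?thesis using False by simp
qed (simp add: assms)

lemma parallelogram:
  "(norm (x - y :: 'h::chilbert_space))\<^sup>2 = 2 * (norm x)\<^sup>2 + 2 * (norm y)\<^sup>2 - (norm (x + y))\<^sup>2"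
  by (simp add: norm_add_sq norm_diff_sq)

text \<open>Take the point of smallest norm on the closed hyperplane \<open>f = 1\<close>: a
  minimizing sequence is Cauchy by the parallelogram law, and its limit, being orthogonal to the
  kernel of \<open>f\<close>, represents \<open>f\<close> after rescaling.\<close>

lemma Riesz_representation:
  fixes f :: "'h::chilbert_space \<Rightarrow> complex"
  assumes f: "bounded_linear f" and fC: "\<And>c x. f (c *\<^sub>C x) = c * f x"
  obtains z where "\<And>x. f x = cinner z x"
proof (cases "\<forall>x. f x = 0")
  case True
  then show ?thesis by (intro that[of 0]) simp
next
  case False
  interpret f: bounded_linear f by (rule f)
  from False obtain x0 where x0: "f x0 \<noteq> 0" by blast
  define S where "S = {x. f x = 1}"
  have "(1 / f x0) *\<^sub>C x0 \<in> S" using x0 by (simp add: S_def fC)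
  then have ne: "norm ` S \<noteq> {}" by blast
  have bdd: "bdd_below (norm ` S)" by (rule bdd_belowI[of _ 0]) auto
  define m where "m = Inf (norm ` S)"
  have m0: "m \<ge> 0" unfolding m_def by (rule cInf_greatest[OF ne]) auto
  have m_le: "m \<le> norm x" if "x \<in> S" for x
    unfolding m_def by (rule cInf_lower[OF _ bdd]) (use that in blast)
  have "\<exists>x\<in>S. norm x < m + 1 / real (Suc n)" for n
  proof -
    have "m < m + 1 / real (Suc n)" by simp
    then show ?thesis unfolding m_def using cInf_less_iff[OF ne bdd] by (metis imageE)
  qed
  then obtain X where XS: "\<And>n. X n \<in> S" and Xm: "\<And>n. norm (X n) < m + 1 / real (Suc n)" by metis
  have lim_norm: "(\<lambda>n. m + 1 / real (Suc n)) \<longlonglongrightarrow> m"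
    using tendsto_add[OF tendsto_const LIMSEQ_inverse_real_of_nat, of m] by (simp add: inverse_eq_divide)
  have lim_norm': "(\<lambda>n. (m + 1 / real (Suc n))\<^sup>2) \<longlonglongrightarrow> m\<^sup>2"
    by (intro tendsto_power lim_norm)
  \<comment> \<open>The midpoint of two points of \<open>S\<close> lies in \<open>S\<close>, so its
    norm is at least \<open>m\<close>; the parallelogram law then bounds the distance.\<close>
  have dist_sq: "(norm (x - y))\<^sup>2 \<le> 2 * (norm x)\<^sup>2 + 2 * (norm y)\<^sup>2 - 4 * m\<^sup>2" if "x \<in> S" "y \<in> S" for x y
  proof -
    have "f ((1/2) *\<^sub>R (x + y)) = 1" using that by (simp add: S_def f.add f.scaleR scaleR_conv_of_real)
    then have "m \<le> norm ((1/2) *\<^sub>R (x + y))" by (intro m_le) (simp add: S_def)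
    then have "(2 * m)\<^sup>2 \<le> (norm (x + y))\<^sup>2" using m0 by (intro power_mono) auto
    then show ?thesis using parallelogram[of x y] by (simp add: power_mult_distrib)
  qed
  have "Cauchy X"
  proof (rule metric_CauchyI)
    fix \<epsilon> :: real assume "\<epsilon> > 0"
    then have "\<forall>\<^sub>F n in sequentially. (m + 1 / real (Suc n))\<^sup>2 < m\<^sup>2 + \<epsilon>\<^sup>2 / 4"
      using order_tendstoD(2)[OF lim_norm'] by simp
    then obtain N where N: "\<And>n. n \<ge> N \<Longrightarrow> (m + 1 / real (Suc n))\<^sup>2 < m\<^sup>2 + \<epsilon>\<^sup>2 / 4"
      by (auto simp: eventually_sequentially)
    have sq: "(norm (X n))\<^sup>2 < m\<^sup>2 + \<epsilon>\<^sup>2 / 4" if "n \<ge> N" for n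
      using N[OF that] power_mono[OF less_imp_le[OF Xm[of n]], of 2] by simp
    have "dist (X i) (X j) < \<epsilon>" if "i \<ge> N" "j \<ge> N" for i j
    proof -
      have "(norm (X i - X j))\<^sup>2 < \<epsilon>\<^sup>2"
        using dist_sq[OF XS[of i] XS[of j]] sq[OF that(1)] sq[OF that(2)] by simp
      then show ?thesis using \<open>\<epsilon> > 0\<close> by (simp add: dist_norm power2_less_imp_less)
    qed
    then show "\<exists>M. \<forall>i\<ge>M. \<forall>j\<ge>M. dist (X i) (X j) < \<epsilon>" by blast
  qed
  then obtain w where w: "X \<longlonglongrightarrow> w" using Cauchy_convergent convergent_def by blast
  have "(\<lambda>n. f (X n)) \<longlonglongrightarrow> f w" by (rule f.tendsto[OF w])
  then have fw: "f w = 1" using XS LIMSEQ_unique[of "\<lambda>n. f (X n)" "f w" 1] by (simp add: S_def)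
  have "norm w \<le> m"
    by (rule tendsto_le[OF _ lim_norm tendsto_norm[OF w]])
       (use Xm in \<open>auto intro!: always_eventually less_imp_le simp del: of_nat_Suc\<close>)
  then have wm: "norm w \<le> norm x" if "f x = 1" for x
    using m_le[of x] that by (simp add: S_def)
  have w0: "w \<noteq> 0" using fw by (auto simp: f.zero)
  have orth: "cinner w k = 0" if k: "f k = 0" for k
  proof (cases "k = 0")
    case False
    \<comment> \<open>Translation by multiples of \<open>k\<close> stays in the hyperplane; the
      optimal one would shorten \<open>w\<close> if \<open>w\<close> were not orthogonal to
      \<open>k\<close>.\<close>
    let ?c = "cinner k w / (norm k)\<^sup>2"
    have "f (w - ?c *\<^sub>C k) = 1" using k fw by (simp add: f.diff fC)
    then have "(norm w)\<^sup>2 \<le> (norm (w - ?c *\<^sub>C k))\<^sup>2" by (intro power_mono wm) auto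
    also have "\<dots> = (norm w)\<^sup>2 - (cmod (cinner k w))\<^sup>2 / (norm k)\<^sup>2" by (rule norm_sub_scaleC_sq[OF False])
    finally have "(cmod (cinner k w))\<^sup>2 / (norm k)\<^sup>2 \<le> 0" by simp
    then have "cinner k w = 0" using False by (simp add: divide_le_0_iff)
    then show ?thesis by (metis cinner_commute complex_cnj_zero)
  qed simp
  have "f x = cinner ((1 / (norm w)\<^sup>2) *\<^sub>C w) x" for x
  proof -
    have "f (x - f x *\<^sub>C w) = 0" by (simp add: f.diff fC fw)
    then have "cinner w (x - f x *\<^sub>C w) = 0" by (rule orth)
    then have "cinner w x = f x * (norm w)\<^sup>2" by (simp add: cinner_diff_right cinner_scaleC_right cinner_eq_norm)
    then show ?thesis using w0 by (simp add: cinner_scaleC_left)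
  qed
  then show ?thesis by (rule that)
qed

section \<open>Bounded operators and adjoints\<close>

lemma bounded_opsD: "t \<in> bounded_ops \<Longrightarrow> t (c *\<^sub>C x) = c *\<^sub>C t x"
  by (simp add: bounded_ops_def)

lemma blinfun_compose_apply: "(s o\<^sub>L t) x = s (t x)" by simp

lemma bounded_ops_compose [intro]: "s \<in> bounded_ops \<Longrightarrow> t \<in> bounded_ops \<Longrightarrow> s o\<^sub>L t \<in> bounded_ops"
  by (simp add: bounded_ops_def)

lemma bounded_ops_add [intro]: "s \<in> bounded_ops \<Longrightarrow> t \<in> bounded_ops \<Longrightarrow> s + t \<in> bounded_ops"
  by (simp add: bounded_ops_def blinfun.add_left scaleC_add_right)

lemma bounded_ops_diff [intro]: "s \<in> bounded_ops \<Longrightarrow> t \<in> bounded_ops \<Longrightarrow> s - t \<in> bounded_ops"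
  by (simp add: bounded_ops_def blinfun.diff_left scaleC_diff_right)

lemma bounded_ops_zero [intro, simp]: "0 \<in> bounded_ops"
  by (simp add: bounded_ops_def)

lemma bounded_ops_id [intro, simp]: "id_blinfun \<in> bounded_ops"
  by (simp add: bounded_ops_def)

lemma bounded_ops_scaleC [intro]: "t \<in> bounded_ops \<Longrightarrow> scaleC_op c t \<in> bounded_ops"
  by (simp add: bounded_ops_def scaleC_op.rep_eq scaleC_scaleC mult.commute)

lemma bounded_linear_scaleC: "bounded_linear (scaleC c :: 'h::chilbert_space \<Rightarrow> 'h)"
  by (rule bounded_linear_intro[where K = "cmod c"])
    (simp_all add: scaleC_add_right scaleR_scaleC scaleC_scaleC norm_scaleC mult.commute)

lemma closed_bounded_ops: "closed (bounded_ops :: ('h::chilbert_space \<Rightarrow>\<^sub>L 'h) set)"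
proof -
  have *: "closed {t :: 'h \<Rightarrow>\<^sub>L 'h. t (c *\<^sub>C x) = c *\<^sub>C t x}" for c x
    by (rule closed_Collect_eq)
       (auto intro!: continuous_intros bounded_linear.continuous_on[OF bounded_linear_scaleC])
  have "bounded_ops = (\<Inter>c. \<Inter>x. {t :: 'h \<Rightarrow>\<^sub>L 'h. t (c *\<^sub>C x) = c *\<^sub>C t x})"
    by (auto simp: bounded_ops_def)
  moreover have "closed (\<Inter>c. \<Inter>x. {t :: 'h \<Rightarrow>\<^sub>L 'h. t (c *\<^sub>C x) = c *\<^sub>C t x})"
    by (intro closed_INT ballI *)
  ultimately show ?thesis by simp
qed

lemma blinfun_eqI_cinner:
  fixes s t :: "'a::real_normed_vector \<Rightarrow>\<^sub>L 'h::chilbert_space"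
  assumes "\<And>x y. cinner y (s x) = cinner y (t x)"
  shows "s = t"
  by (rule blinfun_eqI, rule cinner_ext, rule assms)

lemma norm_blinfun_le_cinner:
  fixes t :: "'a::real_normed_vector \<Rightarrow>\<^sub>L 'h::chilbert_space"
  assumes "0 \<le> M" "\<And>x y. cmod (cinner y (t x)) \<le> M * norm x * norm y"
  shows "norm t \<le> M"
  by (rule norm_blinfun_bound[OF assms(1)], rule norm_le_of_cinner) (use assms in auto)

lemma cmod_cinner_blinfun_le:
  fixes t :: "'a::real_normed_vector \<Rightarrow>\<^sub>L 'h::chilbert_space"
  shows "cmod (cinner y (t x)) \<le> norm t * norm x * norm y"
proof -
  have "cmod (cinner y (t x)) \<le> norm y * norm (t x)" by (rule Cauchy_Schwarz)
  also have "\<dots> \<le> norm y * (norm t * norm x)" by (intro mult_left_mono norm_blinfun) simp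
  finally show ?thesis by (simp add: mult.commute mult.left_commute)
qed

text \<open>The Riesz theorem in the second variable, for each fixed first one. This yields
  adjoints, and later turns a pointwise limit of matrix coefficients into an operator.\<close>

lemma op_of_form:
  fixes b :: "'h::chilbert_space \<Rightarrow> 'h \<Rightarrow> complex"
  assumes add1: "\<And>x y z. b (x + y) z = b x z + b y z" and scale1: "\<And>c x z. b (c *\<^sub>C x) z = cnj c * b x z"
    and add2: "\<And>x y z. b z (x + y) = b z x + b z y" and scale2: "\<And>c x z. b z (c *\<^sub>C x) = c * b z x"
    and bound: "\<And>x y. cmod (b x y) \<le> M * norm x * norm y" and M: "0 \<le> M"
  obtains s where "s \<in> bounded_ops" "norm s \<le> M" "\<And>x y. cinner (s x) y = b x y" 
proof -
  have "\<exists>z. \<forall>y. b x y = cinner z y" for x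
  proof -
    have "bounded_linear (b x)"
      by (rule bounded_linear_intro[where K = "M * norm x"])
        (use bound[of x] in \<open>auto simp: add2 scale2 scaleR_scaleC scaleR_conv_of_real algebra_simps\<close>)
    from Riesz_representation[OF this scale2] show ?thesis by metis
  qed
  then obtain S where S: "\<And>x y. b x y = cinner (S x) y" by metis
  have S': "cinner y (S x) = cnj (b x y)" for x y by (metis S cinner_commute)
  have add: "S (x + y) = S x + S y" for x y
    by (rule cinner_ext) (simp add: cinner_add_right S' add1)
  have scale: "S (c *\<^sub>C x) = c *\<^sub>C S x" for c x
    by (rule cinner_ext) (simp add: cinner_scaleC_right S' scale1)
  have nS: "norm (S x) \<le> norm x * M" for x
  proof (rule norm_le_of_cinner)
    show "cmod (cinner y (S x)) \<le> norm x * M * norm y" for y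
      using bound[of x y] by (simp add: S' mult.commute)
  qed (simp add: M)
  have bl: "bounded_linear S"
    by (rule bounded_linear_intro[where K = M]) (simp_all add: add scale scaleR_scaleC nS)
  let ?s = "Blinfun S"
  have s: "blinfun_apply ?s x = S x" for x using bl by (simp add: bounded_linear_Blinfun_apply)
  show ?thesis
  proof
    show "?s \<in> bounded_ops" by (simp add: bounded_ops_def s scale)
    show "norm ?s \<le> M" by (rule norm_blinfun_bound[OF M]) (use nS in \<open>simp add: s mult.commute\<close>)
    show "cinner (?s x) y = b x y" for x y by (simp add: s S)
  qed
qed

lemma adj_exists:
  assumes t: "t \<in> bounded_ops"
  obtains s where "s \<in> bounded_ops" "\<And>x y. cinner (s x) y = cinner x (t y)"
proof -
  have "cmod (cinner x (t y)) \<le> norm t * norm x * norm y" for x y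
    using cmod_cinner_blinfun_le[of x t y] by (simp add: algebra_simps)
  note bound = this
  show ?thesis
  proof (rule op_of_form[of "\<lambda>x y. cinner x (t y)" "norm t"])
    show "cmod (cinner x (t y)) \<le> norm t * norm x * norm y" for x y by (rule bound)
  qed (auto simp: blinfun.add_right bounded_opsD[OF t] cinner_add_left cinner_add_right
        cinner_scaleC_left cinner_scaleC_right intro: that)
qed

lemma adj_unique:
  assumes "\<And>x y. cinner (blinfun_apply s x) y = cinner x (blinfun_apply t y)"
  shows "adj t = s"
  unfolding adj_def
proof (rule the_equality)
  show "\<forall>x y. cinner (s x) y = cinner x (t y)" using assms by blast
next
  fix s' assume "\<forall>x y. cinner (blinfun_apply s' x) y = cinner x (blinfun_apply t y)"
  then show "s' = s" using assms by (intro blinfun_eqI_cinner) (metis cinner_commute)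
qed

lemma
  assumes t: "t \<in> bounded_ops"
  shows adj_bounded_ops [intro]: "adj t \<in> bounded_ops"
    and cinner_adj_left: "cinner (adj t x) y = cinner x (t y)"
proof -
  obtain s where s: "s \<in> bounded_ops" "\<And>x y. cinner (s x) y = cinner x (t y)"
    using adj_exists[OF t] by blast
  then have "adj t = s" by (intro adj_unique)
  with s show "adj t \<in> bounded_ops" "cinner (adj t x) y = cinner x (t y)" by auto
qed

lemma cinner_adj_right: "t \<in> bounded_ops \<Longrightarrow> cinner x (adj t y) = cinner (t x) y"
  by (metis cinner_adj_left cinner_commute)

lemma adj_adj: "t \<in> bounded_ops \<Longrightarrow> adj (adj t) = t"
  by (rule adj_unique) (simp add: cinner_adj_right)

lemma adj_compose: "s \<in> bounded_ops \<Longrightarrow> t \<in> bounded_ops \<Longrightarrow> adj (s o\<^sub>L t) = adj t o\<^sub>L adj s"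
  by (rule adj_unique) (simp add: cinner_adj_left)

lemma adj_diff: "s \<in> bounded_ops \<Longrightarrow> t \<in> bounded_ops \<Longrightarrow> adj (s - t) = adj s - adj t"
  by (rule adj_unique) (simp add: cinner_adj_left blinfun.diff_left cinner_diff_left cinner_diff_right)

lemma adj_id: "adj id_blinfun = id_blinfun"
  by (rule adj_unique) simp

lemma adj_zero: "adj 0 = 0"
  by (rule adj_unique) simp

lemma norm_adj_le:
  assumes t: "t \<in> bounded_ops" shows "norm (adj t) \<le> norm t"
proof (rule norm_blinfun_le_cinner)
  fix x y
  have "cmod (cinner y (adj t x)) = cmod (cinner x (t y))"
    by (metis cinner_adj_right[OF t] cinner_commute complex_mod_cnj)
  then show "cmod (cinner y (adj t x)) \<le> norm t * norm x * norm y"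
    using cmod_cinner_blinfun_le[of x t y] by (simp add: mult.commute mult.left_commute)
qed simp

lemma norm_adj: "t \<in> bounded_ops \<Longrightarrow> norm (adj t) = norm t"
  by (metis adj_adj adj_bounded_ops norm_adj_le order_antisym)

lemma norm_compose_le: "norm s \<le> a \<Longrightarrow> norm t \<le> b \<Longrightarrow> norm (s o\<^sub>L t) \<le> a * b"
  by (meson mult_mono norm_blinfun_compose norm_ge_zero order_trans)

lemma
  assumes "projection_op p"
  shows projection_bounded: "p \<in> bounded_ops"
    and projection_idem: "p (p x) = p x"
    and projection_adj: "adj p = p"
    and projection_cinner: "cinner (p x) y = cinner x (p y)"
  using assms cinner_adj_left[of p x y] blinfun_compose_apply[of p p x] by (auto simp: projection_op_def)

lemma projection_norm_sq:
  assumes "projection_op p" shows "(norm x)\<^sup>2 = (norm (p x))\<^sup>2 + (norm (x - p x))\<^sup>2"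
proof -
  have "cinner x (p x) = complex_of_real ((norm (p x))\<^sup>2)"
    by (metis assms cinner_eq_norm projection_cinner projection_idem)
  then show ?thesis by (simp add: norm_diff_sq)
qed

lemma projection_norm_le: "projection_op p \<Longrightarrow> norm (p x) \<le> norm x"
  by (rule power2_le_imp_le) (use projection_norm_sq[of p x] in auto)

lemma projection_norm: "projection_op p \<Longrightarrow> norm p \<le> 1"
  by (rule norm_blinfun_bound) (auto simp: projection_norm_le)

lemma projectionI:
  assumes "p \<in> bounded_ops" "\<And>x. p (p x) = p x" "\<And>x y. cinner (p x) y = cinner x (p y)"
  shows "projection_op p"
  using assms by (auto simp: projection_op_def intro!: blinfun_eqI adj_unique)

lemma projection_compl: "projection_op p \<Longrightarrow> projection_op (id_blinfun - p)"
  by (rule projectionI)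
    (auto simp: projection_bounded blinfun.diff_left blinfun.diff_right projection_idem projection_cinner
      cinner_diff_left cinner_diff_right)

lemma unitary_apply:
  assumes "unitary_op u"
  shows "adj u (u x) = x" "u (adj u x) = x"
  using assms by (metis blinfun_apply_blinfun_compose blinfun_apply_id_blinfun unitary_op_def)+

lemma unitary_adj: "unitary_op u \<Longrightarrow> unitary_op (adj u)"
  by (simp add: unitary_op_def adj_adj adj_bounded_ops)

lemma norm_blinfun_unit_bound:
  fixes t :: "'a::real_normed_vector \<Rightarrow>\<^sub>L 'b::real_normed_vector"
  assumes "norm t > \<epsilon>" "\<epsilon> \<ge> 0" obtains v where "norm v \<le> 1" "norm (t v) > \<epsilon>"
proof -
  have "\<exists>v. norm v \<le> 1 \<and> norm (t v) > \<epsilon>"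
  proof (rule ccontr)
    assume *: "\<not> ?thesis"
    have "norm t \<le> \<epsilon>"
    proof (rule norm_blinfun_bound[OF assms(2)])
      fix x
      show "norm (t x) \<le> \<epsilon> * norm x"
      proof (cases "x = 0")
        case False
        have "norm (t ((1 / norm x) *\<^sub>R x)) \<le> \<epsilon>" using *[unfolded not_ex, rule_format, of "(1 / norm x) *\<^sub>R x"] False
          by simp
        then show ?thesis using False by (simp add: blinfun.scaleR_right field_simps)
      qed simp
    qed
    with assms(1) show False by simp
  qed
  then show ?thesis using that by blast
qed

lemma blinfun_compose_assoc: "(s o\<^sub>L t) o\<^sub>L u = s o\<^sub>L (t o\<^sub>L u)"
  by (rule blinfun_eqI) simp

lemma blinfun_compose_diff_right: "s o\<^sub>L (t - u) = (s o\<^sub>L t) - (s o\<^sub>L u)"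
  by (rule blinfun_eqI) (simp add: blinfun.diff_left blinfun.diff_right)

lemma blinfun_compose_diff_left: "(s - t) o\<^sub>L u = (s o\<^sub>L u) - (t o\<^sub>L u)"
  by (rule blinfun_eqI) (simp add: blinfun.diff_left)

lemma closure_compose:
  assumes "s \<in> closure A" "t \<in> closure B" "\<And>a b. a \<in> A \<Longrightarrow> b \<in> B \<Longrightarrow> a o\<^sub>L b \<in> C"
  shows "s o\<^sub>L t \<in> closure C"
proof -
  obtain a where a: "\<And>n. a n \<in> A" "a \<longlonglongrightarrow> s" using assms(1) by (auto simp: closure_sequential)
  obtain b where b: "\<And>n. b n \<in> B" "b \<longlonglongrightarrow> t" using assms(2) by (auto simp: closure_sequential)
  have "(\<lambda>n. a n o\<^sub>L b n) \<longlonglongrightarrow> (s o\<^sub>L t)"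
    by (rule bounded_bilinear.tendsto[OF bounded_bilinear_blinfun_compose a(2) b(2)])
  then show ?thesis
    using assms(3)[OF a(1) b(1)] by (auto simp: closure_sequential intro!: exI[of _ "\<lambda>n. a n o\<^sub>L b n"])
qed

lemma closure_normI:
  assumes "\<And>\<epsilon>. \<epsilon> > 0 \<Longrightarrow> \<exists>s\<in>A. norm (t - s) \<le> \<epsilon>" shows "t \<in> closure A"
  unfolding closure_approachable
proof (intro allI impI)
  fix \<epsilon> :: real assume "\<epsilon> > 0"
  then obtain s where "s \<in> A" "norm (t - s) \<le> \<epsilon>/2" using assms[of "\<epsilon>/2"] by auto
  then show "\<exists>y\<in>A. dist y t < \<epsilon>" using \<open>\<epsilon> > 0\<close> by (intro bexI[of _ s]) (auto simp: dist_norm norm_minus_commute)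
qed

lemma closure_normD:
  assumes "t \<in> closure A" "\<epsilon> > 0" obtains s where "s \<in> A" "norm (t - s) \<le> \<epsilon>"
  using assms unfolding closure_approachable by (metis dist_norm dist_commute less_imp_le)

lemma norm_blinfun_le_unit:
  fixes t :: "'a::real_normed_vector \<Rightarrow>\<^sub>L 'b::real_normed_vector"
  assumes "\<And>v. norm v \<le> 1 \<Longrightarrow> norm (t v) \<le> \<epsilon>" "\<epsilon> \<ge> 0" shows "norm t \<le> \<epsilon>"
proof (rule ccontr)
  assume "\<not> norm t \<le> \<epsilon>"
  then obtain v where "norm v \<le> 1" "norm (t v) > \<epsilon>"
    using norm_blinfun_unit_bound[of \<epsilon> t] assms(2) by auto
  then show False using assms(1)[of v] by simp
qed

lemma scaleC_op_apply [simp]: "scaleC_op c t x = c *\<^sub>C t x"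
  by (simp add: scaleC_op.rep_eq)

section \<open>Rank one operators and compact operators\<close>

lift_definition ketbra :: "'h::chilbert_space \<Rightarrow> 'h \<Rightarrow> 'h \<Rightarrow>\<^sub>L 'h"
  is "\<lambda>x y z. cinner y z *\<^sub>C x"
proof -
  fix x y :: 'h
  show "bounded_linear (\<lambda>z. cinner y z *\<^sub>C x)"
  proof (rule bounded_linear_intro[where K = "norm x * norm y"])
    show "norm (cinner y z *\<^sub>C x) \<le> norm z * (norm x * norm y)" for z
      using mult_right_mono[OF Cauchy_Schwarz[of y z] norm_ge_zero[of x]] by (simp add: norm_scaleC algebra_simps)
  qed (simp_all add: cinner_add_right scaleC_add_left scaleR_scaleC cinner_scaleC_right scaleC_scaleC)
qed

lemmas ketbra_apply [simp] = ketbra.rep_eq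

lemma ketbra_bounded_ops [intro, simp]: "ketbra x y \<in> bounded_ops"
  by (simp add: bounded_ops_def cinner_scaleC_right scaleC_scaleC)

lemma compose_ketbra: "t \<in> bounded_ops \<Longrightarrow> t o\<^sub>L ketbra x y = ketbra (t x) y"
  by (rule blinfun_eqI) (simp add: bounded_opsD)

lemma ketbra_compose: "t \<in> bounded_ops \<Longrightarrow> ketbra x y o\<^sub>L t = ketbra x (adj t y)"
  by (rule blinfun_eqI) (simp add: cinner_adj_left)

lemma adj_ketbra: "adj (ketbra x y) = ketbra y x"
proof (rule adj_unique)
  fix v w
  show "cinner (ketbra y x v) w = cinner v (ketbra x y w)"
    by (simp add: cinner_scaleC_left cinner_scaleC_right cinner_commute[of v x] mult.commute)
qed

lemma ketbra_ketbra: "ketbra x y o\<^sub>L ketbra z w = scaleC_op (cinner y z) (ketbra x w)"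
  by (rule blinfun_eqI) (simp add: cinner_scaleC_right scaleC_op.rep_eq scaleC_scaleC mult.commute)

lemma ketbra_add_left: "ketbra (x + y) z = ketbra x z + ketbra y z"
  by (rule blinfun_eqI) (simp add: blinfun.add_left scaleC_add_right)

lemma ketbra_scaleC_left: "ketbra (c *\<^sub>C x) z = scaleC_op c (ketbra x z)"
  by (rule blinfun_eqI) (simp add: scaleC_op.rep_eq scaleC_scaleC mult.commute)

lemma ketbra_zero_left [simp]: "ketbra 0 z = 0"
  by (rule blinfun_eqI) simp

lemma ketbra_zero_right [simp]: "ketbra z 0 = 0"
  by (rule blinfun_eqI) simp

lemma cinner_ketbra_self: "cinner (ketbra u u x) y = cinner x (ketbra u u y)"
  by (simp add: cinner_scaleC_right cinner_scaleC_left cinner_commute[of x u] mult.commute)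

lemma ketbra_projection: "norm u = 1 \<Longrightarrow> projection_op (ketbra u u)"
  by (rule projectionI[OF ketbra_bounded_ops _ cinner_ketbra_self])
    (simp add: cinner_scaleC_right cinner_eq_norm)

text \<open>In a complete space a closed set is compact iff it is totally bounded, and a net for
  half of epsilon survives taking the closure. The arguments below handle compact operators in this
  epsilon-net form.\<close>

lemma compact_op_iff:
  "compact_op t \<longleftrightarrow> t \<in> bounded_ops \<and>
     (\<forall>\<epsilon>>0. \<exists>K. finite K \<and> (\<forall>x. norm x \<le> 1 \<longrightarrow> (\<exists>k\<in>K. norm (t x - k) < \<epsilon>)))"
proof -
  let ?S = "blinfun_apply t ` cball 0 1"
  have 1: "(\<forall>\<epsilon>>0. \<exists>K. finite K \<and> closure ?S \<subseteq> (\<Union>k\<in>K. ball k \<epsilon>)) \<longleftrightarrow>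
      (\<forall>\<epsilon>>0. \<exists>K. finite K \<and> ?S \<subseteq> (\<Union>k\<in>K. ball k \<epsilon>))" (is "?L \<longleftrightarrow> ?R")
  proof
    assume ?L then show ?R using closure_subset[of ?S] by (meson order_trans)
  next
    assume R: ?R
    show ?L
    proof (intro allI impI)
      fix \<epsilon> :: real assume "\<epsilon> > 0"
      then obtain K where K: "finite K" "?S \<subseteq> (\<Union>k\<in>K. ball k (\<epsilon>/2))" using R by (meson half_gt_zero)
      have "y \<in> (\<Union>k\<in>K. ball k \<epsilon>)" if "y \<in> closure ?S" for y
      proof -
        obtain s where s: "s \<in> ?S" "dist s y < \<epsilon>/2"
          using \<open>y \<in> closure ?S\<close> \<open>\<epsilon> > 0\<close> by (meson closure_approachable half_gt_zero)
        then obtain k where k: "k \<in> K" "dist k s < \<epsilon>/2" using K by auto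
        have "dist k y < \<epsilon>" using dist_triangle[of k y s] s k by linarith
        then show ?thesis using k by auto
      qed
      then show "\<exists>K. finite K \<and> closure ?S \<subseteq> (\<Union>k\<in>K. ball k \<epsilon>)" using K(1) by blast
    qed
  qed
  have 2: "compact (closure ?S) \<longleftrightarrow> (\<forall>\<epsilon>>0. \<exists>K. finite K \<and> ?S \<subseteq> (\<Union>k\<in>K. ball k \<epsilon>))"
    unfolding compact_eq_totally_bounded 1[symmetric] by (simp add: complete_eq_closed)
  have "y \<in> (\<Union>k\<in>K. ball k \<epsilon>) \<longleftrightarrow> (\<exists>k\<in>K. norm (y - k) < \<epsilon>)" for y :: 'a and K \<epsilon>
    by (metis UN_iff mem_ball dist_commute dist_norm)
  then have 3: "?S \<subseteq> (\<Union>k\<in>K. ball k \<epsilon>) \<longleftrightarrow> (\<forall>x. norm x \<le> 1 \<longrightarrow> (\<exists>k\<in>K. norm (t x - k) < \<epsilon>))" for K \<epsilon>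
    unfolding image_subset_iff by (simp only: Ball_def mem_cball_0)
  show ?thesis
    unfolding compact_op_def 2 3 ..
qed

lemma compact_op_bounded: "compact_op t \<Longrightarrow> t \<in> bounded_ops"
  by (simp add: compact_op_iff)

lemma compact_op_net:
  assumes "compact_op t" "\<epsilon> > 0"
  obtains K where "finite K" "\<And>x. norm x \<le> 1 \<Longrightarrow> \<exists>k\<in>K. norm (t x - k) < \<epsilon>"
  using assms unfolding compact_op_iff by blast

lemma compact_opI:
  assumes "t \<in> bounded_ops" "\<And>\<epsilon>. \<epsilon> > 0 \<Longrightarrow> \<exists>K. finite K \<and> (\<forall>x. norm x \<le> 1 \<longrightarrow> (\<exists>k\<in>K. norm (t x - k) < \<epsilon>))"
  shows "compact_op t"
  using assms by (simp add: compact_op_iff)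

lemma compact_op_zero [simp, intro]: "compact_op 0"
  by (rule compact_opI) (auto intro!: exI[of _ "{0}"])

lemma compact_op_add [intro]:
  assumes s: "compact_op s" and t: "compact_op t" shows "compact_op (s + t)"
proof (rule compact_opI)
  fix \<epsilon> :: real assume "\<epsilon> > 0"
  then obtain K L where K: "finite K" "\<And>x. norm x \<le> 1 \<Longrightarrow> \<exists>k\<in>K. norm (s x - k) < \<epsilon>/2"
    and L: "finite L" "\<And>x. norm x \<le> 1 \<Longrightarrow> \<exists>k\<in>L. norm (t x - k) < \<epsilon>/2"
    using compact_op_net[OF s] compact_op_net[OF t] by (metis half_gt_zero)
  let ?K = "(\<lambda>(k, l). k + l) ` (K \<times> L)"
  have "\<exists>k\<in>?K. norm ((s + t) x - k) < \<epsilon>" if x1: "norm x \<le> 1" for x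
  proof -
    obtain k l where kl: "k \<in> K" "norm (s x - k) < \<epsilon>/2" "l \<in> L" "norm (t x - l) < \<epsilon>/2"
      using K(2)[OF x1] L(2)[OF x1] by blast
    have "norm ((s + t) x - (k + l)) \<le> norm (s x - k) + norm (t x - l)"
      by (simp add: blinfun.add_left norm_diff_triangle_ineq)
    also have "\<dots> < \<epsilon>" using kl by linarith
    finally show ?thesis using kl by auto
  qed
  then show "\<exists>K. finite K \<and> (\<forall>x. norm x \<le> 1 \<longrightarrow> (\<exists>k\<in>K. norm ((s + t) x - k) < \<epsilon>))"
    using K(1) L(1) by (intro exI[of _ ?K]) auto
qed (use s t compact_op_bounded in auto)

lemma compact_op_sum [intro]: "(\<And>i. i \<in> A \<Longrightarrow> compact_op (f i)) \<Longrightarrow> compact_op (sum f A)"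
  by (induction A rule: infinite_finite_induct) auto

lemma compact_op_compose_left [intro]:
  assumes b: "b \<in> bounded_ops" and t: "compact_op t" shows "compact_op (b o\<^sub>L t)"
proof (rule compact_opI)
  fix \<epsilon> :: real assume "\<epsilon> > 0"
  then have "\<epsilon> / (norm b + 1) > 0" by (simp add: add_nonneg_pos)
  then obtain K where K: "finite K" "\<And>x. norm x \<le> 1 \<Longrightarrow> \<exists>k\<in>K. norm (t x - k) < \<epsilon> / (norm b + 1)"
    using compact_op_net[OF t] by metis
  have "\<exists>k\<in>b ` K. norm ((b o\<^sub>L t) x - k) < \<epsilon>" if x1: "norm x \<le> 1" for x
  proof -
    obtain k where k: "k \<in> K" "norm (t x - k) < \<epsilon> / (norm b + 1)" using K x1 by blast
    have "norm ((b o\<^sub>L t) x - b k) \<le> norm b * norm (t x - k)"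
      using norm_blinfun[of b "t x - k"] by (simp add: blinfun.diff_right)
    also have "\<dots> \<le> (norm b + 1) * norm (t x - k)" by (intro mult_right_mono) auto
    also have "\<dots> < \<epsilon>" using k(2) by (simp add: pos_less_divide_eq add_nonneg_pos mult.commute)
    finally show ?thesis using k(1) by blast
  qed
  then show "\<exists>K. finite K \<and> (\<forall>x. norm x \<le> 1 \<longrightarrow> (\<exists>k\<in>K. norm ((b o\<^sub>L t) x - k) < \<epsilon>))"
    using K(1) by (intro exI[of _ "b ` K"]) auto
qed (use b t compact_op_bounded in auto)

lemma compact_op_compose_right [intro]:
  assumes b: "b \<in> bounded_ops" and t: "compact_op t" shows "compact_op (t o\<^sub>L b)"
proof (rule compact_opI)
  fix \<epsilon> :: real assume "\<epsilon> > 0"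
  \<comment> \<open>\<open>b\<close> maps the unit ball into the ball of radius \<open>M\<close>;
    the summand 1 keeps \<open>M\<close> positive when \<open>b = 0\<close>.\<close>
  define M where "M = norm b + 1"
  have M: "M > 0" by (simp add: M_def add_nonneg_pos)
  then have "\<epsilon> / M > 0" using \<open>\<epsilon> > 0\<close> by simp
  then obtain K where K: "finite K" "\<And>x. norm x \<le> 1 \<Longrightarrow> \<exists>k\<in>K. norm (t x - k) < \<epsilon> / M"
    using compact_op_net[OF t] by metis
  have "\<exists>k\<in>(*\<^sub>R) M ` K. norm ((t o\<^sub>L b) x - k) < \<epsilon>" if x1: "norm x \<le> 1" for x
  proof -
    have "norm (b x) \<le> norm b * 1" using norm_blinfun[of b x] that mult_left_mono[OF that, of "norm b"] by simp
    then have "norm ((1 / M) *\<^sub>R b x) \<le> 1" using M by (simp add: M_def field_simps)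
    then obtain k where k: "k \<in> K" "norm (t ((1 / M) *\<^sub>R b x) - k) < \<epsilon> / M" using K by blast
    have "(t o\<^sub>L b) x - M *\<^sub>R k = M *\<^sub>R (t ((1 / M) *\<^sub>R b x) - k)"
      using M by (simp add: blinfun.scaleR_right scaleR_right_diff_distrib)
    then have "norm ((t o\<^sub>L b) x - M *\<^sub>R k) = M * norm (t ((1 / M) *\<^sub>R b x) - k)" using M by simp
    also have "\<dots> < \<epsilon>" using k(2) M by (simp add: pos_less_divide_eq mult.commute)
    finally show ?thesis using k(1) by blast
  qed
  then show "\<exists>K. finite K \<and> (\<forall>x. norm x \<le> 1 \<longrightarrow> (\<exists>k\<in>K. norm ((t o\<^sub>L b) x - k) < \<epsilon>))"
    using K(1) by (intro exI[of _ "(*\<^sub>R) M ` K"]) auto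
qed (use b t compact_op_bounded in auto)

lemma compact_op_limit:
  assumes t: "t \<in> bounded_ops" and approx: "\<And>\<epsilon>. \<epsilon> > 0 \<Longrightarrow> \<exists>s. compact_op s \<and> norm (t - s) \<le> \<epsilon>"
  shows "compact_op t"
proof (rule compact_opI[OF t])
  fix \<epsilon> :: real assume "\<epsilon> > 0"
  then obtain s where s: "compact_op s" "norm (t - s) \<le> \<epsilon>/2" using approx[of "\<epsilon>/2"] by auto
  obtain K where K: "finite K" "\<And>x. norm x \<le> 1 \<Longrightarrow> \<exists>k\<in>K. norm (s x - k) < \<epsilon>/2"
    using compact_op_net[OF s(1)] \<open>\<epsilon> > 0\<close> by (metis half_gt_zero)
  have "\<exists>k\<in>K. norm (t x - k) < \<epsilon>" if x1: "norm x \<le> 1" for x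
  proof -
    obtain k where k: "k \<in> K" "norm (s x - k) < \<epsilon>/2" using K x1 by blast
    have "norm ((t - s) x) \<le> norm (t - s) * norm x" by (rule norm_blinfun)
    also have "\<dots> \<le> \<epsilon>/2 * 1" using s(2) that \<open>\<epsilon> > 0\<close> by (intro mult_mono) auto
    finally have "norm (t x - s x) \<le> \<epsilon>/2" by (simp add: blinfun.diff_left)
    then have "norm (t x - k) < \<epsilon>" using k(2) norm_triangle_ineq[of "t x - s x" "s x - k"] by simp
    then show ?thesis using k by blast
  qed
  then show "\<exists>K. finite K \<and> (\<forall>x. norm x \<le> 1 \<longrightarrow> (\<exists>k\<in>K. norm (t x - k) < \<epsilon>))" using K by blast
qed

lemma compact_op_ketbra [intro, simp]: "compact_op (ketbra x y)"
proof (rule compact_opI)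
  fix \<epsilon> :: real assume "\<epsilon> > 0"
  let ?C = "(\<lambda>c. c *\<^sub>C x) ` cball 0 (norm y)"
  have "continuous_on (cball 0 (norm y)) (\<lambda>c. c *\<^sub>C x)"
  proof (rule bounded_linear.continuous_on[OF _ continuous_on_id])
    show "bounded_linear (\<lambda>c. c *\<^sub>C x)"
      by (rule bounded_linear_intro[where K = "norm x"])
        (simp_all add: scaleC_add_left scaleR_scaleC scaleC_scaleC norm_scaleC scaleR_conv_of_real)
  qed
  then have "compact ?C" by (intro compact_continuous_image) auto
  then obtain K where K: "finite K" "?C \<subseteq> (\<Union>k\<in>K. ball k \<epsilon>)"
    using \<open>\<epsilon> > 0\<close> unfolding compact_eq_totally_bounded by blast
  have "\<exists>k\<in>K. norm (ketbra x y z - k) < \<epsilon>" if "norm z \<le> 1" for z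
  proof -
    have "cmod (cinner y z) \<le> norm y"
      using Cauchy_Schwarz[of y z] mult_left_mono[OF that, of "norm y"] by simp
    then have "ketbra x y z \<in> ?C" by auto
    then show ?thesis using K(2) by (force simp: dist_norm norm_minus_commute)
  qed
  then show "\<exists>K. finite K \<and> (\<forall>z. norm z \<le> 1 \<longrightarrow> (\<exists>k\<in>K. norm (ketbra x y z - k) < \<epsilon>))" using K by blast
qed simp

text \<open>One Gram-Schmidt step per vector: the normalized residue of \<open>a\<close> is
  orthogonal to the range of \<open>p\<close>, so its rank one projection can be added to
  \<open>p\<close>. The bound on the range later keeps such projections inside one block.\<close>

lemma finite_dim_projection:
  assumes "finite S"
  shows "\<exists>p. projection_op p \<and> compact_op p \<and> (\<forall>x\<in>S. p x = x) \<and> range (blinfun_apply p) \<subseteq> cspan S"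
  using assms
proof (induction S)
  case empty
  show ?case by (rule exI[of _ 0]) (auto simp: projection_op_def adj_zero complex_vector.span_zero)
next
  case (insert a S)
  obtain p where p: "projection_op p" "compact_op p" "\<And>x. x \<in> S \<Longrightarrow> p x = x" "range (blinfun_apply p) \<subseteq> cspan S"
    using insert.IH by auto
  have sub: "cspan S \<subseteq> cspan (insert a S)" by (rule complex_vector.span_mono) auto
  define r where "r = a - p a"
  show ?case
  proof (cases "r = 0")
    case True
    then have "p x = x" if "x \<in> insert a S" for x using that p(3) by (auto simp: r_def)
    with p sub show ?thesis by (intro exI[of _ p]) blast
  next
    case False
    define u where "u = (1 / norm r) *\<^sub>C r"
    have nu: "norm u = 1" using False by (simp add: u_def norm_scaleC norm_divide)
    have pr: "p r = 0" by (simp add: r_def blinfun.diff_right projection_idem[OF p(1)])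
    then have pu: "p u = 0" by (simp add: u_def bounded_opsD[OF projection_bounded[OF p(1)]])
    have up: "cinner u (p x) = 0" for x using projection_cinner[OF p(1), of u x] pu by simp
    let ?q = "p + ketbra u u"
    have q: "projection_op ?q"
    proof (rule projectionI)
      show "?q \<in> bounded_ops" using projection_bounded[OF p(1)] by auto
      show "?q (?q x) = ?q x" for x
        by (simp add: blinfun.add_left blinfun.add_right projection_idem[OF p(1)] up pu nu
            bounded_opsD[OF projection_bounded[OF p(1)]] cinner_add_right cinner_scaleC_right cinner_eq_norm)
      show "cinner (?q x) y = cinner x (?q y)" for x y
        using cinner_ketbra_self[of u x y] projection_cinner[OF p(1), of x y]
        by (simp add: blinfun.add_left cinner_add_left cinner_add_right)
    qed
    have "cinner r a = complex_of_real ((norm r)\<^sup>2)"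
    proof -
      have "cinner r (p a) = 0" using projection_cinner[OF p(1), of r a] pr by simp
      then have "cinner r a = cinner r r" by (simp add: r_def cinner_diff_right)
      then show ?thesis by (simp add: cinner_eq_norm)
    qed
    then have "cinner u a *\<^sub>C u = r"
      using False by (simp add: u_def cinner_scaleC_left scaleC_scaleC power2_eq_square scaleC_one)
    then have qa: "?q a = a" by (simp add: blinfun.add_left r_def)
    have qS: "?q x = x" if "x \<in> S" for x
      using up[of x] p(3)[OF that] by (simp add: blinfun.add_left)
    have a: "a \<in> cspan (insert a S)" by (rule complex_vector.span_base) simp
    have "p x \<in> cspan (insert a S)" for x using p(4) sub by blast
    moreover from this have "u \<in> cspan (insert a S)" unfolding u_def r_def
      by (intro complex_vector.span_scale complex_vector.span_diff a)
    ultimately have "range (blinfun_apply ?q) \<subseteq> cspan (insert a S)"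
      by (auto simp: blinfun.add_left intro!: complex_vector.span_add complex_vector.span_scale)
    with q qa qS p(2) show ?thesis by (intro exI[of _ ?q]) auto
  qed
qed

text \<open>A finite net of the image of the unit ball, pushed into the range of \<open>e\<close>.\<close>

lemma compact_op_finite_approx:
  assumes c: "compact_op c" and e: "projection_op e" "e o\<^sub>L c = c" and "\<epsilon> > 0"
  obtains S where "finite S" "\<And>x. x \<in> S \<Longrightarrow> e x = x"
    "\<And>p. projection_op p \<Longrightarrow> (\<And>x. x \<in> S \<Longrightarrow> p x = x) \<Longrightarrow> norm (c - (p o\<^sub>L c)) \<le> \<epsilon>"
proof -
  obtain K where K: "finite K" "\<And>x. norm x \<le> 1 \<Longrightarrow> \<exists>k\<in>K. norm (c x - k) < \<epsilon>"
    using compact_op_net[OF c \<open>\<epsilon> > 0\<close>] by metis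
  have ec: "e (c x) = c x" for x using e(2) by (metis blinfun_apply_blinfun_compose)
  show ?thesis
  proof (rule that[of "e ` K"])
    fix p assume p: "projection_op p" "\<And>x. x \<in> e ` K \<Longrightarrow> p x = x"
    have unit: "norm (c x - p (c x)) \<le> \<epsilon>" if x1: "norm x \<le> 1" for x
    proof -
      obtain k where k: "k \<in> K" "norm (c x - k) < \<epsilon>" using K(2) x1 by blast
      have "c x - p (c x) = (id_blinfun - p) (e (c x - k))"
        using p(2)[of "e k"] k by (simp add: blinfun.diff_left blinfun.diff_right ec)
      then have "norm (c x - p (c x)) \<le> norm (e (c x - k))"
        using projection_norm_le[OF projection_compl[OF p(1)]] by metis
      also have "\<dots> \<le> norm (c x - k)" by (rule projection_norm_le[OF e(1)])
      finally show ?thesis using k by simp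
    qed
    show "norm (c - (p o\<^sub>L c)) \<le> \<epsilon>"
    proof (rule norm_blinfun_bound)
      fix x
      show "norm ((c - (p o\<^sub>L c)) x) \<le> \<epsilon> * norm x"
      proof (cases "x = 0")
        case False
        have "(c - (p o\<^sub>L c)) x = norm x *\<^sub>R (c - (p o\<^sub>L c)) ((1 / norm x) *\<^sub>R x)"
          using False by (simp add: blinfun.scaleR_right)
        also have "norm \<dots> = norm x * norm ((c - (p o\<^sub>L c)) ((1 / norm x) *\<^sub>R x))" by simp
        also have "\<dots> \<le> norm x * \<epsilon>"
          using unit[of "(1 / norm x) *\<^sub>R x"] False by (intro mult_left_mono) (auto simp: blinfun.diff_left)
        finally show ?thesis by (simp add: mult.commute)
      qed simp
    qed (use \<open>\<epsilon> > 0\<close> in simp)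
  qed (use K e in \<open>auto simp: projection_idem\<close>)
qed

text \<open>A compact \<open>c\<close> is a norm limit of operators \<open>p o\<^sub>L c\<close>
  with \<open>p\<close> a finite dimensional projection, and their adjoints
  \<open>adj c o\<^sub>L p\<close> are compact because \<open>p\<close> is.\<close>

lemma compact_op_adj:
  assumes c: "compact_op c" shows "compact_op (adj c)"
proof (rule compact_op_limit)
  have cb: "c \<in> bounded_ops" by (rule compact_op_bounded[OF c])
  then show "adj c \<in> bounded_ops" by (rule adj_bounded_ops)
  fix \<epsilon> :: real assume "\<epsilon> > 0"
  have id: "projection_op id_blinfun" "id_blinfun o\<^sub>L c = c"
    by (auto simp: projection_op_def adj_id intro!: blinfun_eqI)
  obtain S where S: "finite S"
    "\<And>p. projection_op p \<Longrightarrow> (\<And>x. x \<in> S \<Longrightarrow> p x = x) \<Longrightarrow> norm (c - (p o\<^sub>L c)) \<le> \<epsilon>"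
    using compact_op_finite_approx[OF c id \<open>\<epsilon> > 0\<close>] by metis
  obtain p where p: "projection_op p" "compact_op p" "\<And>x. x \<in> S \<Longrightarrow> p x = x"
    using finite_dim_projection[OF S(1)] by metis
  have pb: "p \<in> bounded_ops" by (rule projection_bounded[OF p(1)])
  have "norm (adj (c - (p o\<^sub>L c))) \<le> \<epsilon>"
    using S(2)[OF p(1,3)] cb pb by (subst norm_adj) auto
  moreover have "adj (c - (p o\<^sub>L c)) = adj c - (adj c o\<^sub>L p)"
    using cb pb by (simp add: adj_diff adj_compose bounded_ops_compose projection_adj[OF p(1)])
  moreover have "compact_op (adj c o\<^sub>L p)" using adj_bounded_ops[OF cb] p(2) by auto
  ultimately show "\<exists>s. compact_op s \<and> norm (adj c - s) \<le> \<epsilon>" by metis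
qed

section \<open>Sums of orthogonal families\<close>

text \<open>Two finite partial sums that both contain \<open>F0\<close> differ only by sums over
  sets disjoint from \<open>F0\<close>, so the net of partial sums is Cauchy.\<close>

lemma summable_on_Cauchy:
  fixes f :: "'i \<Rightarrow> 'b::banach"
  assumes "\<And>\<epsilon>. \<epsilon> > 0 \<Longrightarrow> \<exists>F0. finite F0 \<and> F0 \<subseteq> A \<and> (\<forall>F. finite F \<and> F \<subseteq> A \<and> F \<inter> F0 = {} \<longrightarrow> norm (sum f F) < \<epsilon>)"
  shows "f summable_on A"
proof -
  have "\<exists>P. eventually P (finite_subsets_at_top A) \<and> (\<forall>F F'. P F \<and> P F' \<longrightarrow> dist (sum f F) (sum f F') < \<epsilon>)"
    if "\<epsilon> > 0" for \<epsilon> :: real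
  proof -
    obtain F0 where F0: "finite F0" "F0 \<subseteq> A"
      "\<And>F. finite F \<Longrightarrow> F \<subseteq> A \<Longrightarrow> F \<inter> F0 = {} \<Longrightarrow> norm (sum f F) < \<epsilon>/2"
      using assms[of "\<epsilon>/2"] \<open>\<epsilon> > 0\<close> by (metis half_gt_zero)
    define P where "P F \<longleftrightarrow> finite F \<and> F0 \<subseteq> F \<and> F \<subseteq> A" for F
    have "eventually P (finite_subsets_at_top A)"
      unfolding eventually_finite_subsets_at_top P_def using F0 by blast
    moreover have "dist (sum f F) (sum f F') < \<epsilon>" if "P F" "P F'" for F F'
    proof -
      have eq: "sum f G = sum f F0 + sum f (G - F0)" if "P G" for G
        using that by (metis P_def add.commute sum.subset_diff)
      have small: "norm (sum f (G - F0)) < \<epsilon>/2" if "P G" for G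
        using that by (intro F0(3)) (auto simp: P_def)
      show ?thesis
        using small[OF that(1)] small[OF that(2)] norm_triangle_ineq4[of "sum f (F - F0)" "sum f (F' - F0)"]
        by (simp add: eq[OF that(1)] eq[OF that(2)] dist_norm)
    qed
    ultimately show ?thesis by blast
  qed
  then have "cauchy_filter (filtermap (sum f) (finite_subsets_at_top A))"
    by (simp add: cauchy_filter_metric_filtermap)
  moreover have "complete (UNIV::'b set)"
    by (meson Cauchy_convergent UNIV_I complete_def convergent_def)
  ultimately obtain L where "(sum f \<longlongrightarrow> L) (finite_subsets_at_top A)"
    using complete_uniform[where S=UNIV] by (force simp add: filterlim_def)
  then show ?thesis
    using summable_on_def has_sum_def by blast
qed

lemma bounded_sum_tail:
  fixes a :: "'i \<Rightarrow> real"
  assumes a: "\<And>i. i \<in> A \<Longrightarrow> a i \<ge> 0" and bound: "\<And>F. finite F \<Longrightarrow> F \<subseteq> A \<Longrightarrow> sum a F \<le> B" and "\<epsilon> > 0"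
  obtains F0 where "finite F0" "F0 \<subseteq> A" "\<And>F. finite F \<Longrightarrow> F \<subseteq> A \<Longrightarrow> F \<inter> F0 = {} \<Longrightarrow> sum a F < \<epsilon>"
proof -
  have sm: "a summable_on A"
    by (rule nonneg_bdd_above_summable_on) (auto intro!: a bdd_aboveI2[where M=B] bound)
  then obtain F0 where F0: "finite F0" "F0 \<subseteq> A" "dist (sum a F0) (infsum a A) \<le> \<epsilon>/3"
    using infsum_finite_approximation[of a A "\<epsilon>/3"] \<open>\<epsilon> > 0\<close> by auto
  have "sum a F < \<epsilon>" if F: "finite F" "F \<subseteq> A" "F \<inter> F0 = {}" for F
  proof -
    have "sum a (F \<union> F0) \<le> infsum a A"
      by (rule finite_sum_le_infsum[OF sm]) (use F F0 a in auto)
    then have "sum a F + sum a F0 \<le> infsum a A" using F F0 by (simp add: sum.union_disjoint)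
    then show ?thesis using F0(3) \<open>\<epsilon> > 0\<close> unfolding dist_real_def by linarith
  qed
  then show ?thesis using that F0 by blast
qed

lemma pythagoras_sum:
  fixes f :: "'i \<Rightarrow> 'h::chilbert_space"
  assumes "finite F" "\<And>i j. i \<in> F \<Longrightarrow> j \<in> F \<Longrightarrow> i \<noteq> j \<Longrightarrow> cinner (f i) (f j) = 0"
  shows "(norm (sum f F))\<^sup>2 = (\<Sum>i\<in>F. (norm (f i))\<^sup>2)"
  using assms
proof (induction F)
  case (insert a F)
  have "cinner (f a) (sum f F) = 0"
    unfolding cinner_sum_right by (rule sum.neutral) (use insert in auto)
  then show ?case using insert by (simp add: norm_add_sq)
qed simp

lemma Bessel:
  fixes e :: "'i \<Rightarrow> ('h::chilbert_space \<Rightarrow>\<^sub>L 'h)"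
  assumes F: "finite F" and proj: "\<And>i. i \<in> F \<Longrightarrow> projection_op (e i)"
    and orth: "\<And>i j x y. i \<in> F \<Longrightarrow> j \<in> F \<Longrightarrow> i \<noteq> j \<Longrightarrow> cinner (e i x) (e j y) = 0"
  shows "(\<Sum>i\<in>F. (norm (e i x))\<^sup>2) \<le> (norm x)\<^sup>2"
proof -
  let ?y = "\<Sum>i\<in>F. e i x"
  have 1: "(norm ?y)\<^sup>2 = (\<Sum>i\<in>F. (norm (e i x))\<^sup>2)"
    by (rule pythagoras_sum[OF F]) (rule orth)
  have "cinner x (e i x) = complex_of_real ((norm (e i x))\<^sup>2)" if "i \<in> F" for i
    using proj[OF that] by (metis cinner_eq_norm projection_cinner projection_idem)
  then have "Re (cinner x ?y) = (\<Sum>i\<in>F. (norm (e i x))\<^sup>2)" by (simp add: cinner_sum_right)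
  then have "0 \<le> (norm x)\<^sup>2 - (\<Sum>i\<in>F. (norm (e i x))\<^sup>2)"
    using norm_diff_sq[of x ?y] 1 zero_le_power2[of "norm (x - ?y)"] by simp
  then show ?thesis by simp
qed

text \<open>Pythagoras for the values and Bessel for the \<open>e i\<close> bound both the partial
  sums and their tails, for index sets of any cardinality. The \<open>T i\<close> are bare
  functions, so that explicit formulas can be inserted without first being packaged as operators.
  Block diagonal projections, the operator \<open>T\<close> of \<open>corner_tail\<close> and the
  implementing unitary are all obtained in this way.\<close>

lemma orthogonal_strong_sum:
  fixes T :: "'i \<Rightarrow> 'h::chilbert_space \<Rightarrow> 'h" and e :: "'i \<Rightarrow> ('h \<Rightarrow>\<^sub>L 'h)"
  assumes add: "\<And>i x y. i \<in> I \<Longrightarrow> T i (x + y) = T i x + T i y"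
    and scale: "\<And>i c x. i \<in> I \<Longrightarrow> T i (c *\<^sub>C x) = c *\<^sub>C T i x"
    and proj: "\<And>i. i \<in> I \<Longrightarrow> projection_op (e i)"
    and orth: "\<And>i j x y. i \<in> I \<Longrightarrow> j \<in> I \<Longrightarrow> i \<noteq> j \<Longrightarrow> cinner (e i x) (e j y) = 0"
    and bound: "\<And>i x. i \<in> I \<Longrightarrow> norm (T i x) \<le> M * norm (e i x)"
    and orthT: "\<And>i j x y. i \<in> I \<Longrightarrow> j \<in> I \<Longrightarrow> i \<noteq> j \<Longrightarrow> cinner (T i x) (T j y) = 0"
    and M: "0 \<le> M"
  obtains s where "s \<in> bounded_ops" "norm s \<le> M" "\<And>x. ((\<lambda>i. T i x) has_sum s x) I"
proof -
  have sum_sq: "(norm (\<Sum>i\<in>F. T i x))\<^sup>2 \<le> M\<^sup>2 * (\<Sum>i\<in>F. (norm (e i x))\<^sup>2)"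
    if "finite F" "F \<subseteq> I" for F x
  proof -
    have "(norm (\<Sum>i\<in>F. T i x))\<^sup>2 = (\<Sum>i\<in>F. (norm (T i x))\<^sup>2)"
      by (rule pythagoras_sum[OF that(1)]) (use that(2) in \<open>blast intro: orthT\<close>)
    also have "\<dots> \<le> (\<Sum>i\<in>F. (M * norm (e i x))\<^sup>2)"
      by (intro sum_mono power_mono) (use that bound in auto)
    finally show ?thesis by (simp add: power_mult_distrib sum_distrib_left)
  qed
  have bessel: "(\<Sum>i\<in>F. (norm (e i x))\<^sup>2) \<le> (norm x)\<^sup>2" if "finite F" "F \<subseteq> I" for F x
    by (rule Bessel[OF that(1)]) (use that(2) in \<open>blast intro: proj orth\<close>)+
  have norm_sum: "norm (\<Sum>i\<in>F. T i x) \<le> norm x * M" if "finite F" "F \<subseteq> I" for F x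
  proof (rule power2_le_imp_le)
    have "(norm (\<Sum>i\<in>F. T i x))\<^sup>2 \<le> M\<^sup>2 * (norm x)\<^sup>2"
      using sum_sq[OF that] mult_left_mono[OF bessel[OF that], of "M\<^sup>2"] order_trans by fastforce
    then show "(norm (\<Sum>i\<in>F. T i x))\<^sup>2 \<le> (norm x * M)\<^sup>2" by (simp add: power_mult_distrib mult.commute)
  qed (simp add: M)
  have "(\<lambda>i. T i x) summable_on I" for x
  proof (rule summable_on_Cauchy)
    fix \<epsilon> :: real assume "\<epsilon> > 0"
    \<comment> \<open>The denominator \<open>M\<^sup>2 + 1\<close> is positive even for
      \<open>M = 0\<close>.\<close>
    define \<delta> where "\<delta> = \<epsilon>\<^sup>2 / (M\<^sup>2 + 1)"
    have M1: "M\<^sup>2 + 1 > 0" by (simp add: add_nonneg_pos)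
    then have "\<delta> > 0" using \<open>\<epsilon> > 0\<close> by (simp add: \<delta>_def)
    then obtain F0 where F0: "finite F0" "F0 \<subseteq> I"
      "\<And>F. finite F \<Longrightarrow> F \<subseteq> I \<Longrightarrow> F \<inter> F0 = {} \<Longrightarrow> (\<Sum>i\<in>F. (norm (e i x))\<^sup>2) < \<delta>"
      using bounded_sum_tail[of I "\<lambda>i. (norm (e i x))\<^sup>2" "(norm x)\<^sup>2" \<delta>] bessel by (metis zero_le_power2)
    have "norm (\<Sum>i\<in>F. T i x) < \<epsilon>" if "finite F" "F \<subseteq> I" "F \<inter> F0 = {}" for F
    proof (rule power2_less_imp_less)
      have "(norm (\<Sum>i\<in>F. T i x))\<^sup>2 \<le> M\<^sup>2 * (\<Sum>i\<in>F. (norm (e i x))\<^sup>2)" by (rule sum_sq[OF that(1,2)])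
      also have "\<dots> \<le> (M\<^sup>2 + 1) * (\<Sum>i\<in>F. (norm (e i x))\<^sup>2)"
        by (intro mult_right_mono) (auto intro: sum_nonneg)
      also have "\<dots> < (M\<^sup>2 + 1) * \<delta>" using F0(3)[OF that] M1 by (intro mult_strict_left_mono) auto
      also have "\<dots> = \<epsilon>\<^sup>2" using M1 by (simp add: \<delta>_def)
      finally show "(norm (\<Sum>i\<in>F. T i x))\<^sup>2 < \<epsilon>\<^sup>2" .
    qed (use \<open>\<epsilon> > 0\<close> in simp)
    then show "\<exists>F0. finite F0 \<and> F0 \<subseteq> I \<and> (\<forall>F. finite F \<and> F \<subseteq> I \<and> F \<inter> F0 = {} \<longrightarrow> norm (\<Sum>i\<in>F. T i x) < \<epsilon>)"
      using F0 by blast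
  qed
  then obtain S where S: "\<And>x. ((\<lambda>i. T i x) has_sum S x) I"
    unfolding summable_on_def by metis
  have S_add: "S (x + y) = S x + S y" for x y
  proof (rule has_sum_unique)
    show "((\<lambda>i. T i (x + y)) has_sum S (x + y)) I" by (rule S)
    have "((\<lambda>i. T i x + T i y) has_sum S x + S y) I" by (intro has_sum_add S)
    then show "((\<lambda>i. T i (x + y)) has_sum S x + S y) I"
      by (subst has_sum_cong[where g = "\<lambda>i. T i x + T i y"]) (auto simp: add)
  qed
  have S_scale: "S (c *\<^sub>C x) = c *\<^sub>C S x" for c x
  proof (rule has_sum_unique)
    show "((\<lambda>i. T i (c *\<^sub>C x)) has_sum S (c *\<^sub>C x)) I" by (rule S)
    have "((\<lambda>i. c *\<^sub>C T i x) has_sum c *\<^sub>C S x) I"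
      by (rule has_sum_bounded_linear[OF bounded_linear_scaleC S])
    then show "((\<lambda>i. T i (c *\<^sub>C x)) has_sum c *\<^sub>C S x) I"
      by (subst has_sum_cong[where g = "\<lambda>i. c *\<^sub>C T i x"]) (auto simp: scale)
  qed
  have S_norm: "norm (S x) \<le> norm x * M" for x
  proof (rule tendsto_upperbound)
    show "((\<lambda>F. norm (\<Sum>i\<in>F. T i x)) \<longlongrightarrow> norm (S x)) (finite_subsets_at_top I)"
      using S[of x] unfolding has_sum_def by (rule tendsto_norm)
    show "\<forall>\<^sub>F F in finite_subsets_at_top I. norm (\<Sum>i\<in>F. T i x) \<le> norm x * M"
      by (rule eventually_finite_subsets_at_top_weakI) (rule norm_sum)
  qed simp
  have bl: "bounded_linear S"
    by (rule bounded_linear_intro[where K = M]) (simp_all add: S_add S_scale scaleR_scaleC S_norm)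
  have s: "blinfun_apply (Blinfun S) x = S x" for x using bl by (simp add: bounded_linear_Blinfun_apply)
  show ?thesis
  proof (rule that[of "Blinfun S"])
    show "Blinfun S \<in> bounded_ops" by (simp add: bounded_ops_def s S_scale)
    show "norm (Blinfun S) \<le> M" by (rule norm_blinfun_bound[OF M]) (use S_norm in \<open>simp add: s mult.commute\<close>)
    show "((\<lambda>i. T i x) has_sum blinfun_apply (Blinfun S) x) I" for x using S by (simp add: s)
  qed
qed

section \<open>Gliding humps and products of compact sets\<close>

lemma sum_inverse_powers_le_1:
  assumes "finite A" shows "(\<Sum>m\<in>A. (1/2 :: real) ^ Suc m) \<le> 1"
proof -
  have eq: "(\<Sum>m<N. (1/2 :: real) ^ Suc m) = 1 - (1/2) ^ N" for N
    by (induction N) simp_all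
  obtain N where "A \<subseteq> {..<N}" using assms finite_nat_iff_bounded by blast
  then have "(\<Sum>m\<in>A. (1/2 :: real) ^ Suc m) \<le> (\<Sum>m<N. (1/2 :: real) ^ Suc m)"
    by (intro sum_mono2) auto
  then show ?thesis unfolding eq using zero_le_power[of "1/2::real" N] by linarith
qed

text \<open>Dependent choice with the whole history: each element is chosen against the finite set
  \<open>L n\<close> of all earlier ones. That set forgets the stages, which is why the premise only
  knows \<open>P m a\<close> for some \<open>m\<close>.\<close>

lemma gliding_hump:
  assumes step: "\<And>n A. finite A \<Longrightarrow> (\<And>a. a \<in> A \<Longrightarrow> \<exists>m. P m a) \<Longrightarrow> \<exists>x. P n x \<and> (\<forall>a\<in>A. R n a x)"
  shows "\<exists>f :: nat \<Rightarrow> 'a. (\<forall>n. P n (f n)) \<and> (\<forall>m n. m < n \<longrightarrow> R n (f m) (f n))"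
proof -
  define g where "g n A = (SOME x. P n x \<and> (\<forall>a\<in>A. R n a x))" for n A
  define L where "L = rec_nat {} (\<lambda>n A. insert (g n A) A)"
  define f where "f n = g n (L n)" for n
  have L0: "L 0 = {}" and LS: "L (Suc n) = insert (f n) (L n)" for n
    by (simp_all add: L_def f_def)
  have g: "P n (g n A) \<and> (\<forall>a\<in>A. R n a (g n A))" if "finite A" "\<And>a. a \<in> A \<Longrightarrow> \<exists>m. P m a" for n A
    unfolding g_def by (rule someI_ex) (rule step[OF that])
  have L: "finite (L n) \<and> (\<forall>a\<in>L n. \<exists>m. P m a)" for n
  proof (induction n)
    case (Suc n)
    then have "P n (f n)" unfolding f_def using g[of "L n" n] by simp
    then show ?case using Suc by (auto simp: LS)
  qed (simp add: L0)
  have mem: "m < n \<Longrightarrow> f m \<in> L n" for m n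
    by (induction n) (auto simp: LS less_Suc_eq)
  show ?thesis
  proof (intro exI[of _ f] conjI allI impI)
    show "P n (f n)" for n unfolding f_def using g[of "L n" n] L[of n] by simp
    show "R n (f m) (f n)" if "m < n" for m n
      using g[of "L n" n] L[of n] mem[OF \<open>m < n\<close>] unfolding f_def[of n] by simp
  qed
qed

lemma disjoint_avoids_finite:
  fixes G :: "nat \<Rightarrow> 'i set"
  assumes disj: "\<And>m n. m < n \<Longrightarrow> G m \<inter> G n = {}" and "finite B"
  obtains n where "G n \<inter> B = {}"
proof (rule ccontr)
  assume "\<not> thesis"
  then have "\<forall>n. \<exists>b. b \<in> G n \<inter> B" using that by blast
  then obtain h where h: "\<And>n. h n \<in> G n \<inter> B" by metis
  have "inj h"
  proof (rule injI, rule ccontr)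
    fix m n assume "h m = h n" "m \<noteq> n"
    then show False using disj[of m n] disj[of n m] h[of m] h[of n] by (auto simp: neq_iff)
  qed
  moreover have "range h \<subseteq> B" using h by auto
  ultimately show False using \<open>finite B\<close> by (meson finite_imageD finite_subset infinite_UNIV_nat)
qed

lemma disjoint_index_unique:
  fixes G :: "nat \<Rightarrow> 'i set"
  assumes disj: "\<And>m n. m < n \<Longrightarrow> G m \<inter> G n = {}" and "i \<in> G m" "i \<in> G n" shows "m = n"
  using disj[of m n] disj[of n m] assms(2,3) by (cases m n rule: linorder_cases) auto

lemma continuous_on_eval: "continuous_on UNIV (\<lambda>b :: 'a \<Rightarrow> 'b::topological_space. b p)"
  by (rule continuous_on_product_then_coordinatewise[OF continuous_on_id])

text \<open>Tychonoff's theorem on a function type, whose topology is that of pointwise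
  convergence.\<close>

lemma compact_Pi_UNIV:
  fixes K :: "'a \<Rightarrow> 'b::topological_space set"
  assumes "\<And>p. compact (K p)" shows "compact (Pi UNIV K)"
proof -
  have "compactin (product_topology (\<lambda>i. euclidean) UNIV) (PiE UNIV K)"
    unfolding compactin_PiE using assms by simp
  then show ?thesis by (simp add: euclidean_product_topology PiE_UNIV_domain)
qed

section \<open>Modules over a locally finite coarse space\<close>

text \<open>\<open>e S\<close> is the projection onto the part of the module over \<open>S\<close>; an index with \<open>e {i} = 0\<close> is harmless, so
  that the index set can be taken to be a whole type.\<close>

locale block_module =
  fixes e :: "'i set \<Rightarrow> ('h::chilbert_space \<Rightarrow>\<^sub>L 'h)" and near :: "nat \<Rightarrow> 'i \<Rightarrow> 'i \<Rightarrow> bool"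
  assumes e_proj: "projection_op (e S)"
    and e_compose: "e S o\<^sub>L e T = e (S \<inter> T)"
    and e_Un: "S \<inter> T = {} \<Longrightarrow> e (S \<union> T) = e S + e T"
    and e_UNIV: "e UNIV = id_blinfun"
    and e_dense: "\<epsilon> > 0 \<Longrightarrow> \<exists>F. finite F \<and> norm (v - e F v) \<le> \<epsilon>"
    and near_refl: "near n i i"
    and near_sym: "near n i j \<Longrightarrow> near n j i"
    and near_trans: "near m i j \<Longrightarrow> near n j k \<Longrightarrow> near (m + n) i k"
    and near_finite: "finite {j. near n i j}"
begin

section \<open>Elementary calculus of the block projections\<close>

lemma e_bounded_ops [intro, simp]: "e S \<in> bounded_ops"
  by (rule projection_bounded[OF e_proj])

lemma e_e [simp]: "e S (e T x) = e (S \<inter> T) x"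
  by (metis e_compose blinfun_apply_blinfun_compose)

lemma e_empty [simp]: "e {} = 0"
  using e_Un[of "{}" "{}"] by simp

lemma e_compl: "e (- S) = id_blinfun - e S"
  using e_Un[of S "- S"] by (simp add: e_UNIV algebra_simps)

lemma e_compl_apply: "e (- S) x = x - e S x"
  by (simp add: e_compl blinfun.diff_left)

lemma e_split: "x = e S x + e (- S) x"
  by (simp add: e_compl_apply)

lemma e_cinner: "cinner (e S x) y = cinner x (e S y)"
  by (rule projection_cinner[OF e_proj])

lemma e_adj: "adj (e S) = e S"
  by (rule projection_adj[OF e_proj])

lemma e_orth: "S \<inter> T = {} \<Longrightarrow> cinner (e S x) (e T y) = 0"
  by (simp add: e_cinner)

lemma e_norm_le: "norm (e S x) \<le> norm x"
  by (rule projection_norm_le[OF e_proj])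

lemma e_norm: "norm (e S) \<le> 1"
  by (rule projection_norm[OF e_proj])

lemma e_norm_mono: "S \<subseteq> T \<Longrightarrow> norm (e S x) \<le> norm (e T x)"
  using e_norm_le[of S "e T x"] by (simp add: Int_absorb2)

lemma e_finite: "finite F \<Longrightarrow> e F x = (\<Sum>i\<in>F. e {i} x)"
proof (induction F rule: finite_induct)
  case (insert a F)
  then show ?case using e_Un[of "{a}" F] by (simp add: blinfun.add_left)
qed simp

lemma e_dense_compl:
  assumes "\<epsilon> > 0" obtains F where "finite F" "\<And>G. F \<subseteq> G \<Longrightarrow> norm (e (- G) v) \<le> \<epsilon>"
proof -
  obtain F where "finite F" "norm (e (- F) v) \<le> \<epsilon>"
    using e_dense[OF assms, of v] by (auto simp: e_compl_apply)
  then show ?thesis using that by (meson Compl_anti_mono e_norm_mono order_trans)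
qed

lemma e_ext: assumes "\<And>i. e {i} x = e {i} y" shows "x = y"
proof -
  have "norm (x - y) \<le> 0 + \<epsilon>" if "\<epsilon> > 0" for \<epsilon>
  proof -
    obtain F where F: "finite F" "\<And>G. F \<subseteq> G \<Longrightarrow> norm (e (- G) (x - y)) \<le> \<epsilon>" using e_dense_compl[OF \<open>\<epsilon> > 0\<close>] by blast
    have "e F (x - y) = 0" using assms by (simp add: e_finite[OF F(1)] blinfun.diff_right)
    then show ?thesis using F(2)[OF order_refl] by (simp add: e_compl_apply)
  qed
  then have "norm (x - y) \<le> 0" by (rule field_le_epsilon)
  then show ?thesis by simp
qed

lemma e_ext_left: assumes "\<And>i. e {i} o\<^sub>L s = e {i} o\<^sub>L t" shows "s = t"
  by (rule blinfun_eqI, rule e_ext) (metis assms blinfun_apply_blinfun_compose)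

lemma e_ext_right:
  assumes "\<And>i. s o\<^sub>L e {i} = t o\<^sub>L e {i}" shows "s = (t :: 'h \<Rightarrow>\<^sub>L 'h)"
proof (rule blinfun_eqI)
  fix x
  have "norm (s x - t x) \<le> 0 + \<epsilon>" if "\<epsilon> > 0" for \<epsilon>
  proof -
    have "\<epsilon> / (norm (s - t) + 1) > 0" using that by (simp add: add_nonneg_pos)
    then obtain F where F: "finite F" "norm (x - e F x) \<le> \<epsilon> / (norm (s - t) + 1)" using e_dense by blast
    have "s (e {i} x) = t (e {i} x)" for i by (metis assms blinfun_apply_blinfun_compose)
    then have "(s - t) (e F x) = 0"
      by (simp add: e_finite[OF F(1)] blinfun.sum_right blinfun.diff_left)
    then have "s x - t x = (s - t) (x - e F x)"
      by (simp add: blinfun.diff_left blinfun.diff_right)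
    then have "norm (s x - t x) \<le> norm (s - t) * norm (x - e F x)" by (simp add: norm_blinfun)
    also have "\<dots> \<le> (norm (s - t) + 1) * norm (x - e F x)" by (intro mult_right_mono) auto
    also have "\<dots> \<le> \<epsilon>" using F(2) by (simp add: pos_le_divide_eq add_nonneg_pos mult.commute)
    finally show ?thesis by simp
  qed
  then have "norm (s x - t x) \<le> 0" by (rule field_le_epsilon)
  then show "s x = t x" by simp
qed

lemma e_ext_both:
  fixes s t :: "'h \<Rightarrow>\<^sub>L 'h"
  assumes "\<And>i j x. e {j} (s (e {i} x)) = e {j} (t (e {i} x))" shows "s = t"
  by (rule e_ext_right, rule e_ext_left, rule blinfun_eqI) (simp add: assms)

lemma e_sq_sum: "finite F \<Longrightarrow> (norm (e F x))\<^sup>2 = (\<Sum>i\<in>F. (norm (e {i} x))\<^sup>2)"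
  by (subst e_finite, assumption, rule pythagoras_sum) (auto intro: e_orth)

lemma norm_le_e_bound:
  fixes t :: "'h \<Rightarrow>\<^sub>L 'h"
  assumes "\<And>F x. finite F \<Longrightarrow> norm (e F (t x)) \<le> M * norm x" "0 \<le> M" shows "norm t \<le> M"
proof (rule norm_blinfun_bound[OF assms(2)])
  fix x
  show "norm (t x) \<le> M * norm x"
  proof (rule field_le_epsilon)
    fix \<epsilon> :: real assume "\<epsilon> > 0"
    then obtain F where F: "finite F" "norm (t x - e F (t x)) \<le> \<epsilon>" using e_dense by blast
    have "norm (t x) \<le> norm (e F (t x)) + norm (t x - e F (t x))"
      using norm_triangle_ineq[of "e F (t x)" "t x - e F (t x)"] by simp
    then show "norm (t x) \<le> M * norm x + \<epsilon>" using F assms(1)[OF F(1), of x] by linarith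
  qed
qed

lemma near_mono: "near m i j \<Longrightarrow> m \<le> n \<Longrightarrow> near n i j"
  using near_trans[of m i j "n - m" j] near_refl by simp

lemma near_finite_set: "finite F \<Longrightarrow> finite {j. \<exists>i\<in>F. near n i j}"
proof -
  assume "finite F"
  have "{j. \<exists>i\<in>F. near n i j} = (\<Union>i\<in>F. {j. near n i j})" by blast
  then show ?thesis using near_finite \<open>finite F\<close> by simp
qed

section \<open>Band operators, local compactness and the two algebras\<close>

definition propag :: "nat \<Rightarrow> ('h \<Rightarrow>\<^sub>L 'h) \<Rightarrow> bool" where
  "propag n t \<longleftrightarrow> t \<in> bounded_ops \<and> (\<forall>i j x. \<not> near n j i \<longrightarrow> e {j} (t (e {i} x)) = 0)"

definition lc :: "('h \<Rightarrow>\<^sub>L 'h) \<Rightarrow> bool" where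
  "lc t \<longleftrightarrow> (\<forall>i. compact_op (t o\<^sub>L e {i}) \<and> compact_op (e {i} o\<^sub>L t))"

definition cp :: "('h \<Rightarrow>\<^sub>L 'h) set" where
  "cp = closure {t. \<exists>n. propag n t}"

definition roe :: "('h \<Rightarrow>\<^sub>L 'h) set" where
  "roe = closure {t. (\<exists>n. propag n t) \<and> lc t}"

lemma propag_bounded: "propag n t \<Longrightarrow> t \<in> bounded_ops"
  by (simp add: propag_def)

text \<open>An operator is determined by its entries between single blocks. For the compression
  \<open>e T o\<^sub>L t o\<^sub>L e S\<close> they vanish, by hypothesis inside \<open>S\<close>
  and \<open>T\<close> and trivially elsewhere, so infinite \<open>S\<close> and \<open>T\<close>
  are covered although \<open>e\<close> is only finitely additive.\<close>

lemma e_zero_between: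
  fixes t :: "'h \<Rightarrow>\<^sub>L 'h"
  assumes "\<And>i j x. i \<in> S \<Longrightarrow> j \<in> T \<Longrightarrow> e {j} (t (e {i} x)) = 0"
  shows "e T (t (e S x)) = 0"
proof -
  have "e {j} ((e T o\<^sub>L t o\<^sub>L e S) (e {i} x)) = e {j} ((0 :: 'h \<Rightarrow>\<^sub>L 'h) (e {i} x))" for i j x
  proof (cases "i \<in> S \<and> j \<in> T")
    case True
    then show ?thesis using assms[of i j x] by (simp add: Int_absorb1 Int_insert_left Int_commute)
  next
    case False
    then have "{j} \<inter> T = {} \<or> S \<inter> {i} = {}" by auto
    then show ?thesis by auto
  qed
  then have "e T o\<^sub>L t o\<^sub>L e S = 0" by (rule e_ext_both)
  from arg_cong[OF this, of "\<lambda>s. blinfun_apply s x"] show ?thesis by simp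
qed

lemma propag_far:
  assumes "propag n t" "\<And>i j. i \<in> S \<Longrightarrow> j \<in> T \<Longrightarrow> \<not> near n j i"
  shows "e T (t (e S x)) = 0"
  by (rule e_zero_between) (use assms in \<open>auto simp: propag_def\<close>)

lemma propag_support_left:
  assumes "propag n t" shows "t (e S x) = e {j. \<exists>i\<in>S. near n i j} (t (e S x))"
proof -
  have "e (- {j. \<exists>i\<in>S. near n i j}) (t (e S x)) = 0"
    by (rule propag_far[OF assms]) (auto dest: near_sym)
  then show ?thesis using e_split by (metis add.right_neutral)
qed

lemma propag_support_right:
  assumes "propag n t" shows "e S (t x) = e S (t (e {j. \<exists>i\<in>S. near n i j} x))"
proof -
  have "e S (t (e (- {j. \<exists>i\<in>S. near n i j}) x)) = 0"
    by (rule propag_far[OF assms]) auto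
  then have "e S (t (e {j. \<exists>i\<in>S. near n i j} x + e (- {j. \<exists>i\<in>S. near n i j}) x)) =
      e S (t (e {j. \<exists>i\<in>S. near n i j} x))"
    by (simp only: blinfun.add_right add_0_right)
  then show ?thesis by (simp only: e_split[symmetric])
qed

lemma propag_mono: "propag m t \<Longrightarrow> m \<le> n \<Longrightarrow> propag n t"
  unfolding propag_def using near_mono by blast

lemma propag_add: "propag n s \<Longrightarrow> propag n t \<Longrightarrow> propag n (s + t)"
  by (auto simp: propag_def blinfun.add_left blinfun.add_right)

lemma propag_compose:
  assumes s: "propag m s" and t: "propag n t" shows "propag (m + n) (s o\<^sub>L t)"
  unfolding propag_def
proof (intro conjI allI impI)
  fix i j x assume "\<not> near (m + n) j i"
  then have "e {j} (s (e {k. \<exists>i'\<in>{i}. near n i' k} (t (e {i} x)))) = 0"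
  proof (intro propag_far[OF s])
    fix k j' assume k: "k \<in> {k. \<exists>i'\<in>{i}. near n i' k}" and j': "j' \<in> {j}"
    then have "near n k i" by (auto intro: near_sym)
    then show "\<not> near m j' k" using \<open>\<not> near (m + n) j i\<close> near_trans[of m j k n i] j' by auto
  qed
  then show "e {j} ((s o\<^sub>L t) (e {i} x)) = 0"
    using propag_support_left[OF t, of "{i}" x] by simp
qed (use s t propag_bounded in blast)

lemma propag_adj: assumes "propag n t" shows "propag n (adj t)"
  unfolding propag_def
proof (intro conjI allI impI)
  have b: "t \<in> bounded_ops" using assms by (rule propag_bounded)
  then show "adj t \<in> bounded_ops" by auto
  fix i j x assume "\<not> near n j i"
  then have "\<not> near n i j" using near_sym by blast
  then have far: "e {i} (t (e {j} y)) = 0" for y using assms by (simp add: propag_def)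
  show "e {j} (adj t (e {i} x)) = 0"
  proof (rule cinner_ext)
    fix z show "cinner z (e {j} (adj t (e {i} x))) = cinner z 0"
      by (simp flip: e_cinner add: cinner_adj_right[OF b] far)
  qed
qed

lemma propag_e: "propag n (e S)"
  by (auto simp: propag_def Int_insert_left near_refl)

lemma propag_e_compose: "propag n t \<Longrightarrow> propag n (e S o\<^sub>L t)" "propag n t \<Longrightarrow> propag n (t o\<^sub>L e S)"
  using propag_compose[OF propag_e[of 0]] propag_compose[OF _ propag_e[of 0]] by auto

lemma propag_corner:
  assumes "t \<in> bounded_ops" "\<And>i j. i \<in> S \<Longrightarrow> j \<in> T \<Longrightarrow> near n j i" shows "propag n (e T o\<^sub>L t o\<^sub>L e S)"
  unfolding propag_def
proof (intro conjI allI impI)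
  fix i j x assume "\<not> near n j i"
  then have "S \<inter> {i} = {} \<or> {j} \<inter> T = {}" using assms(2) by blast
  then show "e {j} ((e T o\<^sub>L t o\<^sub>L e S) (e {i} x)) = 0" by auto
qed (use assms in auto)

lemma propag_ketbra:
  assumes "e {i} x = x" "e {j} y = y" "near n i j" shows "propag n (ketbra x y)"
proof -
  have "e {i} o\<^sub>L ketbra x y o\<^sub>L e {j} = ketbra x y"
    by (simp add: compose_ketbra ketbra_compose e_adj assms)
  moreover have "propag n (e {i} o\<^sub>L ketbra x y o\<^sub>L e {j})" by (rule propag_corner) (use assms in auto)
  ultimately show ?thesis by simp
qed

lemma lc_ketbra: "lc (ketbra x y)"
  by (simp add: lc_def compose_ketbra ketbra_compose)

lemma compact_e_finite_left:
  assumes "\<And>i. compact_op (e {i} o\<^sub>L t)" "finite F" shows "compact_op (e F o\<^sub>L t)"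
proof -
  have "e F o\<^sub>L t = (\<Sum>i\<in>F. e {i} o\<^sub>L t)"
    by (rule blinfun_eqI) (simp add: e_finite[OF assms(2)] blinfun.sum_left)
  then show ?thesis using assms(1) by auto
qed

lemma compact_e_finite_right:
  assumes "\<And>i. compact_op (t o\<^sub>L e {i})" "finite F" shows "compact_op (t o\<^sub>L e F)"
proof -
  have "t o\<^sub>L e F = (\<Sum>i\<in>F. t o\<^sub>L e {i})"
    by (rule blinfun_eqI) (simp add: e_finite[OF assms(2)] blinfun.sum_left blinfun.sum_right)
  then show ?thesis using assms(1) by auto
qed

text \<open>Local finiteness enters here: row \<open>i\<close> of \<open>s\<close> sees only the
  finitely many blocks near \<open>i\<close>, and over those \<open>t\<close> has compact
  rows.\<close>

lemma lc_compose_left: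
  assumes s: "propag n s" and t: "lc t" shows "lc (s o\<^sub>L t)"
  unfolding lc_def
proof (intro allI conjI)
  fix i
  show "compact_op (s o\<^sub>L t o\<^sub>L e {i})"
    using t propag_bounded[OF s] unfolding lc_def by (simp add: blinfun_compose_assoc compact_op_compose_left)
  let ?N = "{j. \<exists>i\<in>{i}. near n i j}"
  have "e {i} o\<^sub>L (s o\<^sub>L t) = (e {i} o\<^sub>L s) o\<^sub>L (e ?N o\<^sub>L t)"
    by (rule blinfun_eqI) (use propag_support_right[OF s, of "{i}"] in simp)
  moreover have "compact_op (e ?N o\<^sub>L t)"
    by (rule compact_e_finite_left[OF _ near_finite_set]) (use t in \<open>auto simp: lc_def\<close>)
  ultimately show "compact_op (e {i} o\<^sub>L (s o\<^sub>L t))"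
    using propag_bounded[OF s] by (simp add: compact_op_compose_left bounded_ops_compose)
qed

lemma lc_adj: "lc t \<Longrightarrow> t \<in> bounded_ops \<Longrightarrow> lc (adj t)"
  unfolding lc_def
proof (intro allI conjI)
  fix i
  assume lc: "\<forall>i. compact_op (t o\<^sub>L e {i}) \<and> compact_op (e {i} o\<^sub>L t)" and t: "t \<in> bounded_ops"
  show "compact_op (adj t o\<^sub>L e {i})"
    using compact_op_adj[of "e {i} o\<^sub>L t"] lc t by (simp add: adj_compose e_adj)
  show "compact_op (e {i} o\<^sub>L adj t)"
    using compact_op_adj[of "t o\<^sub>L e {i}"] lc t by (simp add: adj_compose e_adj)
qed

lemma lc_compose_right:
  assumes t: "lc t" "t \<in> bounded_ops" and s: "propag n s" shows "lc (t o\<^sub>L s)"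
proof -
  have sb: "s \<in> bounded_ops" by (rule propag_bounded[OF s])
  have "lc (adj s o\<^sub>L adj t)" by (rule lc_compose_left[OF propag_adj[OF s] lc_adj[OF t]])
  then have "lc (adj (adj s o\<^sub>L adj t))" using sb t(2) by (intro lc_adj) auto
  then show ?thesis using sb t(2) by (simp add: adj_compose adj_adj adj_bounded_ops)
qed

section \<open>Algebraic structure of the two closures\<close>

lemma roe_subset_cp: "roe \<subseteq> cp"
  unfolding roe_def cp_def by (rule closure_mono) blast

lemma cp_bounded: "t \<in> cp \<Longrightarrow> t \<in> bounded_ops"
  using closure_minimal[OF _ closed_bounded_ops, of "{t. \<exists>n. propag n t}"] propag_bounded unfolding cp_def by blast

lemma roe_bounded: "t \<in> roe \<Longrightarrow> t \<in> bounded_ops"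
  using roe_subset_cp cp_bounded by blast

lemma propag_in_cp: "propag n t \<Longrightarrow> t \<in> cp"
  unfolding cp_def by (rule subsetD[OF closure_subset]) auto

lemma propag_lc_in_roe: "propag n t \<Longrightarrow> lc t \<Longrightarrow> t \<in> roe"
  unfolding roe_def by (rule subsetD[OF closure_subset]) auto

lemma cp_compose:
  assumes "s \<in> cp" "t \<in> cp" shows "s o\<^sub>L t \<in> cp"
  unfolding cp_def
  by (rule closure_compose[OF assms[unfolded cp_def]]) (auto intro: propag_compose)

lemma cp_roe_compose:
  assumes "s \<in> cp" "t \<in> roe" shows "s o\<^sub>L t \<in> roe"
  unfolding roe_def
  by (rule closure_compose[OF assms[unfolded cp_def roe_def]]) (auto intro: propag_compose lc_compose_left)

lemma roe_cp_compose:
  assumes "s \<in> roe" "t \<in> cp" shows "s o\<^sub>L t \<in> roe"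
  unfolding roe_def
  by (rule closure_compose[OF assms[unfolded cp_def roe_def]])
    (auto intro: propag_compose lc_compose_right propag_bounded)

lemma roe_compose: "s \<in> roe \<Longrightarrow> t \<in> roe \<Longrightarrow> s o\<^sub>L t \<in> roe"
  using roe_cp_compose roe_subset_cp by blast

lemma closed_roe: "closed roe"
  by (simp add: roe_def)

lemma roe_adj: assumes t: "t \<in> roe" shows "adj t \<in> roe"
  unfolding roe_def
proof (rule closure_normI)
  fix \<epsilon> :: real assume "\<epsilon> > 0"
  then obtain s n where s: "propag n s" "lc s" "norm (t - s) \<le> \<epsilon>"
    using closure_normD[OF t[unfolded roe_def]] by blast
  have "norm (adj t - adj s) \<le> \<epsilon>"
    using s roe_bounded[OF t] propag_bounded[OF s(1)] by (metis adj_diff bounded_ops_diff norm_adj)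
  then show "\<exists>s\<in>{t. (\<exists>n. propag n t) \<and> lc t}. norm (adj t - s) \<le> \<epsilon>"
    using propag_adj[OF s(1)] lc_adj[OF s(2) propag_bounded[OF s(1)]] by blast
qed

text \<open>Cutting to a block does not increase norms, and norm limits of compact operators are
  compact, so local compactness survives the closure.\<close>

lemma roe_lc:
  assumes t: "t \<in> roe" shows "lc t"
  unfolding lc_def
proof (intro allI conjI)
  fix i
  have *: "\<exists>s. lc s \<and> norm (t - s) \<le> \<epsilon>" if "\<epsilon> > 0" for \<epsilon>
    using closure_normD[OF t[unfolded roe_def] that] by blast
  have tb: "t \<in> bounded_ops" by (rule roe_bounded[OF t])
  have 1: "norm ((t - s) o\<^sub>L e {i}) \<le> \<epsilon>" if "norm (t - s) \<le> \<epsilon>" for s \<epsilon>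
    using norm_compose_le[OF that e_norm] by simp
  have 2: "norm (e {i} o\<^sub>L (t - s)) \<le> \<epsilon>" if "norm (t - s) \<le> \<epsilon>" for s \<epsilon>
    using norm_compose_le[OF e_norm that] by simp
  show "compact_op (t o\<^sub>L e {i})"
  proof (rule compact_op_limit)
    fix \<epsilon> :: real assume "\<epsilon> > 0"
    then obtain s where "lc s" "norm (t - s) \<le> \<epsilon>" using * by blast
    then show "\<exists>s. compact_op s \<and> norm ((t o\<^sub>L e {i}) - s) \<le> \<epsilon>"
      using 1[of s] by (intro exI[of _ "s o\<^sub>L e {i}"]) (simp add: lc_def blinfun_compose_diff_left)
  qed (use tb in auto)
  show "compact_op (e {i} o\<^sub>L t)"
  proof (rule compact_op_limit)
    fix \<epsilon> :: real assume "\<epsilon> > 0"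
    then obtain s where "lc s" "norm (t - s) \<le> \<epsilon>" using * by blast
    then show "\<exists>s. compact_op s \<and> norm ((e {i} o\<^sub>L t) - s) \<le> \<epsilon>"
      using 2[of s] by (intro exI[of _ "e {i} o\<^sub>L s"]) (simp add: lc_def blinfun_compose_diff_right)
  qed (use tb in auto)
qed

text \<open>Its classes are the coarse components: indices at finite distance from one
  another.\<close>

definition conn :: "'i \<Rightarrow> 'i \<Rightarrow> bool" where "conn i j \<longleftrightarrow> (\<exists>n. near n i j)"

lemma conn_refl: "conn i i" and conn_sym: "conn i j \<Longrightarrow> conn j i"
  and conn_trans: "conn i j \<Longrightarrow> conn j k \<Longrightarrow> conn i k"
  unfolding conn_def using near_refl near_sym near_trans by blast+

lemma cp_not_conn:
  assumes t: "t \<in> cp" and "\<not> conn j i" shows "e {j} (t (e {i} x)) = 0"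
proof -
  have "closed {t. e {j} (blinfun_apply t (e {i} x)) = 0}"
    by (intro closed_Collect_eq) (auto intro!: continuous_intros)
  moreover have "{t. \<exists>n. propag n t} \<subseteq> {t. e {j} (blinfun_apply t (e {i} x)) = 0}"
    using assms(2) by (auto simp: propag_def conn_def)
  ultimately show ?thesis using closure_minimal t unfolding cp_def by blast
qed

lemma cp_component:
  assumes t: "t \<in> cp" shows "e {i} (t x) = e {i} (t (e {j. conn i j} x))"
proof -
  have "e {i} (t (e (- {j. conn i j}) x)) = 0"
    by (rule e_zero_between) (use cp_not_conn[OF t] in auto)
  then have "e {i} (t (e {j. conn i j} x + e (- {j. conn i j}) x)) = e {i} (t (e {j. conn i j} x))"
    by (simp only: blinfun.add_right add_0_right)
  then show ?thesis by (simp only: e_split[symmetric])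
qed

lemma countable_conn: "countable {j. conn i j}"
proof -
  have "{j. conn i j} = (\<Union>n. {j. near n i j})" by (auto simp: conn_def)
  then show ?thesis using near_finite by (simp add: countable_finite)
qed

section \<open>Block diagonal projections\<close>

text \<open>\<open>q\<close> is the strong sum of the \<open>p i\<close>, and its properties are
  checked block by block through \<open>e {i} (q x) = p i x\<close>. On each block it is a single
  compact \<open>p i\<close>, so it lies in \<open>roe\<close> even when infinitely many
  \<open>p i\<close> are nonzero and \<open>q\<close> is not compact.\<close>

lemma block_diagonal:
  assumes proj: "\<And>i. projection_op (p i)" and cpt: "\<And>i. compact_op (p i)" and sub: "\<And>i x. e {i} (p i x) = p i x"
  obtains q where "projection_op q" "propag 0 q" "lc q" "q \<in> roe"
    "\<And>i x. e {i} (q x) = p i x" "\<And>S x. e S (q x) = q (e S x)"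
proof -
  have sub': "p i (e {i} x) = p i x" for i x
    by (rule cinner_ext) (simp flip: projection_cinner[OF proj] e_cinner add: sub)
  have orth: "cinner (p i x) (p j y) = 0" if "i \<noteq> j" for i j x y
    using e_orth[of "{i}" "{j}" "p i x" "p j y"] that by (simp add: sub)
  have b: "norm (p i x) \<le> 1 * norm (e {i} x)" for i x
    using projection_norm_le[OF proj[of i], of "e {i} x"] by (simp add: sub')
  obtain q where q: "q \<in> bounded_ops" and hs: "\<And>x. ((\<lambda>i. p i x) has_sum q x) UNIV"
  proof (rule orthogonal_strong_sum[of UNIV "\<lambda>i. blinfun_apply (p i)" "\<lambda>i. e {i}" 1])
    show "cinner (e {i} x) (e {j} y) = 0" if "i \<noteq> j" for i j x y using that by (intro e_orth) auto
    show "p i (c *\<^sub>C x) = c *\<^sub>C p i x" for i c x by (rule bounded_opsD[OF projection_bounded[OF proj]])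
    show "norm (p i x) \<le> 1 * norm (e {i} x)" for i x by (rule b)
  qed (auto simp: blinfun.add_right e_proj orth intro: that)
  have eq: "e {j} (q x) = p j x" for j x
  proof (rule has_sum_unique)
    show "((\<lambda>i. e {j} (p i x)) has_sum e {j} (q x)) UNIV"
      by (rule has_sum_bounded_linear[OF blinfun.bounded_linear_right hs])
    have "e {j} (p i x) = 0" if "i \<noteq> j" for i
      using e_e[of "{j}" "{i}" "p i x"] that by (simp add: sub)
    then show "((\<lambda>i. e {j} (p i x)) has_sum p j x) UNIV"
      by (intro has_sum_finite_neutralI[of "{j}"]) (auto simp: sub)
  qed
  have pe: "p j (e S x) = e S (p j x)" for j S x
  proof (cases "j \<in> S")
    case True
    have "p j (e S x) = p j (e {j} (e S x))" by (rule sub'[symmetric])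
    also have "\<dots> = p j x" using True by (simp add: sub')
    also have "\<dots> = e S (p j x)" using True e_e[of S "{j}" "p j x"] by (simp add: sub)
    finally show ?thesis .
  next
    case False
    then have "p j (e S x) = 0" using sub'[of j "e S x"] by simp
    moreover have "e S (p j x) = 0" using False e_e[of S "{j}" "p j x"] by (simp add: sub)
    ultimately show ?thesis by simp
  qed
  have comm: "e S (q x) = q (e S x)" for S x
  proof (rule e_ext)
    fix j
    have "e {j} (e S (q x)) = e S (e {j} (q x))" by (simp add: Int_commute)
    then show "e {j} (e S (q x)) = e {j} (q (e S x))" by (simp only: eq pe)
  qed
  have idem: "q (q x) = q x" for x
  proof (rule e_ext)
    fix j
    have "e {j} (q (q x)) = p j (q x)" by (rule eq)
    also have "\<dots> = p j (e {j} (q x))" by (rule sub'[symmetric])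
    also have "\<dots> = e {j} (q x)" by (simp only: eq projection_idem[OF proj])
    finally show "e {j} (q (q x)) = e {j} (q x)" .
  qed
  have "adj q = q"
  proof (rule e_ext_right, rule blinfun_eqI_cinner)
    fix j x y
    have "cinner y (adj q (e {j} x)) = cinner (e {j} (q y)) x"
      by (simp add: cinner_adj_right[OF q] e_cinner)
    also have "\<dots> = cinner y (e {j} (q x))" by (simp add: eq projection_cinner[OF proj])
    finally show "cinner y ((adj q o\<^sub>L e {j}) x) = cinner y ((q o\<^sub>L e {j}) x)" by (simp add: comm)
  qed
  then have proj_q: "projection_op q"
    using q idem by (auto simp: projection_op_def intro: blinfun_eqI)
  have prop_q: "propag 0 q"
    unfolding propag_def
  proof (intro conjI allI impI)
    fix i j x assume "\<not> near 0 j i"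
    then have "{j} \<inter> {i} = {}" using near_refl by auto
    then show "e {j} (q (e {i} x)) = 0" by (simp flip: comm)
  qed (rule q)
  have "e {i} o\<^sub>L q = p i" "q o\<^sub>L e {i} = p i" for i
    by (auto intro!: blinfun_eqI simp: eq simp flip: comm)
  then have lc_q: "lc q" by (simp add: lc_def cpt)
  show ?thesis
    by (rule that[OF proj_q prop_q lc_q propag_lc_in_roe[OF prop_q lc_q]]) (fact eq comm)+
qed

text \<open>If each \<open>S i\<close> is finite and lies in block \<open>i\<close>, this
  characterizes the projection whose part on block \<open>i\<close> projects onto the span of
  \<open>S i\<close>. It converts the finite data per block produced by a gliding hump into a single
  element of \<open>roe\<close>.\<close>

definition block_proj :: "('i \<Rightarrow> 'h set) \<Rightarrow> ('h \<Rightarrow>\<^sub>L 'h) \<Rightarrow> bool" where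
  "block_proj S q \<longleftrightarrow> projection_op q \<and> propag 0 q \<and> q \<in> roe \<and> (\<forall>i. \<forall>x\<in>S i. q x = x) \<and>
     (\<forall>i x. e {i} (q x) \<in> cspan (S i)) \<and> (\<forall>T x. e T (q x) = q (e T x))"

lemma block_projD:
  assumes "block_proj S q"
  shows "projection_op q" "propag 0 q" "q \<in> roe" "x \<in> S i \<Longrightarrow> q x = x" "e {i} (q x) \<in> cspan (S i)"
    "e T (q x) = q (e T x)"
  using assms by (auto simp: block_proj_def)

lemma ex_block_proj:
  assumes fin: "\<And>i. finite (S i)" and sub: "\<And>i x. x \<in> S i \<Longrightarrow> e {i} x = x"
  shows "\<exists>q. block_proj S q"
proof -
  have "\<forall>i. \<exists>p. projection_op p \<and> compact_op p \<and> (\<forall>x\<in>S i. p x = x) \<and> range (blinfun_apply p) \<subseteq> cspan (S i)"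
    using finite_dim_projection[OF fin] by blast
  then obtain p where p: "\<And>i. projection_op (p i)" "\<And>i. compact_op (p i)" "\<And>i x. x \<in> S i \<Longrightarrow> p i x = x"
    "\<And>i. range (blinfun_apply (p i)) \<subseteq> cspan (S i)" by metis
  have span: "e {i} y = y" if "y \<in> cspan (S i)" for i y
    using that
  proof (induction rule: complex_vector.span_induct_alt)
    case (step c x y)
    then show ?case using sub by (simp add: blinfun.add_right bounded_opsD)
  qed simp
  have ep: "e {i} (p i x) = p i x" for i x
    using p(4)[of i] by (intro span) auto
  obtain q where q: "projection_op q" "propag 0 q" "lc q" "q \<in> roe"
    "\<And>i x. e {i} (q x) = p i x" "\<And>S x. e S (q x) = q (e S x)"
    using block_diagonal[of p, OF p(1,2) ep] by blast
  have "q x = x" if "x \<in> S i" for i x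
  proof -
    have "q x = q (e {i} x)" using sub[OF that] by simp
    also have "\<dots> = x" using q(5)[of i x] q(6)[of "{i}" x] p(3)[OF that] by simp
    finally show ?thesis .
  qed
  moreover have "e {i} (q x) \<in> cspan (S i)" for i x using p(4)[of i] by (auto simp: q(5))
  ultimately have "block_proj S q" using q(1,2,4,6) by (simp add: block_proj_def)
  then show ?thesis ..
qed

section \<open>Locally compact elements of the band algebra\<close>

text \<open>Each component is countable, but there may be uncountably many of them, so injectivity
  is asked only inside a component. Indices that share a number lie in different components, where
  orthogonality takes over.\<close>

lemma component_numbering:
  obtains n :: "'i \<Rightarrow> nat" where "\<And>i j. conn i j \<Longrightarrow> n i = n j \<Longrightarrow> i = j"
proof -
  define n where "n i = to_nat_on {j. conn i j} i" for i
  have "i = j" if ij: "conn i j" and n: "n i = n j" for i j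
  proof -
    \<comment> \<open>The enumeration depends on the component as a set only, so \<open>i\<close>
      and \<open>j\<close> are numbered by the same function.\<close>
    have "{k. conn j k} = {k. conn i k}" using ij conn_sym conn_trans by blast
    then have "to_nat_on {k. conn i k} i = to_nat_on {k. conn i k} j" using n by (simp add: n_def)
    moreover have "inj_on (to_nat_on {k. conn i k}) {k. conn i k}"
      by (rule inj_on_to_nat_on[OF countable_conn])
    ultimately show "i = j" using ij conn_refl by (auto dest: inj_onD)
  qed
  then show ?thesis by (rule that)
qed

text \<open>Cut off the rows \<open>e {i} o\<^sub>L t\<close> by finite rank projections with errors that are summable along each
  component; different components contribute orthogonally.\<close>

lemma roeI:
  assumes t: "t \<in> cp" and cpt: "\<And>i. compact_op (e {i} o\<^sub>L t)"
  shows "t \<in> roe"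
proof -
  have "\<exists>s\<in>roe. norm (t - s) \<le> \<epsilon>" if "\<epsilon> > 0" for \<epsilon>
  proof -
    obtain n :: "'i \<Rightarrow> nat" where n: "\<And>i j. conn i j \<Longrightarrow> n i = n j \<Longrightarrow> i = j"
      using component_numbering by blast
    \<comment> \<open>Along a component the numbers \<open>n i\<close> are distinct, so the weights
      \<open>(1/2) ^ Suc (n i)\<close> sum to at most 1.\<close>
    define \<delta> where "\<delta> i = \<epsilon> * (1/2) ^ Suc (n i)" for i
    have \<delta>: "\<delta> i > 0" for i using that by (simp add: \<delta>_def)
    define good where "good i S \<longleftrightarrow> finite S \<and> (\<forall>x\<in>S. e {i} x = x) \<and>
        (\<forall>p. projection_op p \<longrightarrow> (\<forall>x\<in>S. p x = x) \<longrightarrow> norm ((e {i} o\<^sub>L t) - (p o\<^sub>L (e {i} o\<^sub>L t))) \<le> \<delta> i)" for i S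
    have "\<exists>S. good i S" for i
    proof -
      have "e {i} o\<^sub>L (e {i} o\<^sub>L t) = e {i} o\<^sub>L t" by (rule blinfun_eqI) simp
      note ec = this
      show ?thesis
      proof (rule compact_op_finite_approx[OF cpt[of i] e_proj[of "{i}"] ec \<delta>[of i]])
        fix S assume "finite S" "\<And>x. x \<in> S \<Longrightarrow> e {i} x = x"
          "\<And>p. projection_op p \<Longrightarrow> (\<And>x. x \<in> S \<Longrightarrow> p x = x) \<Longrightarrow>
            norm ((e {i} o\<^sub>L t) - (p o\<^sub>L (e {i} o\<^sub>L t))) \<le> \<delta> i"
        then have "good i S" by (simp add: good_def)
        then show ?thesis by blast
      qed
    qed
    then obtain S where good: "\<And>i. good i (S i)" by metis
    have S: "\<And>i. finite (S i)" "\<And>i x. x \<in> S i \<Longrightarrow> e {i} x = x"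
      using good by (auto simp: good_def)
    obtain q where bq: "block_proj S q" using ex_block_proj[of S, OF S] by blast
    note q = block_projD[OF bq]
    define D where "D = t - (q o\<^sub>L t)"
    have Dcp: "e {i} (D x) = e {i} (D (e {j. conn i j} x))" for i x
    proof -
      have "e {i} (t x) = e {i} (t (e {j. conn i j} x))" by (rule cp_component[OF t])
      then show ?thesis by (simp add: D_def blinfun.diff_left blinfun.diff_right q(6))
    qed
    have row: "norm (e {i} (D x)) \<le> \<delta> i * norm (e {j. conn i j} x)" for i x
    proof -
      have "norm ((e {i} o\<^sub>L t) - (q o\<^sub>L (e {i} o\<^sub>L t))) \<le> \<delta> i"
        using good[of i] q(1,4) by (simp add: good_def)
      moreover have "e {i} (D x) = ((e {i} o\<^sub>L t) - (q o\<^sub>L (e {i} o\<^sub>L t))) (e {j. conn i j} x)"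
        unfolding Dcp[of i x] by (simp add: D_def blinfun.diff_left blinfun.diff_right q(6))
      ultimately show ?thesis
        by (simp only:) (rule order_trans[OF norm_blinfun mult_right_mono[OF _ norm_ge_zero]])
    qed
    have "norm D \<le> \<epsilon>"
    proof (rule norm_le_e_bound)
      fix F :: "'i set" and x assume F: "finite F"
      \<comment> \<open>Indices with the same number lie in different components, whose projections
        are orthogonal; so all of them together cost no more than one.\<close>
      have level: "(\<Sum>i\<in>{i\<in>F. n i = m}. (norm (e {j. conn i j} x))\<^sup>2) \<le> (norm x)\<^sup>2" for m
      proof (rule Bessel)
        fix i j y z assume "i \<in> {i\<in>F. n i = m}" "j \<in> {i\<in>F. n i = m}" "i \<noteq> j"
        then have "\<not> conn i j" using n by auto
        then have "{k. conn i k} \<inter> {k. conn j k} = {}" using conn_sym conn_trans by blast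
        then show "cinner (e {k. conn i k} y) (e {k. conn j k} z) = 0" by (rule e_orth)
      qed (use F e_proj in auto)
      have "(norm (e F (D x)))\<^sup>2 = (\<Sum>i\<in>F. (norm (e {i} (D x)))\<^sup>2)" by (rule e_sq_sum[OF F])
      also have "\<dots> \<le> (\<Sum>i\<in>F. \<epsilon>\<^sup>2 * (1/2) ^ Suc (n i) * (norm (e {j. conn i j} x))\<^sup>2)"
      proof (rule sum_mono)
        fix i
        have "((1/2) ^ Suc (n i))\<^sup>2 \<le> ((1/2) ^ Suc (n i) :: real)"
          unfolding power2_eq_square
          by (rule mult_left_le_one_le[OF _ _ power_le_one]) (auto simp del: power_Suc)
        then have "(\<delta> i)\<^sup>2 \<le> \<epsilon>\<^sup>2 * (1/2) ^ Suc (n i)"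
          unfolding \<delta>_def power_mult_distrib by (intro mult_left_mono) auto
        moreover have "(norm (e {i} (D x)))\<^sup>2 \<le> (\<delta> i * norm (e {j. conn i j} x))\<^sup>2"
          by (intro power_mono row) simp
        ultimately show "(norm (e {i} (D x)))\<^sup>2 \<le> \<epsilon>\<^sup>2 * (1/2) ^ Suc (n i) * (norm (e {j. conn i j} x))\<^sup>2"
          unfolding power_mult_distrib by (meson mult_right_mono order_trans zero_le_power2)
      qed
      also have "\<dots> = (\<Sum>m\<in>n ` F. \<Sum>i\<in>{i\<in>F. n i = m}. \<epsilon>\<^sup>2 * (1/2) ^ Suc (n i) * (norm (e {j. conn i j} x))\<^sup>2)"
        by (rule sum.image_gen[OF F])
      also have "\<dots> = (\<Sum>m\<in>n ` F. \<epsilon>\<^sup>2 * (1/2) ^ Suc m * (\<Sum>i\<in>{i\<in>F. n i = m}. (norm (e {j. conn i j} x))\<^sup>2))"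
        by (simp add: sum_distrib_left)
      also have "\<dots> \<le> (\<Sum>m\<in>n ` F. \<epsilon>\<^sup>2 * (1/2) ^ Suc m * (norm x)\<^sup>2)"
        by (intro sum_mono mult_left_mono level) simp
      also have "\<dots> = \<epsilon>\<^sup>2 * (\<Sum>m\<in>n ` F. (1/2) ^ Suc m) * (norm x)\<^sup>2"
        by (simp add: sum_distrib_left sum_distrib_right)
      also have "\<dots> \<le> \<epsilon>\<^sup>2 * 1 * (norm x)\<^sup>2"
        by (intro mult_right_mono mult_left_mono sum_inverse_powers_le_1) (use F in auto)
      finally have "(norm (e F (D x)))\<^sup>2 \<le> (\<epsilon> * norm x)\<^sup>2" by (simp add: power_mult_distrib)
      then show "norm (e F (D x)) \<le> \<epsilon> * norm x"
        by (rule power2_le_imp_le) (use \<open>\<epsilon> > 0\<close> in simp)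
    qed (use \<open>\<epsilon> > 0\<close> in simp)
    moreover have "q o\<^sub>L t \<in> roe" by (rule roe_cp_compose[OF q(3) t])
    ultimately show ?thesis unfolding D_def by blast
  qed
  then have "t \<in> closure roe" by (rule closure_normI)
  then show ?thesis by (simp add: closed_roe)
qed

text \<open>A finite net of the image of the unit ball suffices, since each net point is nearly
  supported on finitely many blocks.\<close>

lemma compact_tail:
  assumes c: "compact_op c" and "\<epsilon> > 0"
  obtains B where "finite B" "norm (e (- B) o\<^sub>L c) \<le> \<epsilon>"
proof -
  obtain K where K: "finite K" "\<And>x. norm x \<le> 1 \<Longrightarrow> \<exists>k\<in>K. norm (c x - k) < \<epsilon>/2"
    using compact_op_net[OF c] \<open>\<epsilon> > 0\<close> by (metis half_gt_zero)
  have "\<forall>k. \<exists>B. finite B \<and> (\<forall>G. B \<subseteq> G \<longrightarrow> norm (e (- G) k) \<le> \<epsilon>/2)"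
    using e_dense_compl[of "\<epsilon>/2"] \<open>\<epsilon> > 0\<close> by (metis half_gt_zero)
  then obtain B where B: "\<And>k. finite (B k)" "\<And>k G. B k \<subseteq> G \<Longrightarrow> norm (e (- G) k) \<le> \<epsilon>/2" by metis
  let ?B = "\<Union>k\<in>K. B k"
  have "norm ((e (- ?B) o\<^sub>L c) x) \<le> \<epsilon>" if x: "norm x \<le> 1" for x
  proof -
    obtain k where k: "k \<in> K" "norm (c x - k) < \<epsilon>/2" using K(2)[OF x] by blast
    have "norm (e (- ?B) (c x - k)) \<le> norm (c x - k)" by (rule e_norm_le)
    moreover have "norm (e (- ?B) k) \<le> \<epsilon>/2" using k(1) by (intro B(2)) blast
    moreover have "e (- ?B) (c x) = e (- ?B) (c x - k) + e (- ?B) k" by (simp add: blinfun.diff_right)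
    ultimately show ?thesis
      using k(2) norm_triangle_ineq[of "e (- ?B) (c x - k)" "e (- ?B) k"] by simp
  qed
  then have "norm (e (- ?B) o\<^sub>L c) \<le> \<epsilon>" by (rule norm_blinfun_le_unit[OF _ less_imp_le[OF \<open>\<epsilon> > 0\<close>]])
  moreover have "finite ?B" using K(1) B(1) by blast
  ultimately show ?thesis using that by blast
qed

lemma norm_e_gt_finite:
  assumes "norm (e S y) > \<epsilon>" obtains G where "finite G" "G \<subseteq> S" "norm (e G y) > \<epsilon>"
proof -
  obtain H where H: "finite H" "norm (e S y - e H (e S y)) \<le> (norm (e S y) - \<epsilon>) / 2"
    using e_dense[of "(norm (e S y) - \<epsilon>) / 2" "e S y"] assms by auto
  have "norm (e S y) \<le> norm (e (H \<inter> S) y) + norm (e S y - e (H \<inter> S) y)"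
    using norm_triangle_ineq[of "e (H \<inter> S) y" "e S y - e (H \<inter> S) y"] by simp
  moreover have "norm (e S y - e (H \<inter> S) y) \<le> (norm (e S y) - \<epsilon>) / 2" using H(2) by simp
  ultimately have "norm (e (H \<inter> S) y) > \<epsilon>" using assms by argo
  then show ?thesis using H(1) by (intro that[of "H \<inter> S"]) auto
qed

section \<open>Multipliers of the Roe algebra\<close>

text \<open>This is the idealizer of \<open>roe\<close> in the bounded operators, the concrete form
  of its multiplier algebra.\<close>

definition multiplier :: "('h \<Rightarrow>\<^sub>L 'h) \<Rightarrow> bool" where
  "multiplier t \<longleftrightarrow> t \<in> bounded_ops \<and> (\<forall>a\<in>roe. t o\<^sub>L a \<in> roe \<and> a o\<^sub>L t \<in> roe)"

lemma multiplier_adj: assumes t: "multiplier t" shows "multiplier (adj t)"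
  unfolding multiplier_def
proof (intro conjI ballI)
  have tb: "t \<in> bounded_ops" using t by (simp add: multiplier_def)
  then show "adj t \<in> bounded_ops" by auto
  fix a assume a: "a \<in> roe"
  then have ab: "a \<in> bounded_ops" by (rule roe_bounded)
  have "adj (adj a o\<^sub>L t) \<in> roe" "adj (t o\<^sub>L adj a) \<in> roe"
    using t roe_adj[OF a] by (auto intro!: roe_adj simp: multiplier_def)
  then show "adj t o\<^sub>L a \<in> roe" "a o\<^sub>L adj t \<in> roe"
    using ab tb by (simp_all add: adj_compose adj_adj adj_bounded_ops)
qed

text \<open>Multiply by the rank one operator of \<open>e {i} x\<close>, which lies in
  \<open>roe\<close>: the product sends \<open>x\<close> to a nonzero multiple of
  \<open>t (e {i} x)\<close>, and elements of \<open>cp\<close> do not link different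
  components.\<close>

lemma multiplier_not_conn:
  assumes t: "multiplier t" and "\<not> conn j i" shows "e {j} (t (e {i} x)) = 0"
proof (cases "e {i} x = 0")
  case False
  let ?y = "e {i} x"
  have "ketbra ?y ?y \<in> roe"
    by (rule propag_lc_in_roe[OF propag_ketbra[of i _ i _ 0] lc_ketbra]) (auto simp: near_refl)
  then have "t o\<^sub>L ketbra ?y ?y \<in> cp" using t roe_subset_cp by (auto simp: multiplier_def)
  from cp_not_conn[OF this assms(2), of x]
  have "e {j} (t (cinner ?y ?y *\<^sub>C ?y)) = 0" by simp
  then have "cinner ?y ?y *\<^sub>C e {j} (t ?y) = 0"
    using t by (simp add: bounded_opsD multiplier_def)
  then show ?thesis using False by (simp add: cinner_eq_zero_iff)
qed simp

text \<open>\<open>t o\<^sub>L e F\<close> itself need not be compact. If its mass escaped every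
  finite set, there would be unit ball vectors \<open>V n\<close> and disjoint finite
  \<open>G n\<close> such that \<open>t (e F (V n))\<close> stays large over \<open>G n\<close>. A
  block projection \<open>q\<close> fixing these pieces lies in \<open>roe\<close>, hence so does
  \<open>q o\<^sub>L t\<close>, and \<open>q o\<^sub>L t o\<^sub>L e F\<close> is compact; but a
  compact operator is small off some finite set, which one of the \<open>G n\<close> misses.\<close>

lemma multiplier_left_tail:
  assumes t: "multiplier t" and F: "finite F" and "\<epsilon> > 0"
  obtains F' where "finite F'" "F \<subseteq> F'" "norm (e (- F') o\<^sub>L (t o\<^sub>L e F)) \<le> \<epsilon>"
proof (rule ccontr)
  note witness = that
  assume no: "\<not> thesis"
  have big: "norm (e (- F') o\<^sub>L (t o\<^sub>L e F)) > \<epsilon>" if "finite F'" "F \<subseteq> F'" for F'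
  proof (rule ccontr)
    assume "\<not> norm (e (- F') o\<^sub>L (t o\<^sub>L e F)) > \<epsilon>"
    then show False using no witness[OF that] by simp
  qed
  define P where "P (n::nat) x \<longleftrightarrow> norm (fst x) \<le> 1 \<and> finite (snd x) \<and> norm (e (snd x) (t (e F (fst x)))) > \<epsilon>"
    for n and x :: "'h \<times> 'i set"
  define R where "R (n::nat) a x \<longleftrightarrow> snd a \<inter> snd x = {}" for n and a x :: "'h \<times> 'i set"
  have "\<exists>f. (\<forall>n. P n (f n)) \<and> (\<forall>m n. m < n \<longrightarrow> R n (f m) (f n))"
  proof (rule gliding_hump[of P R])
    fix n and A :: "('h \<times> 'i set) set" assume A: "finite A" "\<And>a. a \<in> A \<Longrightarrow> \<exists>m. P m a"
    let ?F' = "F \<union> (\<Union>a\<in>A. snd a)"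
    have "finite ?F'" using F A by (auto simp: P_def)
    then have "norm (e (- ?F') o\<^sub>L (t o\<^sub>L e F)) > \<epsilon>" by (intro big) auto
    from norm_blinfun_unit_bound[OF this less_imp_le[OF \<open>\<epsilon> > 0\<close>]]
    obtain v where v: "norm v \<le> 1" "norm ((e (- ?F') o\<^sub>L (t o\<^sub>L e F)) v) > \<epsilon>" by blast
    have v2: "norm (e (- ?F') (t (e F v))) > \<epsilon>" using v(2) by (simp only: blinfun_apply_blinfun_compose)
    obtain G where "finite G" "G \<subseteq> - ?F'" "norm (e G (t (e F v))) > \<epsilon>"
      using norm_e_gt_finite[OF v2] by blast
    then show "\<exists>x. P n x \<and> (\<forall>a\<in>A. R n a x)"
      using v(1) by (intro exI[of _ "(v, G)"]) (auto simp: P_def R_def)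
  qed
  then obtain f where f: "\<And>n. P n (f n)" "\<And>m n. m < n \<Longrightarrow> R n (f m) (f n)" by blast
  define V where "V n = fst (f n)" for n
  define G where "G n = snd (f n)" for n
  have VG: "norm (V n) \<le> 1" "finite (G n)" "norm (e (G n) (t (e F (V n)))) > \<epsilon>" for n
    using f(1)[of n] by (auto simp: P_def V_def G_def)
  have disj: "m < n \<Longrightarrow> G m \<inter> G n = {}" for m n
    using f(2) by (auto simp: R_def G_def)
  \<comment> \<open>As the \<open>G n\<close> are disjoint, each block receives at most one
    vector.\<close>
  define S where "S i = {e {i} (t (e F (V n))) |n. i \<in> G n}" for i
  have "finite (S i)" for i
  proof (cases "\<exists>n. i \<in> G n")
    case True
    then obtain n where "i \<in> G n" by blast
    then have "S i \<subseteq> {e {i} (t (e F (V n)))}" using disjoint_index_unique[of G, OF disj] by (auto simp: S_def)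
    then show ?thesis using finite_subset by blast
  qed (simp add: S_def)
  moreover have "e {i} x = x" if "x \<in> S i" for i x using that by (auto simp: S_def)
  ultimately obtain q where bq: "block_proj S q" using ex_block_proj[of S] by blast
  note q = block_projD(3,4,6)[OF bq]
  define c where "c = q o\<^sub>L t o\<^sub>L e F"
  have "q o\<^sub>L t \<in> roe" using t q(1) by (simp add: multiplier_def)
  then have "compact_op (q o\<^sub>L t o\<^sub>L e {i})" for i using roe_lc[of "q o\<^sub>L t"] by (simp add: lc_def)
  then have "compact_op c" unfolding c_def by (rule compact_e_finite_right[OF _ F])
  from compact_tail[OF this \<open>\<epsilon> > 0\<close>]
  obtain B where B: "finite B" "norm (e (- B) o\<^sub>L c) \<le> \<epsilon>" by blast
  obtain n where n: "G n \<inter> B = {}" using disjoint_avoids_finite[of G B, OF disj B(1)] by blast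
  have "e (G n) (c (V n)) = q (e (G n) (t (e F (V n))))" by (simp add: c_def q(3))
  also have "\<dots> = (\<Sum>i\<in>G n. q (e {i} (t (e F (V n)))))"
    by (subst e_finite[OF VG(2)]) (simp add: blinfun.sum_right)
  also have "\<dots> = (\<Sum>i\<in>G n. e {i} (t (e F (V n))))"
    by (rule sum.cong) (auto intro!: q(2) simp: S_def)
  also have "\<dots> = e (G n) (t (e F (V n)))" by (rule e_finite[OF VG(2), symmetric])
  finally have "\<epsilon> < norm (e (G n) (c (V n)))" using VG(3)[of n] by simp
  also have "\<dots> \<le> norm (e (- B) (c (V n)))" using n by (intro e_norm_mono) auto
  also have "\<dots> \<le> norm (e (- B) o\<^sub>L c) * norm (V n)" using norm_blinfun[of "e (- B) o\<^sub>L c" "V n"] by simp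
  also have "\<dots> \<le> \<epsilon> * 1" using B(2) VG(1) \<open>\<epsilon> > 0\<close> by (intro mult_mono) auto
  finally show False by simp
qed

lemma multiplier_right_tail:
  assumes t: "multiplier t" and F: "finite F" and "\<epsilon> > 0"
  obtains F' where "finite F'" "F \<subseteq> F'" "norm (e F o\<^sub>L (t o\<^sub>L e (- F'))) \<le> \<epsilon>"
proof -
  obtain F' where F': "finite F'" "F \<subseteq> F'" "norm (e (- F') o\<^sub>L (adj t o\<^sub>L e F)) \<le> \<epsilon>"
    using multiplier_left_tail[OF multiplier_adj[OF t] F \<open>\<epsilon> > 0\<close>] by blast
  have tb: "t \<in> bounded_ops" using t by (simp add: multiplier_def)
  have "adj (e F o\<^sub>L (t o\<^sub>L e (- F'))) = e (- F') o\<^sub>L (adj t o\<^sub>L e F)"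
    using tb by (simp add: adj_compose bounded_ops_compose e_adj blinfun_compose_assoc)
  then have "norm (e F o\<^sub>L (t o\<^sub>L e (- F'))) \<le> \<epsilon>"
    using F'(3) tb norm_adj[of "e F o\<^sub>L (t o\<^sub>L e (- F'))"] by (simp add: bounded_ops_compose)
  with F' show ?thesis using that by blast
qed

text \<open>Only the compression of \<open>t - s\<close> to the span of \<open>S\<close> is bounded.
  For finite \<open>S\<close> this is a condition on finitely many dimensions, it passes to subsets
  of \<open>S\<close>, and it is stable under limits of matrix coefficients.\<close>

definition approx_on :: "('h \<Rightarrow>\<^sub>L 'h) \<Rightarrow> real \<Rightarrow> nat \<Rightarrow> 'h set \<Rightarrow> bool" where
  "approx_on t \<epsilon> n S \<longleftrightarrow> (\<exists>s. propag n s \<and>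
     (\<forall>x\<in>cspan S. \<forall>y\<in>cspan S. cmod (cinner x ((t - s) y)) \<le> \<epsilon> * norm x * norm y))"

definition block_vectors :: "'h set" where
  "block_vectors = {x. \<exists>i. e {i} x = x}"

lemma e_block_vector: "e {i} x \<in> block_vectors"
  unfolding block_vectors_def by (rule CollectI, rule exI[of _ i]) simp

lemma finite_support_in_span:
  assumes "finite F" shows "e F x \<in> cspan ((\<lambda>i. e {i} x) ` F)"
  unfolding e_finite[OF assms] by (intro complex_vector.span_sum complex_vector.span_base) auto

lemma block_vectors_support:
  assumes "finite S" "S \<subseteq> block_vectors"
  shows "\<exists>F. finite F \<and> (\<forall>x\<in>S. \<exists>i\<in>F. e {i} x = x)"
proof -
  have "\<forall>x\<in>S. \<exists>i. e {i} x = x" using assms(2) by (auto simp: block_vectors_def)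
  then obtain i where "\<forall>x\<in>S. e {i x} x = x" by metis
  then show ?thesis using assms(1) by (intro exI[of _ "i ` S"]) auto
qed

text \<open>Compressing by a block projection preserves the propagation and bounds the norm.\<close>

lemma approx_on_bounded:
  assumes t: "t \<in> bounded_ops" and "\<epsilon> \<ge> 0" and S: "finite S" "S \<subseteq> block_vectors" and ap: "approx_on t \<epsilon> n S"
  shows "\<exists>s. propag n s \<and> norm s \<le> norm t + \<epsilon> \<and>
     (\<forall>x\<in>cspan S. \<forall>y\<in>cspan S. cmod (cinner x ((t - s) y)) \<le> \<epsilon> * norm x * norm y)"
proof -
  obtain s where s: "propag n s"
    "\<And>x y. x \<in> cspan S \<Longrightarrow> y \<in> cspan S \<Longrightarrow> cmod (cinner x ((t - s) y)) \<le> \<epsilon> * norm x * norm y"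
    using ap by (auto simp: approx_on_def)
  obtain F where F: "finite F" "\<And>x. x \<in> S \<Longrightarrow> \<exists>i\<in>F. e {i} x = x"
    using block_vectors_support[OF S] by auto
  have "\<exists>q. block_proj (\<lambda>i. {x\<in>S. e {i} x = x}) q"
    by (rule ex_block_proj) (use S(1) in auto)
  then obtain q where bq: "block_proj (\<lambda>i. {x\<in>S. e {i} x = x}) q" by blast
  note q = block_projD[OF bq]
  have qS: "q x = x" if "x \<in> S" for x using F(2)[OF that] q(4) that by blast
  \<comment> \<open>Cutting down to the finitely many blocks in \<open>F\<close> makes every
    \<open>p x\<close> a finite sum of elements of the spans, hence an element of
    \<open>cspan S\<close>.\<close>
  define p where "p = e F o\<^sub>L q"
  have pp: "p = q o\<^sub>L e F" by (rule blinfun_eqI) (simp add: p_def q(6))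
  have pb: "p \<in> bounded_ops" unfolding p_def using projection_bounded[OF q(1)] by auto
  have p: "projection_op p"
  proof (rule projectionI[OF pb])
    show "p (p x) = p x" for x by (simp add: p_def flip: q(6)) (simp add: q(6) projection_idem[OF q(1)])
    show "cinner (p x) y = cinner x (p y)" for x y
      unfolding p_def by (simp add: e_cinner projection_cinner[OF q(1)] flip: q(6))
  qed
  have p_span: "p x \<in> cspan S" for x
  proof -
    have "e {i} (q x) \<in> cspan S" for i
      using q(5)[of i x] complex_vector.span_mono[of "{x\<in>S. e {i} x = x}" S] by auto
    then show ?thesis unfolding p_def by (simp add: e_finite[OF F(1)] complex_vector.span_sum)
  qed
  have pS: "p x = x" if "x \<in> S" for x
  proof -
    obtain i where i: "i \<in> F" "e {i} x = x" using F(2)[OF \<open>x \<in> S\<close>] by blast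
    have "e F x = e F (e {i} x)" by (simp only: i(2))
    also have "\<dots> = e {i} x" using i(1) by simp
    also have "\<dots> = x" by (rule i(2))
    finally show ?thesis by (simp add: p_def qS[OF that])
  qed
  have p_id: "p y = y" if "y \<in> cspan S" for y
    using that
  proof (induction rule: complex_vector.span_induct_alt)
    case (step c x y)
    then show ?case using pS by (simp add: blinfun.add_right bounded_opsD[OF pb])
  qed simp
  have pr: "propag 0 p" unfolding pp by (rule propag_e_compose(2)[OF q(2)])
  define s' where "s' = p o\<^sub>L s o\<^sub>L p"
  have "propag (0 + n + 0) s'" unfolding s'_def by (intro propag_compose pr s(1))
  then have 1: "propag n s'" by simp
  have 2: "norm (p o\<^sub>L (t - s) o\<^sub>L p) \<le> \<epsilon>"
  proof (rule norm_blinfun_le_cinner[OF \<open>\<epsilon> \<ge> 0\<close>])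
    fix x y
    have "cmod (cinner y ((p o\<^sub>L (t - s) o\<^sub>L p) x)) = cmod (cinner (p y) ((t - s) (p x)))"
      by (simp add: projection_cinner[OF p])
    also have "\<dots> \<le> \<epsilon> * norm (p y) * norm (p x)" by (rule s(2)[OF p_span p_span])
    also have "\<dots> \<le> \<epsilon> * norm y * norm x"
      by (intro mult_mono projection_norm_le[OF p]) (use \<open>\<epsilon> \<ge> 0\<close> in auto)
    finally show "cmod (cinner y ((p o\<^sub>L (t - s) o\<^sub>L p) x)) \<le> \<epsilon> * norm x * norm y" by (simp add: mult_ac)
  qed
  have "s' = (p o\<^sub>L t o\<^sub>L p) - (p o\<^sub>L (t - s) o\<^sub>L p)"
    by (simp add: s'_def blinfun_compose_diff_left blinfun_compose_diff_right)
  then have "norm s' \<le> norm (p o\<^sub>L t o\<^sub>L p) + norm (p o\<^sub>L (t - s) o\<^sub>L p)" by (simp add: norm_triangle_ineq4)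
  moreover have "norm (p o\<^sub>L t o\<^sub>L p) \<le> 1 * norm t * 1" by (intro norm_compose_le projection_norm[OF p]) simp
  ultimately have 3: "norm s' \<le> norm t + \<epsilon>" using 2 by simp
  have 4: "cmod (cinner x ((t - s') y)) \<le> \<epsilon> * norm x * norm y" if "x \<in> cspan S" "y \<in> cspan S" for x y
  proof -
    have "cinner x (s' y) = cinner (p x) (s (p y))" by (simp add: s'_def projection_cinner[OF p])
    also have "\<dots> = cinner x (s y)" by (simp only: p_id[OF that(1)] p_id[OF that(2)])
    finally have "cinner x ((t - s') y) = cinner x ((t - s) y)"
      by (simp add: blinfun.diff_left cinner_diff_right)
    then show ?thesis using s(2)[OF that] by simp
  qed
  show ?thesis using 1 3 4 by blast
qed

text \<open>A weak operator limit exists by Tychonoff's theorem, applied to the sesquilinear forms of the approximants.\<close>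

lemma propag_approx_limit:
  assumes t: "t \<in> bounded_ops" and eps: "\<epsilon> \<ge> 0"
    and ap: "\<And>S. finite S \<Longrightarrow> S \<subseteq> block_vectors \<Longrightarrow> approx_on t \<epsilon> n S"
  shows "\<exists>s. propag n s \<and> norm (t - s) \<le> \<epsilon>"
proof -
  define M where "M = norm t + \<epsilon>"
  have M: "M \<ge> 0" using eps by (simp add: M_def)
  define K :: "('h \<times> 'h \<Rightarrow> complex) set" where "K = Pi UNIV (\<lambda>p. cball 0 (M * norm (fst p) * norm (snd p)))"
  define C :: "('h \<times> 'h \<Rightarrow> complex) set" where "C =
     (\<Inter>x. \<Inter>y. \<Inter>z. {b. b (x + y, z) = b (x, z) + b (y, z)}) \<inter>
     (\<Inter>x. \<Inter>y. \<Inter>z. {b. b (z, x + y) = b (z, x) + b (z, y)}) \<inter>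
     (\<Inter>c. \<Inter>x. \<Inter>z. {b. b (c *\<^sub>C x, z) = cnj c * b (x, z)}) \<inter>
     (\<Inter>c. \<Inter>x. \<Inter>z. {b. b (z, c *\<^sub>C x) = c * b (z, x)}) \<inter>
     (\<Inter>(i, j)\<in>{(i, j). \<not> near n j i}. \<Inter>x. \<Inter>y. {b. b (e {j} y, e {i} x) = 0})"
  \<comment> \<open>The finitely supported vectors are those reached by spans of finite sets of
    block vectors, so \<open>approx_on\<close> applies to every finite part of
    \<open>Q\<close>.\<close>
  define Q where "Q = {x. \<exists>F. finite F \<and> e F x = x} \<times> {x. \<exists>F. finite F \<and> e F x = x}"
  define f :: "'h \<times> 'h \<Rightarrow> ('h \<times> 'h \<Rightarrow> complex) set" where
    "f p = {b. cmod (cinner (fst p) (t (snd p)) - b p) \<le> \<epsilon> * norm (fst p) * norm (snd p)}" for p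
  have "compact K" unfolding K_def by (rule compact_Pi_UNIV) simp
  moreover have "closed C" unfolding C_def
    by (intro closed_Int closed_INT ballI)
      (auto intro!: closed_Collect_eq continuous_on_add continuous_on_mult continuous_on_const continuous_on_eval)
  ultimately have "compact (K \<inter> C)" by (rule compact_Int_closed)
  then have "(K \<inter> C) \<inter> (\<Inter>p\<in>Q. f p) \<noteq> {}"
  proof (rule compact_imp_fip_image)
    show "closed (f p)" for p unfolding f_def
      by (intro closed_Collect_le continuous_intros continuous_on_eval)
    fix A assume A: "finite A" "A \<subseteq> Q"
    have "\<forall>x\<in>fst ` A \<union> snd ` A. \<exists>F. finite F \<and> e F x = x" using A(2) by (auto simp: Q_def)
    then obtain F where F: "\<And>x. x \<in> fst ` A \<union> snd ` A \<Longrightarrow> finite (F x) \<and> e (F x) x = x" by metis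
    \<comment> \<open>The block components of all vectors occurring in \<open>A\<close>; each of
      those vectors is the sum of its own.\<close>
    define S where "S = (\<Union>x\<in>fst ` A \<union> snd ` A. (\<lambda>i. e {i} x) ` F x)"
    have span: "x \<in> cspan S" if x: "x \<in> fst ` A \<union> snd ` A" for x
    proof -
      have "x \<in> cspan ((\<lambda>i. e {i} x) ` F x)" using finite_support_in_span[of "F x" x] F[OF x] by simp
      moreover have "cspan ((\<lambda>i. e {i} x) ` F x) \<subseteq> cspan S"
        by (rule complex_vector.span_mono) (use x in \<open>auto simp: S_def\<close>)
      ultimately show ?thesis by blast
    qed
    have S: "finite S" "S \<subseteq> block_vectors"
      using A(1) F by (auto simp: S_def e_block_vector)
    obtain s where s: "propag n s" "norm s \<le> M"
      "\<And>x y. x \<in> cspan S \<Longrightarrow> y \<in> cspan S \<Longrightarrow> cmod (cinner x ((t - s) y)) \<le> \<epsilon> * norm x * norm y"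
      using approx_on_bounded[OF t eps S ap[OF S]] unfolding M_def by auto
    define b where "b p = cinner (fst p) (s (snd p))" for p
    have sb: "s \<in> bounded_ops" by (rule propag_bounded[OF s(1)])
    have "b \<in> K"
    proof -
      have "cmod (cinner x (s y)) \<le> M * norm x * norm y" for x y
      proof -
        have "cmod (cinner x (s y)) \<le> norm s * norm y * norm x" by (rule cmod_cinner_blinfun_le)
        also have "\<dots> \<le> M * norm y * norm x" by (intro mult_right_mono s(2)) auto
        finally show ?thesis by (simp add: mult_ac)
      qed
      then show ?thesis by (auto simp: K_def b_def)
    qed
    moreover have "b \<in> C"
    proof -
      have "cinner (e {j} y) (s (e {i} x)) = 0" if "\<not> near n j i" for i j x y
        using s(1) that unfolding e_cinner by (simp add: propag_def)
      then show ?thesis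
        by (auto simp: C_def b_def cinner_add_left cinner_add_right blinfun.add_right cinner_scaleC_left
            cinner_scaleC_right bounded_opsD[OF sb])
    qed
    moreover have "b \<in> f p" if p: "p \<in> A" for p
    proof -
      have "fst p \<in> cspan S" "snd p \<in> cspan S" using p by (auto intro!: span)
      from s(3)[OF this] show ?thesis by (simp add: f_def b_def blinfun.diff_left cinner_diff_right)
    qed
    ultimately show "(K \<inter> C) \<inter> (\<Inter>p\<in>A. f p) \<noteq> {}" by blast
  qed
  then obtain b where bK: "b \<in> K" and bC: "b \<in> C" and bf: "\<And>p. p \<in> Q \<Longrightarrow> b \<in> f p" by blast
  have bnd: "cmod (b (x, y)) \<le> M * norm x * norm y" for x y
    using bK by (auto simp: K_def Pi_iff)
  have form: "b (x + y, z) = b (x, z) + b (y, z)" "b (z, x + y) = b (z, x) + b (z, y)"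
    "b (c *\<^sub>C x, z) = cnj c * b (x, z)" "b (z, c *\<^sub>C x) = c * b (z, x)" for x y z c
    using bC by (simp_all add: C_def)
  have far: "b (e {j} y, e {i} x) = 0" if "\<not> near n j i" for i j x y
    using bC that by (auto simp: C_def)
  have "\<exists>s0. s0 \<in> bounded_ops \<and> (\<forall>x y. cinner (s0 x) y = b (x, y))"
  proof (rule op_of_form[of "\<lambda>x y. b (x, y)" M])
    show "cmod (b (x, y)) \<le> M * norm x * norm y" for x y by (rule bnd)
  qed (use form M in auto)
  then obtain s0 where s0: "s0 \<in> bounded_ops" "\<And>x y. cinner (s0 x) y = b (x, y)" by blast
  \<comment> \<open>\<open>op_of_form\<close> puts the operator into the first argument of the inner
    product, while \<open>b\<close> was modelled on the second; hence the adjoint.\<close>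
  define s where "s = adj s0"
  have sb: "s \<in> bounded_ops" using s0(1) by (auto simp: s_def)
  have s: "cinner x (s y) = b (x, y)" for x y
    by (simp add: s_def cinner_adj_right[OF s0(1)] s0(2))
  have "propag n s"
    unfolding propag_def
  proof (intro conjI allI impI sb)
    fix i j x assume "\<not> near n j i"
    then have "cinner z (e {j} (s (e {i} x))) = cinner z 0" for z
      by (simp flip: e_cinner add: s far)
    then show "e {j} (s (e {i} x)) = 0" by (rule cinner_ext)
  qed
  moreover have "norm (t - s) \<le> \<epsilon>"
  proof (rule norm_le_e_bound[OF _ eps])
    fix G x assume G: "finite (G :: 'i set)"
    show "norm (e G ((t - s) x)) \<le> \<epsilon> * norm x"
    proof (rule field_le_epsilon)
      fix \<eta> :: real assume "\<eta> > 0"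
      define N where "N = norm (t - s) + 1"
      have N: "N > 0" by (simp add: N_def add_nonneg_pos)
      obtain F where F: "finite F" "norm (x - e F x) \<le> \<eta> / N"
        using e_dense[of "\<eta> / N" x] \<open>\<eta> > 0\<close> N by auto
      let ?y = "e F x" and ?z = "e G ((t - s) (e F x))"
      have "(?z, ?y) \<in> Q" using F(1) G by (auto simp: Q_def)
      from bf[OF this] have "cmod (cinner ?z ((t - s) ?y)) \<le> \<epsilon> * norm ?z * norm ?y"
        by (simp add: f_def blinfun.diff_left cinner_diff_right s)
      \<comment> \<open>Testing the coefficient bound against \<open>?z\<close> itself turns it into
        a bound for \<open>norm ?z\<close>.\<close>
      moreover have "cinner ?z ((t - s) ?y) = cinner ?z ?z"
        by (metis e_cinner e_e Int_absorb)
      ultimately have "norm ?z * norm ?z \<le> \<epsilon> * norm ?y * norm ?z"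
        by (simp add: cinner_eq_norm norm_mult norm_power power2_eq_square mult_ac)
      then have "norm ?z \<le> \<epsilon> * norm ?y"
        using eps by (cases "?z = 0") (auto simp del: e_e)
      also have "\<dots> \<le> \<epsilon> * norm x" by (intro mult_left_mono e_norm_le eps)
      finally have "norm ?z \<le> \<epsilon> * norm x" .
      moreover have "norm (e G ((t - s) (x - e F x))) \<le> \<eta>"
      proof -
        have "norm (e G ((t - s) (x - e F x))) \<le> norm ((t - s) (x - e F x))" by (rule e_norm_le)
        also have "\<dots> \<le> norm (t - s) * norm (x - e F x)" by (rule norm_blinfun)
        also have "\<dots> \<le> N * (\<eta> / N)" by (intro mult_mono F(2)) (auto simp: N_def)
        finally show ?thesis using N by simp
      qed
      ultimately have "norm (?z + e G ((t - s) (x - e F x))) \<le> \<epsilon> * norm x + \<eta>"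
        using norm_triangle_ineq[of ?z "e G ((t - s) (x - e F x))"] by linarith
      moreover have "e G ((t - s) x) = ?z + e G ((t - s) (x - e F x))"
        by (simp only: blinfun.diff_right) simp
      ultimately show "norm (e G ((t - s) x)) \<le> \<epsilon> * norm x + \<eta>" by simp
    qed
  qed
  ultimately show ?thesis by blast
qed

text \<open>The rows and columns of \<open>t\<close> over \<open>F\<close> are, up to small tails, supported on finitely many pairs of blocks.\<close>

lemma multiplier_discard_blocks:
  assumes t: "multiplier t" and "\<epsilon> > 0" and F: "finite F"
  shows "\<exists>n. \<forall>S. S \<subseteq> block_vectors \<longrightarrow> approx_on t (\<epsilon>/2) m {x\<in>S. \<exists>i. i \<notin> F \<and> e {i} x = x} \<longrightarrow> approx_on t \<epsilon> n S"
proof -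
  have tb: "t \<in> bounded_ops" using t by (simp add: multiplier_def)
  have eps4: "\<epsilon>/4 > 0" using \<open>\<epsilon> > 0\<close> by simp
  obtain F1 where F1: "finite F1" "F \<subseteq> F1" "norm (e (- F1) o\<^sub>L (t o\<^sub>L e F)) \<le> \<epsilon>/4"
    using multiplier_left_tail[OF t F eps4] by blast
  obtain F2 where F2: "finite F2" "F \<subseteq> F2" "norm (e F o\<^sub>L (t o\<^sub>L e (- F2))) \<le> \<epsilon>/4"
    using multiplier_right_tail[OF t F eps4] by blast
  \<comment> \<open>Only finitely many connected pairs have to be covered, so one propagation bound
    serves them all; entries between unconnected indices vanish anyway.\<close>
  have "\<exists>n\<ge>m. \<forall>i\<in>F1 \<union> F2. \<forall>j\<in>F1 \<union> F2. conn j i \<longrightarrow> near n j i"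
  proof -
    have "\<forall>p. \<exists>n. conn (fst p) (snd p) \<longrightarrow> near n (fst p) (snd p)" by (auto simp: conn_def)
    then obtain N where N: "\<And>p. conn (fst p) (snd p) \<Longrightarrow> near (N p) (fst p) (snd p)" by metis
    let ?A = "insert m (N ` ((F1 \<union> F2) \<times> (F1 \<union> F2)))"
    have fin: "finite ?A" using F1(1) F2(1) by auto
    have "near (Max ?A) j i" if "i \<in> F1 \<union> F2" "j \<in> F1 \<union> F2" "conn j i" for i j
    proof -
      have 1: "near (N (j, i)) j i" using N[of "(j, i)"] that(3) by simp
      have 2: "N (j, i) \<le> Max ?A" by (rule Max_ge[OF fin]) (use that in simp)
      show ?thesis by (rule near_mono[OF 1 2])
    qed
    moreover have "m \<le> Max ?A" by (rule Max_ge[OF fin]) simp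
    ultimately show ?thesis by blast
  qed
  then obtain n where n: "n \<ge> m" "\<And>i j. i \<in> F1 \<union> F2 \<Longrightarrow> j \<in> F1 \<union> F2 \<Longrightarrow> conn j i \<Longrightarrow> near n j i" by blast
  have corner: "propag n (e T o\<^sub>L t o\<^sub>L e T')" if "T \<subseteq> F1 \<union> F2" "T' \<subseteq> F1 \<union> F2" for T T'
    unfolding propag_def
  proof (intro conjI allI impI)
    fix i j x assume far: "\<not> near n j i"
    show "e {j} ((e T o\<^sub>L t o\<^sub>L e T') (e {i} x)) = 0"
    proof (cases "j \<in> T \<and> i \<in> T'")
      case True
      then have "\<not> conn j i" using far n(2) that by blast
      then have "e {j} (t (e {i} x)) = 0" by (rule multiplier_not_conn[OF t])
      then show ?thesis using True by (simp add: Int_insert_left Int_insert_right)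
    qed (auto simp: Int_insert_left Int_insert_right)
  qed (use tb in auto)
  \<comment> \<open>The columns over \<open>F\<close> and the rest of the rows over
    \<open>F\<close>, each cut at a finite set. The corner from \<open>F\<close> to \<open>F\<close>
    already lies in the first summand, so the second uses \<open>F2 - F\<close>.\<close>
  define A where "A = (e F1 o\<^sub>L t o\<^sub>L e F) + (e F o\<^sub>L t o\<^sub>L e (F2 - F))"
  have A: "propag n A" unfolding A_def using F1(2) F2(2) by (intro propag_add corner) auto
  have "approx_on t \<epsilon> n S"
    if S: "S \<subseteq> block_vectors" and ap: "approx_on t (\<epsilon>/2) m {x\<in>S. \<exists>i. i \<notin> F \<and> e {i} x = x}" for S
  proof -
    let ?S = "{x\<in>S. \<exists>i. i \<notin> F \<and> e {i} x = x}"
    obtain s where s: "propag m s"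
      "\<And>x y. x \<in> cspan ?S \<Longrightarrow> y \<in> cspan ?S \<Longrightarrow> cmod (cinner x ((t - s) y)) \<le> \<epsilon>/2 * norm x * norm y"
      using ap by (auto simp: approx_on_def)
    define s' where "s' = (e (- F) o\<^sub>L s o\<^sub>L e (- F)) + A"
    have "propag n s'"
      unfolding s'_def by (intro propag_add A propag_e_compose propag_mono[OF s(1) n(1)])
    moreover have "cmod (cinner x ((t - s') y)) \<le> \<epsilon> * norm x * norm y"
      if x: "x \<in> cspan S" and y: "y \<in> cspan S" for x y
    proof -
      \<comment> \<open>Each vector of \<open>S\<close> sits in one block, so \<open>e (- F)\<close>
        either kills it or fixes it; no new vectors arise.\<close>
      have cut: "e (- F) z \<in> cspan ?S" if "z \<in> cspan S" for z
        using that
      proof (induction rule: complex_vector.span_induct_alt)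
        case (step c u v)
        obtain i where i: "e {i} u = u" using step S by (auto simp: block_vectors_def)
        have "e (- F) u \<in> cspan ?S"
        proof (cases "i \<in> F")
          case True
          have "e (- F) (e {i} u) = 0" using True by simp
          then show ?thesis by (simp only: i complex_vector.span_zero)
        next
          case False
          have "e (- F) (e {i} u) = e {i} u" using False by simp
          then have "e (- F) u = u" by (simp only: i)
          moreover have "u \<in> ?S" using step(1) i False by blast
          ultimately show ?thesis by (simp add: complex_vector.span_base)
        qed
        then show ?case using step
          by (simp add: blinfun.add_right bounded_opsD complex_vector.span_add complex_vector.span_scale)
      qed (simp add: complex_vector.span_zero)
      have "t y = e F1 (t (e F y)) + e (- F1) (t (e F y)) + e F (t (e (F2 - F) y)) + e F (t (e (- F2) y))
          + e (- F) (t (e (- F) y))"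
      proof -
        have 1: "e (- F) y = e (F2 - F) y + e (- F2) y"
        proof -
          have "(F2 - F) \<union> - F2 = - F" using F2(2) by blast
          moreover have "(F2 - F) \<inter> - F2 = {}" by blast
          ultimately have "e (- F) = e (F2 - F) + e (- F2)" using e_Un by metis
          then show ?thesis by (simp add: blinfun.add_left)
        qed
        have "t y = t (e F y) + t (e (- F) y)" by (metis blinfun.add_right e_split)
        also have "t (e F y) = e F1 (t (e F y)) + e (- F1) (t (e F y))" by (rule e_split)
        also have "t (e (- F) y) = e F (t (e (- F) y)) + e (- F) (t (e (- F) y))" by (rule e_split)
        also have "e F (t (e (- F) y)) = e F (t (e (F2 - F) y)) + e F (t (e (- F2) y))"
          unfolding 1 by (simp only: blinfun.add_right)
        finally show ?thesis by (simp add: add_ac)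
      qed
      then have "(t - s') y = e (- F) ((t - s) (e (- F) y)) + (e (- F1) o\<^sub>L (t o\<^sub>L e F)) y + (e F o\<^sub>L (t o\<^sub>L e (- F2))) y"
        by (simp add: s'_def A_def blinfun.diff_left blinfun.add_left blinfun.diff_right)
      then have eq: "cinner x ((t - s') y) = cinner (e (- F) x) ((t - s) (e (- F) y))
          + cinner x ((e (- F1) o\<^sub>L (t o\<^sub>L e F)) y) + cinner x ((e F o\<^sub>L (t o\<^sub>L e (- F2))) y)"
        by (simp only: cinner_add_right e_cinner)
      have "cmod (cinner (e (- F) x) ((t - s) (e (- F) y))) \<le> \<epsilon>/2 * norm (e (- F) x) * norm (e (- F) y)"
        by (rule s(2)[OF cut[OF x] cut[OF y]])
      also have "\<dots> \<le> \<epsilon>/2 * norm x * norm y"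
        by (intro mult_mono e_norm_le) (use \<open>\<epsilon> > 0\<close> in auto)
      finally have b1: "cmod (cinner (e (- F) x) ((t - s) (e (- F) y))) \<le> \<epsilon>/2 * norm x * norm y" .
      have tail: "cmod (cinner x (r y)) \<le> \<epsilon>/4 * norm x * norm y" if "norm r \<le> \<epsilon>/4" for r :: "'h \<Rightarrow>\<^sub>L 'h"
      proof -
        have "cmod (cinner x (r y)) \<le> norm r * norm y * norm x" by (rule cmod_cinner_blinfun_le)
        also have "\<dots> \<le> \<epsilon>/4 * norm y * norm x" by (intro mult_right_mono that) auto
        finally show ?thesis by (simp add: mult_ac)
      qed
      have "cmod (cinner x ((t - s') y)) \<le> \<epsilon>/2 * norm x * norm y + \<epsilon>/4 * norm x * norm y + \<epsilon>/4 * norm x * norm y"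
        unfolding eq by (intro norm_triangle_le add_mono b1 tail[OF F1(3)] tail[OF F2(3)])
      also have "\<dots> = \<epsilon> * norm x * norm y" by (simp add: field_simps)
      finally show ?thesis .
    qed
    ultimately show ?thesis by (auto simp: approx_on_def)
  qed
  then show ?thesis by blast
qed

text \<open>If every propagation bound failed at \<open>\<epsilon>\<close>,
  \<open>multiplier_discard_blocks\<close> would make each failure recur at
  \<open>\<epsilon>/2\<close> away from the blocks used before. This gives finite sets
  \<open>S n\<close> over disjoint finite sets of blocks such that \<open>S n\<close> defeats
  propagation \<open>n\<close>. The block projection \<open>q\<close> fixing all \<open>S n\<close>
  lies in \<open>roe\<close>, so \<open>t o\<^sub>L q\<close> lies in \<open>cp\<close>, and an
  approximant of it also approximates \<open>t\<close> on every \<open>S n\<close>.\<close>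

lemma multiplier_uniform_approx:
  assumes t: "multiplier t" and "\<epsilon> > 0"
  shows "\<exists>n. \<forall>S. finite S \<longrightarrow> S \<subseteq> block_vectors \<longrightarrow> approx_on t \<epsilon> n S"
proof (rule ccontr)
  assume no: "\<not> ?thesis"
  define P where "P n x \<longleftrightarrow> finite (fst x) \<and> finite (snd x) \<and> (\<forall>v\<in>fst x. \<exists>i\<in>snd x. e {i} v = v) \<and>
    \<not> approx_on t (\<epsilon>/2) n (fst x)" for n and x :: "'h set \<times> 'i set"
  define R where "R (n::nat) a x \<longleftrightarrow> snd a \<inter> snd x = {}" for n and a x :: "'h set \<times> 'i set"
  have "\<exists>f. (\<forall>n. P n (f n)) \<and> (\<forall>m n. m < n \<longrightarrow> R n (f m) (f n))"
  proof (rule gliding_hump[of P R])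
    fix m and A :: "('h set \<times> 'i set) set" assume A: "finite A" "\<And>a. a \<in> A \<Longrightarrow> \<exists>m. P m a"
    let ?F = "\<Union>a\<in>A. snd a"
    have F: "finite ?F" using A by (auto simp: P_def)
    obtain n where n: "\<And>S. S \<subseteq> block_vectors \<Longrightarrow>
        approx_on t (\<epsilon>/2) m {x\<in>S. \<exists>i. i \<notin> ?F \<and> e {i} x = x} \<Longrightarrow> approx_on t \<epsilon> n S"
      using multiplier_discard_blocks[OF t \<open>\<epsilon> > 0\<close> F, of m] by blast
    obtain S where S: "finite S" "S \<subseteq> block_vectors" "\<not> approx_on t \<epsilon> n S" using no by blast
    define S' where "S' = {x\<in>S. \<exists>i. i \<notin> ?F \<and> e {i} x = x}"
    have S': "finite S'" "\<not> approx_on t (\<epsilon>/2) m S'" using n[OF S(2)] S(1,3) by (auto simp: S'_def)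
    have "\<forall>x\<in>S'. \<exists>i. i \<notin> ?F \<and> e {i} x = x" by (auto simp: S'_def)
    then obtain h where h: "\<forall>x\<in>S'. h x \<notin> ?F \<and> e {h x} x = x" by (rule bchoice[THEN exE])
    have "P m (S', h ` S')" unfolding P_def fst_conv snd_conv using S' h by blast
    moreover have "R m a (S', h ` S')" if "a \<in> A" for a unfolding R_def snd_conv using h that by blast
    ultimately show "\<exists>x. P m x \<and> (\<forall>a\<in>A. R m a x)" by blast
  qed
  then obtain f where f: "\<And>n. P n (f n)" "\<And>m n. m < n \<Longrightarrow> R n (f m) (f n)" by blast
  define S where "S n = fst (f n)" for n
  define F where "F n = snd (f n)" for n
  have SF: "finite (S n)" "\<And>v. v \<in> S n \<Longrightarrow> \<exists>i\<in>F n. e {i} v = v" "\<not> approx_on t (\<epsilon>/2) n (S n)" for n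
    using f(1)[of n] by (auto simp: P_def S_def F_def)
  have disj: "m < n \<Longrightarrow> F m \<inter> F n = {}" for m n
    using f(2) by (auto simp: R_def F_def)
  define T where "T i = {x. \<exists>n. i \<in> F n \<and> x \<in> S n \<and> e {i} x = x}" for i
  have "finite (T i)" for i
  proof (cases "\<exists>n. i \<in> F n")
    case True
    then obtain n where "i \<in> F n" by blast
    then have "T i \<subseteq> S n" using disjoint_index_unique[of F, OF disj] by (auto simp: T_def)
    then show ?thesis using SF(1) finite_subset by blast
  qed (simp add: T_def)
  then have "\<exists>q. block_proj T q" by (intro ex_block_proj) (auto simp: T_def)
  then obtain q where bq: "block_proj T q" by blast
  note q = block_projD[OF bq]
  have qS: "q x = x" if "x \<in> S n" for n x
    using SF(2)[OF that] q(4)[of x] that by (auto simp: T_def)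
  have "t o\<^sub>L q \<in> cp" using t q(3) roe_subset_cp by (auto simp: multiplier_def)
  moreover have "\<epsilon>/2 > 0" using \<open>\<epsilon> > 0\<close> by simp
  \<comment> \<open>The propagation \<open>n\<close> of the approximant selects the set
    \<open>S n\<close> on which the contradiction occurs.\<close>
  ultimately obtain s n where s: "propag n s" "norm ((t o\<^sub>L q) - s) \<le> \<epsilon>/2"
    unfolding cp_def using closure_normD by blast
  have q_id: "q y = y" if "y \<in> cspan (S n)" for y
    using that
  proof (induction rule: complex_vector.span_induct_alt)
    case (step c x y)
    then show ?case using qS by (simp add: blinfun.add_right bounded_opsD[OF projection_bounded[OF q(1)]])
  qed simp
  have "cmod (cinner x ((t - s) y)) \<le> \<epsilon>/2 * norm x * norm y" if "y \<in> cspan (S n)" for x y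
  proof -
    have "(t - s) y = ((t o\<^sub>L q) - s) y" using q_id[OF that] by (simp add: blinfun.diff_left)
    then have "cmod (cinner x ((t - s) y)) \<le> norm ((t o\<^sub>L q) - s) * norm y * norm x"
      by (simp only: cmod_cinner_blinfun_le)
    also have "\<dots> \<le> \<epsilon>/2 * norm y * norm x" by (intro mult_right_mono s(2)) auto
    finally show ?thesis by (simp add: mult_ac)
  qed
  then have "approx_on t (\<epsilon>/2) n (S n)" using s(1) by (auto simp: approx_on_def)
  then show False using SF(3) by blast
qed

theorem multiplier_in_cp:
  assumes t: "multiplier t" shows "t \<in> cp"
  unfolding cp_def
proof (rule closure_normI)
  fix \<epsilon> :: real assume "\<epsilon> > 0"
  have tb: "t \<in> bounded_ops" using t by (simp add: multiplier_def)
  obtain n where n: "\<And>S. finite S \<Longrightarrow> S \<subseteq> block_vectors \<Longrightarrow> approx_on t \<epsilon> n S"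
    using multiplier_uniform_approx[OF t \<open>\<epsilon> > 0\<close>] by blast
  have "\<exists>s. propag n s \<and> norm (t - s) \<le> \<epsilon>"
    by (rule propag_approx_limit[OF tb _ n]) (use \<open>\<epsilon> > 0\<close> in auto)
  then show "\<exists>s\<in>{t. \<exists>n. propag n t}. norm (t - s) \<le> \<epsilon>" by blast
qed

section \<open>Unitaries normalizing one of the two algebras\<close>

text \<open>A corner \<open>q \<B>(\<H>) q\<close> that lies in the band algebra is concentrated on finitely many blocks: otherwise one
  finds unit vectors \<open>w\<^sub>n\<close> with disjoint, mutually remote supports that are not nearly orthogonal to the
  range of \<open>q\<close>, and \<open>q T q\<close> with \<open>T = \<Sum>\<^sub>m ketbra w\<^sub>2\<^sub>m\<^sub>+\<^sub>1 w\<^sub>2\<^sub>m\<close> has matrix entries far from the diagonal that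
  do not tend to \<open>0\<close>.\<close>

lemma corner_tail:
  assumes q: "projection_op q" and corner: "\<And>T. T \<in> bounded_ops \<Longrightarrow> q o\<^sub>L T o\<^sub>L q \<in> cp" and "\<delta> > 0"
  shows "\<exists>B. finite B \<and> norm (e (- B) o\<^sub>L q) \<le> \<delta>"
proof (rule ccontr)
  assume no: "\<not> ?thesis"
  \<comment> \<open>In the entry of \<open>q o\<^sub>L T o\<^sub>L q\<close> between
    \<open>w (2*n)\<close> and \<open>w (2*n+1)\<close> the \<open>n\<close>-th term is at least
    \<open>\<delta> ^ 4 = 2 * c\<close>, and the other terms together take away at most
    \<open>c\<close>.\<close>
  define c where "c = \<delta> ^ 4 / 2"
  have c: "c > 0" using \<open>\<delta> > 0\<close> by (simp add: c_def)
  define P where "P (n::nat) x \<longleftrightarrow> finite (snd x) \<and> e (snd x) (fst x) = fst x \<and> norm (fst x) = 1 \<and> norm (q (fst x)) \<ge> \<delta>"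
    for n and x :: "'h \<times> 'i set"
  \<comment> \<open>The bound decays with the index of the later vector, which makes the unwanted
    terms of each entry summable; remoteness at the growing scale \<open>n\<close> eventually
    exceeds any propagation bound.\<close>
  define R where "R n a x \<longleftrightarrow> (\<forall>i\<in>snd a. \<forall>j\<in>snd x. \<not> near n i j) \<and> cmod (cinner (fst x) (q (fst a))) \<le> c * (1/2) ^ n"
    for n and a x :: "'h \<times> 'i set"
  have "\<exists>f. (\<forall>n. P n (f n)) \<and> (\<forall>m n. m < n \<longrightarrow> R n (f m) (f n))"
  proof (rule gliding_hump[of P R])
    fix n and A :: "('h \<times> 'i set) set" assume A: "finite A" "\<And>a. a \<in> A \<Longrightarrow> \<exists>m. P m a"
    have eps: "c * (1/2) ^ n > 0" using c by simp
    have "\<forall>a :: 'h \<times> 'i set. \<exists>F. finite F \<and> (\<forall>G. F \<subseteq> G \<longrightarrow> norm (e (- G) (q (fst a))) \<le> c * (1/2) ^ n)"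
    proof
      fix a :: "'h \<times> 'i set"
      show "\<exists>F. finite F \<and> (\<forall>G. F \<subseteq> G \<longrightarrow> norm (e (- G) (q (fst a))) \<le> c * (1/2) ^ n)"
        using e_dense_compl[OF eps, of "q (fst a)"] by metis
    qed
    then obtain F where F: "\<And>a :: 'h \<times> 'i set. finite (F a)" "\<And>a G. F a \<subseteq> G \<Longrightarrow> norm (e (- G) (q (fst a))) \<le> c * (1/2) ^ n"
      by metis
    define B where "B = (\<Union>a\<in>A. F a \<union> {j. \<exists>i\<in>snd a. near n i j})"
    have "finite {j. \<exists>i\<in>snd a. near n i j}" if "a \<in> A" for a
      using A(2)[OF that] by (intro near_finite_set) (auto simp: P_def)
    then have B: "finite B" using A(1) F(1) by (auto simp: B_def)
    then have "norm (e (- B) o\<^sub>L q) > \<delta>" using no by (simp add: not_le)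
    from norm_blinfun_unit_bound[OF this less_imp_le[OF \<open>\<delta> > 0\<close>]]
    obtain v where v: "norm v \<le> 1" "norm ((e (- B) o\<^sub>L q) v) > \<delta>" by blast
    have "norm (e (- B) (q v)) > \<delta>" using v(2) by simp
    from norm_e_gt_finite[OF this]
    obtain G where G: "finite G" "G \<subseteq> - B" "norm (e G (q v)) > \<delta>" by blast
    define y where "y = e G (q v)"
    have y: "norm y > \<delta>" "y \<noteq> 0" using G(3) \<open>\<delta> > 0\<close> by (auto simp: y_def)
    define w where "w = complex_of_real (1 / norm y) *\<^sub>C y"
    have nw: "norm w = 1" using y(2) by (simp add: w_def norm_scaleC norm_divide)
    have ew: "e G w = w" by (simp add: w_def y_def bounded_opsD)
    have "cinner w (q v) = complex_of_real (norm y)"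
    proof -
      have "cinner y (q v) = cinner y y" by (simp add: y_def e_cinner)
      then show ?thesis using y(2) by (simp add: w_def cinner_scaleC_left cinner_eq_norm power2_eq_square)
    qed
    then have "norm y = cmod (cinner (q w) v)" by (simp add: projection_cinner[OF q])
    also have "\<dots> \<le> norm (q w) * norm v" by (rule Cauchy_Schwarz)
    also have "\<dots> \<le> norm (q w) * 1" by (intro mult_left_mono v(1)) simp
    finally have qw: "norm (q w) \<ge> \<delta>" using y(1) by simp
    have "R n a (w, G)" if a: "a \<in> A" for a
      unfolding R_def fst_conv snd_conv
    proof
      show "\<forall>i\<in>snd a. \<forall>j\<in>G. \<not> near n i j" using G(2) a by (auto simp: B_def)
      have "cinner w (q (fst a)) = cinner w (e G (q (fst a)))"
        using e_cinner[of G w "q (fst a)"] by (simp only: ew)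
      then have "cmod (cinner w (q (fst a))) \<le> norm w * norm (e G (q (fst a)))"
        by (simp only: Cauchy_Schwarz)
      also have "\<dots> \<le> norm (e (- B) (q (fst a)))" using G(2) by (simp add: nw e_norm_mono)
      also have "\<dots> \<le> c * (1/2) ^ n" using a by (intro F(2)) (auto simp: B_def)
      finally show "cmod (cinner w (q (fst a))) \<le> c * (1/2) ^ n" .
    qed
    moreover have "P n (w, G)" using G(1) ew nw qw by (simp add: P_def)
    ultimately show "\<exists>x. P n x \<and> (\<forall>a\<in>A. R n a x)" by blast
  qed
  then obtain f where f: "\<And>n. P n (f n)" "\<And>m n. m < n \<Longrightarrow> R n (f m) (f n)" by blast
  define w where "w n = fst (f n)" for n
  define G where "G n = snd (f n)" for n
  have wG: "finite (G n)" "e (G n) (w n) = w n" "norm (w n) = 1" "norm (q (w n)) \<ge> \<delta>" for n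
    using f(1)[of n] by (auto simp: P_def w_def G_def)
  have far: "\<not> near n i j" if "m < n" "i \<in> G m" "j \<in> G n" for m n i j
    using f(2)[OF that(1)] that(2,3) by (auto simp: R_def G_def)
  have off: "cmod (cinner (w n) (q (w m))) \<le> c * (1/2) ^ n" if "m < n" for m n
    using f(2)[OF that] by (simp add: R_def w_def)
  have off': "cmod (cinner (w m) (q (w n))) \<le> c * (1/2) ^ n" if "m < n" for m n
    using off[OF that] by (metis cinner_commute complex_mod_cnj projection_cinner[OF q])
  have disj: "G m \<inter> G n = {}" if "m \<noteq> n" for m n
    using far[of m n] far[of n m] near_refl that by (metis disjoint_iff linorder_neqE_nat)
  have ortho: "cinner (w m) (w n) = 0" if "m \<noteq> n" for m n
    using e_orth[OF disj[OF that], of "w m" "w n"] by (simp add: wG(2))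
  have "\<exists>T. T \<in> bounded_ops \<and> (\<forall>x. ((\<lambda>m. cinner (w (2*m)) x *\<^sub>C w (2*m+1)) has_sum blinfun_apply T x) UNIV)"
  proof (rule orthogonal_strong_sum[of UNIV "\<lambda>m x. cinner (w (2*m)) x *\<^sub>C w (2*m+1)"
        "\<lambda>m. ketbra (w (2*m)) (w (2*m))" 1])
    show "projection_op (ketbra (w (2*m)) (w (2*m)))" for m by (rule ketbra_projection[OF wG(3)])
    show "cinner (ketbra (w (2*m)) (w (2*m)) x) (ketbra (w (2*n)) (w (2*n)) y) = 0" if "m \<noteq> n" for m n x y
      using ortho[of "2*m" "2*n"] that by (simp add: cinner_scaleC_left cinner_scaleC_right)
    show "cinner (cinner (w (2*m)) x *\<^sub>C w (2*m+1)) (cinner (w (2*n)) y *\<^sub>C w (2*n+1)) = 0" if "m \<noteq> n" for m n x y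
      using ortho[of "2*m+1" "2*n+1"] that by (simp add: cinner_scaleC_left cinner_scaleC_right)
  qed (auto simp: cinner_add_right scaleC_add_left cinner_scaleC_right scaleC_scaleC norm_scaleC wG(3))
  then obtain T where T: "T \<in> bounded_ops"
    "\<And>x. ((\<lambda>m. cinner (w (2*m)) x *\<^sub>C w (2*m+1)) has_sum T x) UNIV" by blast
  have entry: "cmod (cinner (w (2*n+1)) ((q o\<^sub>L T o\<^sub>L q) (w (2*n)))) \<ge> c" for n
  proof -
    define a where "a m = cinner (w (2*m)) (q (w (2*n))) * cinner (q (w (2*n+1))) (w (2*m+1))" for m
    have hs: "(a has_sum cinner (q (w (2*n+1))) (T (q (w (2*n))))) UNIV"
      using has_sum_bounded_linear[OF bounded_linear_cinner_right T(2)[of "q (w (2*n))"], of "q (w (2*n+1))"]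
      by (simp add: a_def[abs_def] cinner_scaleC_right)
    have "cinner (w k) (q (w k)) = complex_of_real ((norm (q (w k)))\<^sup>2)" for k
      by (metis cinner_eq_norm projection_cinner[OF q] projection_idem[OF q])
    then have "a n = complex_of_real ((norm (q (w (2*n))))\<^sup>2 * (norm (q (w (2*n+1))))\<^sup>2)"
      by (simp add: a_def projection_cinner[OF q])
    moreover have "\<delta>\<^sup>2 * \<delta>\<^sup>2 \<le> (norm (q (w (2*n))))\<^sup>2 * (norm (q (w (2*n+1))))\<^sup>2"
      by (intro mult_mono power_mono wG(4)) (use \<open>\<delta> > 0\<close> in auto)
    ultimately have diag: "cmod (a n) \<ge> 2 * c"
      by (simp add: c_def norm_mult norm_power power4_eq_xxxx power2_eq_square)
    \<comment> \<open>One factor of \<open>a m\<close> is at most 1. The other is bounded with the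
      larger of \<open>2*n+1\<close> and \<open>2*m+1\<close> as exponent, which is at least
      \<open>Suc m\<close> in either case.\<close>
    have offdiag: "cmod (a m) \<le> c * (1/2) ^ Suc m" if "m \<noteq> n" for m
    proof -
      have 1: "cmod (cinner (q (w (2*n+1))) (w (2*m+1))) \<le> c * (1/2) ^ Suc m"
      proof (cases "m < n")
        case True
        have "cmod (cinner (q (w (2*n+1))) (w (2*m+1))) \<le> c * (1/2) ^ (2*n+1)"
          using off[of "2*m+1" "2*n+1"] True by (simp add: projection_cinner[OF q])
        also have "\<dots> \<le> c * (1/2) ^ Suc m" by (intro mult_left_mono power_decreasing) (use True c in auto)
        finally show ?thesis .
      next
        case False
        have "cmod (cinner (q (w (2*n+1))) (w (2*m+1))) \<le> c * (1/2) ^ (2*m+1)"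
          using off'[of "2*n+1" "2*m+1"] False that by (simp add: projection_cinner[OF q])
        also have "\<dots> \<le> c * (1/2) ^ Suc m" by (intro mult_left_mono power_decreasing) (use c in auto)
        finally show ?thesis .
      qed
      have "cmod (cinner (w (2*m)) (q (w (2*n)))) \<le> norm (w (2*m)) * norm (q (w (2*n)))" by (rule Cauchy_Schwarz)
      also have "\<dots> \<le> 1" using projection_norm_le[OF q, of "w (2*n)"] by (simp add: wG(3))
      finally have 2: "cmod (cinner (w (2*m)) (q (w (2*n)))) \<le> 1" .
      have "cmod (a m) \<le> 1 * (c * (1/2) ^ Suc m)"
        unfolding a_def norm_mult by (intro mult_mono 1 2) auto
      then show ?thesis by simp
    qed
    have part: "c \<le> cmod (sum a F)" if F: "finite F" "n \<in> F" for F
    proof -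
      have "cmod (sum a (F - {n})) \<le> (\<Sum>m\<in>F - {n}. c * (1/2) ^ Suc m)"
        by (rule order_trans[OF norm_sum sum_mono]) (rule offdiag, simp)
      also have "\<dots> = c * (\<Sum>m\<in>F - {n}. (1/2) ^ Suc m)" by (rule sum_distrib_left[symmetric])
      also have "\<dots> \<le> c * 1" by (intro mult_left_mono sum_inverse_powers_le_1) (use F c in auto)
      finally have "cmod (sum a (F - {n})) \<le> c" by simp
      moreover have "sum a F = a n + sum a (F - {n})" using F by (simp add: sum.remove)
      ultimately show ?thesis using diag norm_diff_ineq[of "a n" "sum a (F - {n})"] by simp
    qed
    have "c \<le> cmod (cinner (q (w (2*n+1))) (T (q (w (2*n)))))"
    proof (rule tendsto_lowerbound)
      show "((\<lambda>F. cmod (sum a F)) \<longlongrightarrow> cmod (cinner (q (w (2*n+1))) (T (q (w (2*n)))))) (finite_subsets_at_top UNIV)"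
        using hs unfolding has_sum_def by (rule tendsto_norm)
      show "\<forall>\<^sub>F F in finite_subsets_at_top UNIV. c \<le> cmod (sum a F)"
        unfolding eventually_finite_subsets_at_top using part by (intro exI[of _ "{n}"]) auto
    qed simp
    then show ?thesis by (simp add: projection_cinner[OF q])
  qed
  have "c/2 > 0" using c by simp
  from closure_normD[OF corner[OF T(1), unfolded cp_def] this]
  obtain s N where s: "propag N s" "norm ((q o\<^sub>L T o\<^sub>L q) - s) \<le> c/2" by blast
  \<comment> \<open>The supports \<open>G (2*N)\<close> and \<open>G (2*N+1)\<close> are not near at
    scale \<open>2*N+1\<close>, hence not at scale \<open>N\<close>, so the entry of
    \<open>s\<close> vanishes while that of \<open>q o\<^sub>L T o\<^sub>L q\<close> is at least
    \<open>c\<close>.\<close>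
  have "e (G (2*N+1)) (s (e (G (2*N)) (w (2*N)))) = 0"
  proof (rule propag_far[OF s(1)])
    fix i j assume "i \<in> G (2*N)" "j \<in> G (2*N+1)"
    then have "\<not> near (2*N+1) i j" by (intro far) auto
    then show "\<not> near N j i" using near_mono[of N i j "2*N+1"] near_sym[of N j i] by auto
  qed
  then have "cinner (w (2*N+1)) (s (w (2*N))) = 0"
    using e_cinner[of "G (2*N+1)" "w (2*N+1)" "s (w (2*N))"] by (simp add: wG(2))
  then have "cinner (w (2*N+1)) ((q o\<^sub>L T o\<^sub>L q) (w (2*N))) = cinner (w (2*N+1)) (((q o\<^sub>L T o\<^sub>L q) - s) (w (2*N)))"
    by (simp add: blinfun.diff_left cinner_diff_right)
  then have "c \<le> norm ((q o\<^sub>L T o\<^sub>L q) - s) * norm (w (2*N)) * norm (w (2*N+1))"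
    using entry[of N] cmod_cinner_blinfun_le[of "w (2*N+1)" "(q o\<^sub>L T o\<^sub>L q) - s" "w (2*N)"] by simp
  also have "\<dots> \<le> c/2" using s(2) by (simp add: wG(3))
  finally show False using c by simp
qed

text \<open>\<open>roeI\<close> reduces the claim to compact rows
  \<open>e {j} o\<^sub>L Ad U t\<close>, that is, to compactness of \<open>q o\<^sub>L t\<close> for
  \<open>q = Ad (adj U) (e {j})\<close>. Every operator from the single block \<open>j\<close> to
  itself has propagation 0 and is carried back into \<open>cp\<close>, which is the hypothesis of
  \<open>corner_tail\<close>. Hence \<open>q\<close> is nearly \<open>q o\<^sub>L e B\<close> with
  \<open>B\<close> finite, and \<open>e B o\<^sub>L t\<close> is compact.\<close>

lemma Ad_cp_imp_roe:
  assumes U: "unitary_op U" and Ucp: "\<And>t. t \<in> cp \<Longrightarrow> Ad U t \<in> cp" "\<And>t. t \<in> cp \<Longrightarrow> Ad (adj U) t \<in> cp"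
    and t: "t \<in> roe"
  shows "Ad U t \<in> roe"
proof (rule roeI)
  have Ub: "U \<in> bounded_ops" "adj U \<in> bounded_ops" using U unitary_adj[OF U] by (auto simp: unitary_op_def)
  have UU: "adj (adj U) = U" by (rule adj_adj[OF Ub(1)])
  note Uapp = unitary_apply[OF U]
  have tb: "t \<in> bounded_ops" by (rule roe_bounded[OF t])
  show "Ad U t \<in> cp" using t roe_subset_cp by (intro Ucp(1)) blast
  fix j
  define q where "q = Ad (adj U) (e {j})"
  have qx: "q x = adj U (e {j} (U x))" for x by (simp add: q_def Ad_def UU)
  have qb: "q \<in> bounded_ops" using Ub by (auto simp: q_def Ad_def UU)
  have q: "projection_op q"
    by (rule projectionI[OF qb]) (simp_all add: qx Uapp cinner_adj_left[OF Ub(1)] cinner_adj_right[OF Ub(1)] e_cinner)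
  have corner: "q o\<^sub>L T o\<^sub>L q \<in> cp" if "T \<in> bounded_ops" for T
  proof -
    have "propag 0 (e {j} o\<^sub>L Ad U T o\<^sub>L e {j})"
      by (rule propag_corner) (use that Ub near_refl in \<open>auto simp: Ad_def\<close>)
    then have "Ad (adj U) (e {j} o\<^sub>L Ad U T o\<^sub>L e {j}) \<in> cp" by (intro Ucp(2) propag_in_cp)
    moreover have "Ad (adj U) (e {j} o\<^sub>L Ad U T o\<^sub>L e {j}) = q o\<^sub>L T o\<^sub>L q"
      by (rule blinfun_eqI) (simp add: Ad_def qx UU)
    ultimately show ?thesis by simp
  qed
  have "compact_op (q o\<^sub>L t)"
  proof (rule compact_op_limit)
    show "q o\<^sub>L t \<in> bounded_ops" using qb tb by auto
    fix \<epsilon> :: real assume "\<epsilon> > 0"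
    define M where "M = norm t + 1"
    have M: "M > 0" by (simp add: M_def add_nonneg_pos)
    obtain B where B: "finite B" "norm (e (- B) o\<^sub>L q) \<le> \<epsilon> / M"
      using corner_tail[OF q corner, of "\<epsilon> / M"] \<open>\<epsilon> > 0\<close> M by auto
    have "norm (q o\<^sub>L e (- B)) = norm (e (- B) o\<^sub>L q)"
      using norm_adj[of "e (- B) o\<^sub>L q"] qb by (simp add: adj_compose e_adj projection_adj[OF q] bounded_ops_compose)
    then have "norm ((q o\<^sub>L e (- B)) o\<^sub>L t) \<le> \<epsilon> / M * M"
      using B(2) by (intro norm_compose_le) (auto simp: M_def)
    then have "norm ((q o\<^sub>L t) - (q o\<^sub>L (e B o\<^sub>L t))) \<le> \<epsilon>"
      using M by (simp add: e_compl blinfun_compose_diff_left blinfun_compose_diff_right blinfun_compose_assoc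
          blinfun_eqI[of "id_blinfun o\<^sub>L t" t])
    moreover have "compact_op (e B o\<^sub>L t)"
      by (rule compact_e_finite_left[OF _ B(1)]) (use roe_lc[OF t] in \<open>auto simp: lc_def\<close>)
    ultimately show "\<exists>s. compact_op s \<and> norm ((q o\<^sub>L t) - s) \<le> \<epsilon>" using qb by blast
  qed
  then have "compact_op (U o\<^sub>L (q o\<^sub>L t) o\<^sub>L adj U)" using Ub by auto
  moreover have "U o\<^sub>L (q o\<^sub>L t) o\<^sub>L adj U = e {j} o\<^sub>L Ad U t"
    by (rule blinfun_eqI) (simp add: Ad_def qx Uapp)
  ultimately show "compact_op (e {j} o\<^sub>L Ad U t)" by simp
qed

text \<open>Products of \<open>Ad U t\<close> with an element of \<open>roe\<close> are pulled back
  by \<open>U\<close>, formed there with \<open>t\<close>, where \<open>roe\<close> is an ideal of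
  \<open>cp\<close>, and pushed forward again; so \<open>Ad U t\<close> is a multiplier.\<close>

lemma Ad_roe_imp_cp:
  assumes U: "unitary_op U" and Uroe: "\<And>t. t \<in> roe \<Longrightarrow> Ad U t \<in> roe" "\<And>t. t \<in> roe \<Longrightarrow> Ad (adj U) t \<in> roe"
    and t: "t \<in> cp"
  shows "Ad U t \<in> cp"
proof (rule multiplier_in_cp)
  have Ub: "U \<in> bounded_ops" "adj U \<in> bounded_ops" using U unitary_adj[OF U] by (auto simp: unitary_op_def)
  have UU: "adj (adj U) = U" by (rule adj_adj[OF Ub(1)])
  note Uapp = unitary_apply[OF U]
  show "multiplier (Ad U t)"
    unfolding multiplier_def
  proof (intro conjI ballI)
    show "Ad U t \<in> bounded_ops" using Ub cp_bounded[OF t] by (auto simp: Ad_def)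
    fix a assume a: "a \<in> roe"
    have "Ad U t o\<^sub>L a = Ad U (t o\<^sub>L Ad (adj U) a)" "a o\<^sub>L Ad U t = Ad U (Ad (adj U) a o\<^sub>L t)"
      by (rule blinfun_eqI, simp add: Ad_def Uapp UU)+
    then show "Ad U t o\<^sub>L a \<in> roe" "a o\<^sub>L Ad U t \<in> roe"
      using Uroe(1)[OF cp_roe_compose[OF t Uroe(2)[OF a]]] Uroe(1)[OF roe_cp_compose[OF Uroe(2)[OF a] t]]
      by simp_all
  qed
qed

text \<open>\<open>Ad U\<close> respects all the operations on bounded operators, so only
  bijectivity on \<open>A\<close> is at stake, and \<open>Ad (adj U)\<close> inverts it.\<close>

lemma star_automorphism_Ad_iff:
  assumes U: "unitary_op U" and A: "A \<subseteq> bounded_ops"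
  shows "star_automorphism A (Ad U) \<longleftrightarrow> (\<forall>t\<in>A. Ad U t \<in> A \<and> Ad (adj U) t \<in> A)"
proof -
  have Ub: "U \<in> bounded_ops" "adj U \<in> bounded_ops" using U unitary_adj[OF U] by (auto simp: unitary_op_def)
  have UU: "adj (adj U) = U" by (rule adj_adj[OF Ub(1)])
  note Uapp = unitary_apply[OF U]
  have inv: "Ad U (Ad (adj U) t) = t" "Ad (adj U) (Ad U t) = t" for t
    by (rule blinfun_eqI, simp add: Ad_def Uapp UU)+
  have alg: "Ad U (s + t) = Ad U s + Ad U t" "Ad U (scaleC_op z t) = scaleC_op z (Ad U t)"
    "Ad U (s o\<^sub>L t) = Ad U s o\<^sub>L Ad U t" for s t z
    by (rule blinfun_eqI, simp add: Ad_def Uapp blinfun.add_left blinfun.add_right scaleC_op.rep_eq bounded_opsD[OF Ub(1)])+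
  have "Ad U (adj t) = adj (Ad U t)" if "t \<in> A" for t
  proof -
    have tb: "t \<in> bounded_ops" using A that by blast
    show ?thesis using Ub tb adj_bounded_ops[OF tb]
      by (simp add: Ad_def adj_compose bounded_ops_compose UU blinfun_compose_assoc)
  qed
  then have "star_automorphism A (Ad U) \<longleftrightarrow> bij_betw (Ad U) A A"
    by (auto simp: star_automorphism_def alg)
  also have "\<dots> \<longleftrightarrow> (\<forall>t\<in>A. Ad U t \<in> A \<and> Ad (adj U) t \<in> A)"
  proof
    assume b: "bij_betw (Ad U) A A"
    show "\<forall>t\<in>A. Ad U t \<in> A \<and> Ad (adj U) t \<in> A"
    proof
      fix t assume t: "t \<in> A"
      then obtain s where "s \<in> A" "t = Ad U s" using b by (auto simp: bij_betw_def)
      then show "Ad U t \<in> A \<and> Ad (adj U) t \<in> A" using b t inv(2) by (auto simp: bij_betw_def)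
    qed
  next
    assume "\<forall>t\<in>A. Ad U t \<in> A \<and> Ad (adj U) t \<in> A"
    then show "bij_betw (Ad U) A A"
      by (intro bij_betwI[where g = "Ad (adj U)"]) (auto simp: inv)
  qed
  finally show ?thesis .
qed

theorem Ad_cp_iff_Ad_roe:
  assumes U: "unitary_op U"
  shows "star_automorphism cp (Ad U) \<longleftrightarrow> star_automorphism roe (Ad U)"
proof -
  have Ub: "U \<in> bounded_ops" using U by (simp add: unitary_op_def)
  have sub: "cp \<subseteq> bounded_ops" "roe \<subseteq> bounded_ops" using cp_bounded roe_bounded by auto
  have U': "unitary_op (adj U)" by (rule unitary_adj[OF U])
  have UU: "adj (adj U) = U" by (rule adj_adj[OF Ub])
  show ?thesis
    unfolding star_automorphism_Ad_iff[OF U sub(1)] star_automorphism_Ad_iff[OF U sub(2)]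
  proof
    assume cp: "\<forall>t\<in>cp. Ad U t \<in> cp \<and> Ad (adj U) t \<in> cp"
    show "\<forall>t\<in>roe. Ad U t \<in> roe \<and> Ad (adj U) t \<in> roe"
    proof (intro ballI conjI)
      fix t assume t: "t \<in> roe"
      show "Ad U t \<in> roe" by (rule Ad_cp_imp_roe[OF U _ _ t]) (use cp in auto)
      show "Ad (adj U) t \<in> roe" by (rule Ad_cp_imp_roe[OF U' _ _ t]) (use cp UU in auto)
    qed
  next
    assume roe: "\<forall>t\<in>roe. Ad U t \<in> roe \<and> Ad (adj U) t \<in> roe"
    show "\<forall>t\<in>cp. Ad U t \<in> cp \<and> Ad (adj U) t \<in> cp"
    proof (intro ballI conjI)
      fix t assume t: "t \<in> cp"
      show "Ad U t \<in> cp" by (rule Ad_roe_imp_cp[OF U _ _ t]) (use roe in auto)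
      show "Ad (adj U) t \<in> cp" by (rule Ad_roe_imp_cp[OF U' _ _ t]) (use roe UU in auto)
    qed
  qed
qed

section \<open>Automorphisms are spatial\<close>

lemma e_has_sum: "((\<lambda>i. e {i} x) has_sum x) UNIV"
  unfolding has_sum_def tendsto_iff
proof (intro allI impI)
  fix \<epsilon> :: real assume "\<epsilon> > 0"
  then have "\<epsilon>/2 > 0" by simp
  from e_dense_compl[OF this, of x]
  obtain F where F: "finite F" "\<And>G. F \<subseteq> G \<Longrightarrow> norm (e (- G) x) \<le> \<epsilon>/2" by blast
  have "dist (\<Sum>i\<in>G. e {i} x) x < \<epsilon>" if "finite G" "F \<subseteq> G" for G
    using F(2)[OF that(2)] \<open>\<epsilon> > 0\<close>
    by (simp add: dist_norm norm_minus_commute e_compl_apply flip: e_finite[OF that(1)])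
  then show "\<forall>\<^sub>F G in finite_subsets_at_top UNIV. dist (\<Sum>i\<in>G. e {i} x) x < \<epsilon>"
    unfolding eventually_finite_subsets_at_top using F(1) by (intro exI[of _ F]) auto
qed

lemma cp_adj: assumes t: "t \<in> cp" shows "adj t \<in> cp"
  unfolding cp_def
proof (rule closure_normI)
  fix \<epsilon> :: real assume "\<epsilon> > 0"
  from closure_normD[OF t[unfolded cp_def] this]
  obtain s n where s: "propag n s" "norm (t - s) \<le> \<epsilon>" by blast
  have "norm (adj t - adj s) \<le> \<epsilon>"
    using s cp_bounded[OF t] propag_bounded[OF s(1)] by (metis adj_diff bounded_ops_diff norm_adj)
  then show "\<exists>s\<in>{t. \<exists>n. propag n t}. norm (adj t - s) \<le> \<epsilon>"
    using propag_adj[OF s(1)] by blast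
qed

text \<open>With this, closure of both algebras under scalars becomes a case of closure under
  composition.\<close>

lemma scaleC_op_propag: "propag 0 (scaleC_op c id_blinfun)"
  unfolding propag_def
proof (intro conjI allI impI)
  fix i j x assume "\<not> near 0 j i"
  then have "{j} \<inter> {i} = {}" using near_refl by auto
  then show "e {j} (scaleC_op c id_blinfun (e {i} x)) = 0" by (simp add: bounded_opsD)
qed auto

lemma scaleC_op_compose: "scaleC_op c t = scaleC_op c id_blinfun o\<^sub>L t"
  by (rule blinfun_eqI) simp

lemma cp_scaleC: "t \<in> cp \<Longrightarrow> scaleC_op c t \<in> cp"
  by (subst scaleC_op_compose) (rule cp_compose[OF propag_in_cp[OF scaleC_op_propag]])

lemma roe_scaleC: "t \<in> roe \<Longrightarrow> scaleC_op c t \<in> roe"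
  by (subst scaleC_op_compose) (rule cp_roe_compose[OF propag_in_cp[OF scaleC_op_propag]])

lemma ketbra_in_roe:
  assumes "conn i j" "e {i} x = x" "e {j} y = y" shows "ketbra x y \<in> roe"
proof -
  obtain n where "near n i j" using assms(1) by (auto simp: conn_def)
  then show ?thesis by (intro propag_lc_in_roe[OF propag_ketbra[OF assms(2,3)] lc_ketbra])
qed

end

text \<open>The properties shared by \<open>cp\<close> and \<open>roe\<close> that make
  automorphisms spatial, collected so that the argument runs once. Rank one operators are available
  only inside a coarse component; nonzero ones between different components are excluded by
  \<open>A \<subseteq> cp\<close>.\<close>

locale block_algebra = block_module e near
  for e :: "'i set \<Rightarrow> ('h::chilbert_space \<Rightarrow>\<^sub>L 'h)" and near +
  fixes A :: "('h \<Rightarrow>\<^sub>L 'h) set"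
  assumes A_cp: "A \<subseteq> cp"
    and A_compose: "s \<in> A \<Longrightarrow> t \<in> A \<Longrightarrow> s o\<^sub>L t \<in> A"
    and A_adj: "t \<in> A \<Longrightarrow> adj t \<in> A"
    and A_scaleC: "t \<in> A \<Longrightarrow> scaleC_op c t \<in> A"
    and A_ketbra: "conn i j \<Longrightarrow> e {i} x = x \<Longrightarrow> e {j} y = y \<Longrightarrow> ketbra x y \<in> A"
begin

lemma A_bounded: "t \<in> A \<Longrightarrow> t \<in> bounded_ops"
  using A_cp cp_bounded by blast

lemma A_zero: "0 \<in> A"
  using A_ketbra[of undefined undefined 0 0] by (simp add: conn_refl)

text \<open>Compress \<open>ketbra z z\<close> by \<open>p\<close>, where \<open>z\<close> lies in a block on which \<open>p\<close> does not vanish.\<close>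

lemma minimal_projection_rank_one:
  assumes p: "projection_op p" and "p \<noteq> 0" and min: "\<And>a. a \<in> A \<Longrightarrow> \<exists>c. p o\<^sub>L a o\<^sub>L p = scaleC_op c p"
  shows "\<exists>v. norm v = 1 \<and> p = ketbra v v"
proof -
  have "\<exists>i x. p (e {i} x) \<noteq> 0"
  proof (rule ccontr)
    assume "\<not> ?thesis"
    then have "p o\<^sub>L e {i} = 0 o\<^sub>L e {i}" for i by (intro blinfun_eqI) simp
    then have "p = 0" by (rule e_ext_right)
    with \<open>p \<noteq> 0\<close> show False by simp
  qed
  then obtain i x where ix: "p (e {i} x) \<noteq> 0" by blast
  define y where "y = p (e {i} x)"
  have y: "y \<noteq> 0" "p y = y" using ix by (simp_all add: y_def projection_idem[OF p])
  have pb: "p \<in> bounded_ops" by (rule projection_bounded[OF p])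
  have "ketbra (e {i} x) (e {i} x) \<in> A" by (rule A_ketbra[OF conn_refl[of i]]) simp_all
  then obtain c where c: "p o\<^sub>L ketbra (e {i} x) (e {i} x) o\<^sub>L p = scaleC_op c p" using min by blast
  have eq: "cinner y z *\<^sub>C y = c *\<^sub>C p z" for z
  proof -
    have "(p o\<^sub>L ketbra (e {i} x) (e {i} x) o\<^sub>L p) z = cinner y z *\<^sub>C y"
      by (simp add: bounded_opsD[OF pb] y_def flip: projection_cinner[OF p])
    then show ?thesis unfolding c by simp
  qed
  define N where "N = complex_of_real ((norm y)\<^sup>2)"
  have N: "N \<noteq> 0" using y(1) by (simp add: N_def)
  have cN: "c = N"
  proof -
    have "(N - c) *\<^sub>C y = 0" using eq[of y] y(2) by (simp add: cinner_eq_norm N_def complex_vector.scale_left_diff_distrib)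
    then show ?thesis using y(1) by (simp add: complex_vector.scale_eq_0_iff)
  qed
  define v where "v = complex_of_real (1 / norm y) *\<^sub>C y"
  have "norm v = 1" using y(1) by (simp add: v_def norm_scaleC norm_divide)
  moreover have "p = ketbra v v"
  proof (rule blinfun_eqI)
    fix z
    have "p z = (1 / N) *\<^sub>C (N *\<^sub>C p z)" using N by (simp add: scaleC_scaleC scaleC_one)
    also have "\<dots> = (1 / N) *\<^sub>C (cinner y z *\<^sub>C y)" by (simp only: eq[symmetric] cN[symmetric])
    also have "\<dots> = ketbra v v z"
      using y(1) by (simp add: v_def N_def scaleC_scaleC cinner_scaleC_left power2_eq_square)
    finally show "p z = ketbra v v z" .
  qed
  ultimately show ?thesis by blast
qed

lemma ketbra_compress: "ketbra u u o\<^sub>L a o\<^sub>L ketbra u u = scaleC_op (cinner u (a u)) (ketbra u u)" if "a \<in> bounded_ops"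
  by (rule blinfun_eqI) (simp add: bounded_opsD[OF that] cinner_scaleC_right scaleC_scaleC mult.commute)

text \<open>Choose a unit vector \<open>u i\<close> in some block of the component of \<open>i\<close> and let \<open>v i\<close> span the range of the
  image of the projection onto it; then \<open>U\<close> is given on the block \<open>i\<close> by \<open>x \<mapsto> \<Phi> (ketbra x (u i)) (v i)\<close>.\<close>

theorem automorphism_spatial:
  assumes \<Phi>: "star_automorphism A \<Phi>"
  shows "\<exists>U. unitary_op U \<and> (\<forall>t\<in>A. \<Phi> t = Ad U t)"
proof -
  have add: "\<Phi> (s + t) = \<Phi> s + \<Phi> t" if "s \<in> A" "t \<in> A" for s t
    using \<Phi> that by (simp add: star_automorphism_def)
  have scale: "\<Phi> (scaleC_op c t) = scaleC_op c (\<Phi> t)" if "t \<in> A" for c t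
    using \<Phi> that by (simp add: star_automorphism_def)
  have mult: "\<Phi> (s o\<^sub>L t) = \<Phi> s o\<^sub>L \<Phi> t" if "s \<in> A" "t \<in> A" for s t
    using \<Phi> that by (simp add: star_automorphism_def)
  have star: "\<Phi> (adj t) = adj (\<Phi> t)" if "t \<in> A" for t
    using \<Phi> that by (simp add: star_automorphism_def)
  have inj: "s = t" if "\<Phi> s = \<Phi> t" "s \<in> A" "t \<in> A" for s t
    using \<Phi> that by (auto simp: star_automorphism_def bij_betw_def inj_on_def)
  have into: "\<Phi> t \<in> A" if "t \<in> A" for t
    using \<Phi> that by (auto simp: star_automorphism_def bij_betw_def)
  have surj: "\<exists>s\<in>A. t = \<Phi> s" if "t \<in> A" for t
    using \<Phi> that by (auto simp: star_automorphism_def bij_betw_def)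
  have \<Phi>0: "\<Phi> 0 = 0" using add[OF A_zero A_zero] by simp
  have \<Phi>b: "\<Phi> t \<in> bounded_ops" if "t \<in> A" for t by (rule A_bounded[OF into[OF that]])

  \<comment> \<open>Being a nonzero projection that compresses the algebra to its own scalar
    multiples is expressed by the algebra operations alone, so \<open>\<Phi>\<close> preserves
    it.\<close>
  have rank_one: "\<exists>v. norm v = 1 \<and> \<Phi> (ketbra u u) = ketbra v v" if u: "norm u = 1" and uA: "ketbra u u \<in> A" for u
  proof (rule minimal_projection_rank_one)
    let ?k = "ketbra u u"
    have "?k o\<^sub>L ?k = ?k" "adj ?k = ?k" using ketbra_projection[OF u] by (simp_all add: projection_op_def)
    then have "\<Phi> ?k o\<^sub>L \<Phi> ?k = \<Phi> ?k" "adj (\<Phi> ?k) = \<Phi> ?k"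
      using mult[OF uA uA] star[OF uA] by simp_all
    then show "projection_op (\<Phi> ?k)" using \<Phi>b[OF uA] by (simp add: projection_op_def)
    have "?k u \<noteq> 0" using u by (auto simp: cinner_eq_norm scaleC_one)
    then have "?k \<noteq> 0" by (metis zero_blinfun.rep_eq)
    then show "\<Phi> ?k \<noteq> 0" using inj[OF _ uA A_zero] \<Phi>0 by auto
    fix a assume "a \<in> A"
    then obtain f where f: "f \<in> A" "a = \<Phi> f" using surj by blast
    have "\<Phi> ?k o\<^sub>L a o\<^sub>L \<Phi> ?k = \<Phi> (?k o\<^sub>L f o\<^sub>L ?k)"
      using mult[OF A_compose[OF uA f(1)] uA] mult[OF uA f(1)] f(2) by simp
    also have "\<dots> = scaleC_op (cinner u (f u)) (\<Phi> ?k)"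
      unfolding ketbra_compress[OF A_bounded[OF f(1)]] by (rule scale[OF uA])
    finally show "\<exists>c. \<Phi> ?k o\<^sub>L a o\<^sub>L \<Phi> ?k = scaleC_op c (\<Phi> ?k)" by blast
  qed

  \<comment> \<open>The reference vector is chosen as a function of the class as a set, so that
    \<open>conn i j\<close> makes \<open>u i\<close> and \<open>u j\<close>, and likewise
    \<open>v i\<close> and \<open>v j\<close>, literally equal.\<close>
  define cls where "cls i = {j. conn i j}" for i
  have cls_eq: "cls i = cls j" if "conn i j" for i j
    using that conn_sym conn_trans unfolding cls_def by blast
  \<comment> \<open>An index with \<open>e {i} = 0\<close> carries no unit vector, and
    \<open>u i\<close> may then be an arbitrary default; \<open>T i\<close> vanishes there in any
    case.\<close>
  define good where "good i \<longleftrightarrow> (\<exists>x. e {i} x \<noteq> 0)" for i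
  define isu where "isu C u \<longleftrightarrow> norm u = 1 \<and> (\<exists>k\<in>C. e {k} u = u)" for C u
  define uu where "uu C = (SOME u. isu C u)" for C
  define u where "u i = uu (cls i)" for i
  define v where "v i = (SOME v. norm v = 1 \<and> \<Phi> (ketbra (u i) (u i)) = ketbra v v)" for i
  have uv_eq: "u i = u j" "v i = v j" if "conn i j" for i j
    using cls_eq[OF that] by (simp_all add: u_def v_def)
  have "isu (cls i) (u i)" if "good i" for i
    unfolding u_def uu_def
  proof (rule someI_ex)
    obtain x where x: "e {i} x \<noteq> 0" using \<open>good i\<close> by (auto simp: good_def)
    let ?u = "complex_of_real (1 / norm (e {i} x)) *\<^sub>C e {i} x"
    have "norm ?u = 1" using x by (simp add: norm_scaleC norm_divide)
    moreover have "e {i} ?u = ?u" by (simp add: bounded_opsD)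
    moreover have "i \<in> cls i" by (simp add: cls_def conn_refl)
    ultimately have "isu (cls i) ?u" unfolding isu_def by blast
    then show "\<exists>u. isu (cls i) u" ..
  qed
  then have u: "norm (u i) = 1" "\<exists>k. conn i k \<and> e {k} (u i) = u i" if "good i" for i
    using that by (auto simp: isu_def cls_def)
  have ketu: "ketbra (e {i} x) (u i) \<in> A" for i x
  proof (cases "good i")
    case True
    then obtain k where "conn i k" "e {k} (u i) = u i" using u(2) by blast
    then show ?thesis by (intro A_ketbra) auto
  next
    case False
    then show ?thesis using A_zero by (simp add: good_def)
  qed
  have uuA: "ketbra (u i) (u i) \<in> A" if "good i" for i
  proof -
    obtain k where "conn i k" "e {k} (u i) = u i" using u(2)[OF \<open>good i\<close>] by blast
    then show ?thesis using A_ketbra[OF conn_refl[of k]] by blast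
  qed
  have v: "norm (v i) = 1" "\<Phi> (ketbra (u i) (u i)) = ketbra (v i) (v i)" if "good i" for i
    using someI_ex[OF rank_one[OF u(1)[OF that] uuA[OF that]]] by (simp_all add: v_def)

  have support: "w = e (cls i) w" if i: "good i" and w: "ketbra w (u i) \<in> A" for i w
  proof (rule e_ext)
    fix k
    show "e {k} w = e {k} (e (cls i) w)"
    proof (cases "conn i k")
      case True
      then show ?thesis by (simp add: cls_def)
    next
      case False
      obtain l where l: "conn i l" "e {l} (u i) = u i" using u(2)[OF i] by blast
      have "\<not> conn k l" using False l(1) conn_sym conn_trans by blast
      from cp_not_conn[OF _ this, of "ketbra w (u i)" "u i"] w A_cp
      have "e {k} w = 0" using u(1)[OF i] by (simp add: l(2) cinner_eq_norm scaleC_one subset_iff)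
      then show ?thesis using False by (simp add: cls_def)
    qed
  qed
  \<comment> \<open>The adjoint of the first operator times the second is the image of
    \<open>ketbra (u i) w o\<^sub>L ketbra w' (u j)\<close>. Inside one class this is
    \<open>cinner w w'\<close> times the rank one projection of \<open>v i\<close>; across classes
    \<open>w\<close> and \<open>w'\<close> are orthogonal and both sides vanish.\<close>
  have IP: "cinner (\<Phi> (ketbra w (u i)) (v i)) (\<Phi> (ketbra w' (u j)) (v j)) = cinner w w'"
    if i: "good i" and j: "good j" and w: "ketbra w (u i) \<in> A" and w': "ketbra w' (u j) \<in> A" for i j w w'
  proof -
    have w1: "ketbra (u i) w \<in> A" using A_adj[OF w] by (simp add: adj_ketbra)
    have "cinner (\<Phi> (ketbra w (u i)) (v i)) (\<Phi> (ketbra w' (u j)) (v j))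
        = cinner (v i) (adj (\<Phi> (ketbra w (u i))) (\<Phi> (ketbra w' (u j)) (v j)))"
      by (rule cinner_adj_right[OF \<Phi>b[OF w], symmetric])
    also have "\<dots> = cinner (v i) (\<Phi> (ketbra (u i) w o\<^sub>L ketbra w' (u j)) (v j))"
      using mult[OF w1 w'] star[OF w] by (simp add: adj_ketbra)
    also have "\<dots> = cinner w w'"
    proof (cases "conn i j")
      case True
      have "\<Phi> (ketbra (u i) w o\<^sub>L ketbra w' (u j)) = scaleC_op (cinner w w') (ketbra (v i) (v i))"
        using scale[OF uuA[OF i]] v(2)[OF i] by (simp add: ketbra_ketbra flip: uv_eq[OF True])
      then show ?thesis using v(1)[OF i] by (simp add: cinner_scaleC_right cinner_eq_norm flip: uv_eq[OF True])
    next
      case False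
      have "cls i \<inter> cls j = {}" using False conn_sym conn_trans unfolding cls_def by blast
      then have 0: "cinner w w' = 0"
        by (subst support[OF i w], subst support[OF j w']) (rule e_orth)
      then have "ketbra (u i) w o\<^sub>L ketbra w' (u j) = 0"
        by (intro blinfun_eqI) (simp add: cinner_scaleC_right)
      then show ?thesis using 0 by (simp add: \<Phi>0)
    qed
    finally show ?thesis .
  qed
  define T where "T i x = \<Phi> (ketbra (e {i} x) (u i)) (v i)" for i x
  have T_bad: "T i x = 0" if "\<not> good i" for i x using that by (simp add: T_def good_def \<Phi>0)
  have IP': "cinner (T i x) (\<Phi> (ketbra w (u j)) (v j)) = cinner (e {i} x) w"
    if "good j" "ketbra w (u j) \<in> A" for i j x w
  proof (cases "good i")
    case True
    then show ?thesis unfolding T_def using IP ketu that by blast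
  next
    case False
    then show ?thesis by (simp add: T_bad) (simp add: good_def)
  qed
  have T_norm: "norm (T i x) \<le> 1 * norm (e {i} x)" for i x
  proof (cases "good i")
    case True
    have "cinner (T i x) (T i x) = cinner (e {i} x) (e {i} x)"
      using IP'[OF True ketu[of i x], of i x] by (simp add: T_def)
    then show ?thesis by (simp add: norm_eq_sqrt_cinner)
  qed (simp add: T_bad)
  have T_orth: "cinner (T i x) (T j y) = 0" if "i \<noteq> j" for i j x y
  proof (cases "good j")
    case True
    have "cinner (T i x) (T j y) = cinner (e {i} x) (e {j} y)"
      using IP'[OF True ketu[of j y], of i x] by (simp add: T_def)
    then show ?thesis using e_orth[of "{i}" "{j}"] that by simp
  qed (simp add: T_bad)
  have "\<exists>U. U \<in> bounded_ops \<and> (\<forall>x. ((\<lambda>i. T i x) has_sum blinfun_apply U x) UNIV)"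
  proof (rule orthogonal_strong_sum[of UNIV T "\<lambda>i. e {i}" 1])
    show "T i (x + y) = T i x + T i y" for i x y
      using add[OF ketu ketu, of i x i y] by (simp add: T_def blinfun.add_right ketbra_add_left blinfun.add_left)
    show "T i (c *\<^sub>C x) = c *\<^sub>C T i x" for i c x
      using scale[OF ketu, of c i x] by (simp add: T_def bounded_opsD ketbra_scaleC_left)
    show "cinner (e {i} x) (e {j} y) = 0" if "i \<noteq> j" for i j x y using that by (intro e_orth) auto
  qed (auto simp: e_proj T_orth intro: T_norm[simplified])
  then obtain U where Ub: "U \<in> bounded_ops" and U: "\<And>x. ((\<lambda>i. T i x) has_sum U x) UNIV" by blast
  have G: "cinner (U x) (\<Phi> (ketbra w (u j)) (v j)) = cinner x w" if j: "good j" and w: "ketbra w (u j) \<in> A" for j w x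
  proof (rule has_sum_unique)
    show "((\<lambda>i. cinner (T i x) (\<Phi> (ketbra w (u j)) (v j))) has_sum cinner (U x) (\<Phi> (ketbra w (u j)) (v j))) UNIV"
      by (rule has_sum_bounded_linear[OF bounded_linear_cinner_left U])
    show "((\<lambda>i. cinner (T i x) (\<Phi> (ketbra w (u j)) (v j))) has_sum cinner x w) UNIV"
      unfolding IP'[OF that] by (rule has_sum_bounded_linear[OF bounded_linear_cinner_left e_has_sum])
  qed
  have iso: "cinner (U x) (U y) = cinner x y" for x y
  proof (rule has_sum_unique)
    show "((\<lambda>j. cinner (U x) (T j y)) has_sum cinner (U x) (U y)) UNIV"
      by (rule has_sum_bounded_linear[OF bounded_linear_cinner_right U])
    have "cinner (U x) (T j y) = cinner x (e {j} y)" for j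
    proof (cases "good j")
      case True
      then show ?thesis unfolding T_def by (rule G[OF _ ketu])
    next
      case False
      then show ?thesis by (simp add: T_bad) (simp add: good_def)
    qed
    then show "((\<lambda>j. cinner (U x) (T j y)) has_sum cinner x y) UNIV"
      using has_sum_bounded_linear[OF bounded_linear_cinner_right e_has_sum] by simp
  qed
  \<comment> \<open>\<open>w\<close> may spread over infinitely many blocks, while \<open>U\<close>
    was built blockwise. Instead of appealing to continuity of \<open>\<Phi>\<close>, compare inner
    products: all four in the expansion of the squared distance equal
    \<open>cinner w w\<close>.\<close>
  have U_eq: "\<Phi> (ketbra w (u j)) (v j) = U w" if j: "good j" and w: "ketbra w (u j) \<in> A" for j w
  proof -
    let ?z = "\<Phi> (ketbra w (u j)) (v j)"
    have 1: "cinner (U w) ?z = cinner w w" by (rule G[OF that])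
    have 2: "cinner ?z (U w) = cinner w w" using 1 by (metis cinner_commute)
    have 3: "cinner ?z ?z = cinner w w" by (rule IP[OF j j w w])
    have "cinner (?z - U w) (?z - U w) = 0"
      by (simp add: cinner_diff_left cinner_diff_right 1 2 3 iso)
    then show ?thesis by (simp add: cinner_eq_zero_iff)
  qed
  have intertwine: "\<Phi> t o\<^sub>L U = U o\<^sub>L t" if t: "t \<in> A" for t
  proof (rule e_ext_right, rule blinfun_eqI)
    fix i x
    show "((\<Phi> t o\<^sub>L U) o\<^sub>L e {i}) x = ((U o\<^sub>L t) o\<^sub>L e {i}) x"
    proof (cases "good i")
      case True
      let ?x = "e {i} x"
      have tk: "ketbra (t ?x) (u i) = t o\<^sub>L ketbra ?x (u i)"
        by (rule compose_ketbra[OF A_bounded[OF t], symmetric])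
      have "\<Phi> t (U ?x) = (\<Phi> t o\<^sub>L \<Phi> (ketbra ?x (u i))) (v i)" using U_eq[OF True ketu] by simp
      also have "\<dots> = \<Phi> (ketbra (t ?x) (u i)) (v i)" unfolding tk by (simp only: mult[OF t ketu])
      also have "\<dots> = U (t ?x)" by (rule U_eq[OF True]) (unfold tk, rule A_compose[OF t ketu])
      finally show ?thesis by simp
    next
      case False
      then show ?thesis by (simp add: good_def)
    qed
  qed
  have UU: "adj U (U x) = x" for x
    by (rule cinner_ext) (simp only: cinner_adj_right[OF Ub] iso)
  \<comment> \<open>The preimage of \<open>ketbra z z\<close> is again minimal, hence
    \<open>ketbra x x\<close> for a unit vector \<open>x\<close>. Intertwining shows that
    \<open>ketbra z z\<close> fixes \<open>U x\<close>, so \<open>z\<close> is a multiple of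
    \<open>U x\<close>.\<close>
  have hit: "U (adj U z) = z" if ez: "e {i} z = z" and nz: "norm z = 1" for i z
  proof -
    have zA: "ketbra z z \<in> A" by (rule A_ketbra[OF conn_refl ez ez])
    obtain f where f: "f \<in> A" "ketbra z z = \<Phi> f" using surj[OF zA] by blast
    have "\<exists>x. norm x = 1 \<and> f = ketbra x x"
    proof (rule minimal_projection_rank_one)
      have zz: "ketbra z z o\<^sub>L ketbra z z = ketbra z z" "adj (ketbra z z) = ketbra z z"
        using ketbra_projection[OF nz] by (simp_all add: projection_op_def)
      have "f o\<^sub>L f = f" by (rule inj[OF _ A_compose[OF f(1) f(1)] f(1)]) (simp add: mult f zz flip: f(2))
      moreover have "adj f = f" by (rule inj[OF _ A_adj[OF f(1)] f(1)]) (simp add: star f zz flip: f(2))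
      ultimately show "projection_op f" using A_bounded[OF f(1)] by (simp add: projection_op_def)
      have "ketbra z z z \<noteq> 0" using nz by (auto simp: cinner_eq_norm scaleC_one)
      then show "f \<noteq> 0" using f(2) \<Phi>0 by (metis zero_blinfun.rep_eq)
      fix a assume a: "a \<in> A"
      let ?c = "cinner z (\<Phi> a z)"
      have "\<Phi> (f o\<^sub>L a o\<^sub>L f) = ketbra z z o\<^sub>L \<Phi> a o\<^sub>L ketbra z z"
        using mult[OF A_compose[OF f(1) a] f(1)] mult[OF f(1) a] f(2) by simp
      also have "\<dots> = \<Phi> (scaleC_op ?c f)"
        unfolding scale[OF f(1)] f(2)[symmetric] by (rule ketbra_compress[OF \<Phi>b[OF a]])
      finally have "f o\<^sub>L a o\<^sub>L f = scaleC_op ?c f"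
        by (rule inj[OF _ A_compose[OF A_compose[OF f(1) a] f(1)] A_scaleC[OF f(1)]])
      then show "\<exists>c. f o\<^sub>L a o\<^sub>L f = scaleC_op c f" by blast
    qed
    then obtain x where x: "norm x = 1" "f = ketbra x x" by blast
    have fx: "f x = x" using x by (simp add: cinner_eq_norm scaleC_one)
    have "(ketbra z z o\<^sub>L U) x = (U o\<^sub>L f) x" unfolding f(2) by (simp only: intertwine[OF f(1)])
    then have eq: "cinner z (U x) *\<^sub>C z = U x" by (simp add: fx)
    have "U x \<noteq> 0" using iso[of x x] x(1) by (auto simp: cinner_eq_norm)
    then have c0: "cinner z (U x) \<noteq> 0" using eq by auto
    then have "z = U ((1 / cinner z (U x)) *\<^sub>C x)"
      using arg_cong[OF eq, of "\<lambda>y. (1 / cinner z (U x)) *\<^sub>C y"]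
      by (simp add: bounded_opsD[OF Ub] scaleC_scaleC scaleC_one)
    then show ?thesis using UU by metis
  qed
  have "U o\<^sub>L adj U = id_blinfun"
  proof (rule e_ext_right, rule blinfun_eqI)
    fix i x
    let ?y = "e {i} x"
    show "((U o\<^sub>L adj U) o\<^sub>L e {i}) x = (id_blinfun o\<^sub>L e {i}) x"
    proof (cases "?y = 0")
      case False
      define z where "z = complex_of_real (1 / norm ?y) *\<^sub>C ?y"
      have "U (adj U z) = z"
        by (rule hit[of i]) (use False in \<open>simp_all add: z_def bounded_opsD norm_scaleC norm_divide\<close>)
      moreover have "?y = complex_of_real (norm ?y) *\<^sub>C z" using False by (simp add: z_def scaleC_scaleC scaleC_one)
      ultimately have "U (adj U ?y) = ?y"
        using bounded_opsD[OF Ub] bounded_opsD[OF adj_bounded_ops[OF Ub]] by metis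
      then show ?thesis by simp
    qed simp
  qed
  moreover have "adj U o\<^sub>L U = id_blinfun" by (rule blinfun_eqI) (simp add: UU)
  ultimately have "unitary_op U" using Ub by (simp add: unitary_op_def)
  moreover have "\<Phi> t = Ad U t" if "t \<in> A" for t
  proof -
    have "Ad U t = \<Phi> t o\<^sub>L (U o\<^sub>L adj U)"
      by (simp only: Ad_def intertwine[OF that, symmetric] blinfun_compose_assoc)
    then show ?thesis by (simp add: \<open>U o\<^sub>L adj U = id_blinfun\<close> blinfun_eqI)
  qed
  ultimately show ?thesis by blast
qed

end

context block_module
begin

lemma cp_automorphism_spatial:
  assumes "star_automorphism cp \<Phi>" shows "\<exists>U. unitary_op U \<and> (\<forall>t\<in>cp. \<Phi> t = Ad U t)"
proof -
  interpret block_algebra e near cp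
    by unfold_locales (use cp_compose cp_adj cp_scaleC ketbra_in_roe roe_subset_cp in blast)+
  show ?thesis by (rule automorphism_spatial[OF assms])
qed

lemma roe_automorphism_spatial:
  assumes "star_automorphism roe \<Phi>" shows "\<exists>U. unitary_op U \<and> (\<forall>t\<in>roe. \<Phi> t = Ad U t)"
proof -
  interpret block_algebra e near roe
    by unfold_locales (use roe_compose roe_adj roe_scaleC ketbra_in_roe roe_subset_cp in blast)+
  show ?thesis by (rule automorphism_spatial[OF assms])
qed

end

section \<open>Partitions of a proper extended metric space\<close>

context extended_metric_space
begin

text \<open>Zorn's lemma gives maximality, and maximality gives the covering property: a point
  farther than 1 from all of \<open>Z\<close> could be added.\<close>

lemma ex_maximal_separated:
  obtains Z where "Z \<subseteq> X" "\<And>z z'. z \<in> Z \<Longrightarrow> z' \<in> Z \<Longrightarrow> z \<noteq> z' \<Longrightarrow> d z z' > 1"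
    "\<And>x. x \<in> X \<Longrightarrow> \<exists>z\<in>Z. d x z \<le> 1"
proof -
  define \<S> where "\<S> = {Z. Z \<subseteq> X \<and> (\<forall>z\<in>Z. \<forall>z'\<in>Z. z \<noteq> z' \<longrightarrow> d z z' > 1)}"
  have "\<exists>M\<in>\<S>. \<forall>Z\<in>\<S>. M \<subseteq> Z \<longrightarrow> Z = M"
  proof (rule subset_Zorn')
    fix C assume C: "subset.chain \<S> C"
    show "\<Union>C \<in> \<S>"
      unfolding \<S>_def
    proof (intro CollectI conjI ballI impI)
      show "\<Union>C \<subseteq> X" using C by (auto simp: subset_chain_def \<S>_def)
      fix z z' assume "z \<in> \<Union>C" "z' \<in> \<Union>C" and ne: "z \<noteq> z'"
      then obtain A B where AB: "A \<in> C" "z \<in> A" "B \<in> C" "z' \<in> B" by blast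
      then have "A \<subseteq> B \<or> B \<subseteq> A" using C by (auto simp: subset_chain_def)
      then obtain D where "D \<in> C" "z \<in> D" "z' \<in> D" using AB by blast
      moreover from this(1) have "D \<in> \<S>" using C by (auto simp: subset_chain_def)
      ultimately show "d z z' > 1" using ne by (auto simp: \<S>_def)
    qed
  qed
  then obtain Z where Z: "Z \<in> \<S>" "\<And>Y. Y \<in> \<S> \<Longrightarrow> Z \<subseteq> Y \<Longrightarrow> Y = Z" by blast
  show ?thesis
  proof (rule that[of Z])
    show "Z \<subseteq> X" "\<And>z z'. z \<in> Z \<Longrightarrow> z' \<in> Z \<Longrightarrow> z \<noteq> z' \<Longrightarrow> d z z' > 1"
      using Z(1) by (auto simp: \<S>_def)
    fix x assume x: "x \<in> X"
    show "\<exists>z\<in>Z. d x z \<le> 1"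
    proof (rule ccontr)
      assume "\<not> ?thesis"
      then have far: "\<forall>z\<in>Z. d x z > 1" by auto
      then have "\<forall>z\<in>Z. d z x > 1" using d_commute[OF x] \<open>Z \<subseteq> X\<close> by (metis subsetD)
      then have "insert x Z \<in> \<S>" using Z(1) x far by (auto simp: \<S>_def)
      then have "insert x Z = Z" by (rule Z(2)) blast
      then have "x \<in> Z" by blast
      then have "d x x > 1" using far by blast
      then show False using d_eq_0[OF x x] by simp
    qed
  qed
qed

lemma openin_ball: "x \<in> X \<Longrightarrow> openin (emtopology X d) {y \<in> X. d x y < ennreal \<epsilon>}"
  unfolding openin_emtopology
proof (intro conjI ballI)
  assume x: "x \<in> X"
  fix y assume "y \<in> {y \<in> X. d x y < ennreal \<epsilon>}"
  then have y: "y \<in> X" "d x y < ennreal \<epsilon>" by auto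
  then obtain a where a: "a \<ge> 0" "d x y = ennreal a" by (cases "d x y") auto
  then have "a < \<epsilon>" using y(2) by (simp add: ennreal_less_iff)
  have "d x w < ennreal \<epsilon>" if w: "w \<in> X" "d y w < ennreal (\<epsilon> - a)" for w
  proof -
    obtain b where b: "b \<ge> 0" "d y w = ennreal b" using w(2) by (cases "d y w") auto
    then have "b < \<epsilon> - a" using w(2) by (simp add: ennreal_less_iff)
    have "d x w \<le> d x y + d y w" by (rule d_triangle[OF x y(1) w(1)])
    also have "\<dots> = ennreal (a + b)" using a b by simp
    also have "\<dots> < ennreal \<epsilon>" using \<open>b < \<epsilon> - a\<close> a b by (intro ennreal_lessI) auto
    finally show ?thesis .
  qed
  then show "\<exists>\<delta>>0. {w \<in> X. d y w < ennreal \<delta>} \<subseteq> {y \<in> X. d x y < ennreal \<epsilon>}"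
    using \<open>a < \<epsilon>\<close> by (intro exI[of _ "\<epsilon> - a"]) auto
qed auto

end

text \<open>Cover the compact ball by finitely many balls of radius 1/2; by the triangle inequality
  each of them contains at most one point of \<open>Z\<close>.\<close>

lemma (in proper_extended_metric_space) finite_separated_ball:
  assumes Z: "Z \<subseteq> X" "\<And>z z'. z \<in> Z \<Longrightarrow> z' \<in> Z \<Longrightarrow> z \<noteq> z' \<Longrightarrow> d z z' > 1"
    and x: "x \<in> X" and r: "(r::real) \<ge> 0"
  shows "finite {z \<in> Z. d x z \<le> ennreal r}"
proof -
  define h :: real where "h = 1/2"
  have h: "h > 0" "h + h = 1" by (simp_all add: h_def)
  let ?K = "{y \<in> X. d x y \<le> ennreal r}"
  let ?b = "\<lambda>x. {y \<in> X. d x y < ennreal h}"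
  have "compactin (emtopology X d) ?K" by (rule compact_cballs[OF x r])
  moreover have "\<And>U. U \<in> ?b ` X \<Longrightarrow> openin (emtopology X d) U" using openin_ball by auto
  moreover have "?K \<subseteq> \<Union>(?b ` X)"
  proof
    fix y assume "y \<in> ?K"
    then have "y \<in> X" by simp
    then have "y \<in> ?b y" using d_eq_0[of y y] h(1) by simp
    then show "y \<in> \<Union>(?b ` X)" using \<open>y \<in> X\<close> by blast
  qed
  ultimately obtain \<F> where \<F>: "finite \<F>" "\<F> \<subseteq> ?b ` X" "?K \<subseteq> \<Union>\<F>"
    unfolding compactin_def by meson
  have "finite (Z \<inter> U)" if "U \<in> \<F>" for U
  proof -
    obtain y where y: "y \<in> X" "U = ?b y" using \<F>(2) \<open>U \<in> \<F>\<close> by blast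
    have "z = z'" if "z \<in> Z \<inter> U" "z' \<in> Z \<inter> U" for z z'
    proof (rule ccontr)
      assume "z \<noteq> z'"
      have zX: "z \<in> X" "z' \<in> X" using that Z(1) by auto
      have "d z z' \<le> d z y + d y z'" by (rule d_triangle[OF zX(1) y(1) zX(2)])
      also have "\<dots> \<le> ennreal h + ennreal h"
        using that y d_commute[OF zX(1) y(1)] by (intro add_mono) auto
      also have "\<dots> = ennreal (h + h)" by (rule ennreal_plus[symmetric]) (use h in auto)
      also have "\<dots> = 1" by (simp add: h(2))
      finally show False using Z(2)[of z z'] that \<open>z \<noteq> z'\<close> by auto
    qed
    then have "Z \<inter> U = {} \<or> (\<exists>z. Z \<inter> U = {z})" by blast
    then show ?thesis by auto
  qed
  then have "finite (\<Union>U\<in>\<F>. Z \<inter> U)" using \<F>(1) by blast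
  moreover have "{z \<in> Z. d x z \<le> ennreal r} \<subseteq> (\<Union>U\<in>\<F>. Z \<inter> U)" using \<F>(3) Z(1) by blast
  ultimately show ?thesis by (rule finite_subset[rotated])
qed

text \<open>The pieces of the given partition are merged around the points of a maximal separated set \<open>Z\<close>; the
  resulting partition is locally finite because balls are compact.\<close>

lemma Cstar_algebras_block_module:
  fixes X :: "'x set" and d :: "'x \<Rightarrow> 'x \<Rightarrow> ennreal" and \<AA> :: "'x set set"
    and E :: "'x set \<Rightarrow> ('h::chilbert_space \<Rightarrow>\<^sub>L 'h)"
  assumes "proper_extended_metric_space X d" and "discrete_coarse_module X d \<AA> E"
  shows "\<exists>(e :: 'x set \<Rightarrow> _) near. block_module e near \<and> Cstar_cp d \<AA> E = block_module.cp e near \<and>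
    Cstar_Roe d \<AA> E = block_module.roe e near"
proof -
  interpret proper_extended_metric_space X d by fact
  interpret discrete_coarse_module X d \<AA> E by fact
  obtain r P where r: "r \<ge> (0::real)" and part: "partition_on X P \<and> P \<subseteq> \<AA> \<and>
      (\<forall>A\<in>P. ediam d A \<le> ennreal r) \<and> (\<forall>v. ((\<lambda>A. blinfun_apply (E A) v) has_sum v) P) \<and>
      (\<forall>C\<subseteq>X. (\<forall>A\<in>P. C \<inter> A \<in> \<AA>) \<longrightarrow> C \<in> \<AA>)"
    using discrete by (elim exE conjE) (rule that, assumption, intro conjI)
  have P: "partition_on X P" "P \<subseteq> \<AA>" "\<And>A. A \<in> P \<Longrightarrow> ediam d A \<le> ennreal r"
    and P_sum: "\<And>v. ((\<lambda>A. E A v) has_sum v) P"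
    and P_meas: "\<And>C. C \<subseteq> X \<Longrightarrow> (\<And>A. A \<in> P \<Longrightarrow> C \<inter> A \<in> \<AA>) \<Longrightarrow> C \<in> \<AA>"
    using part by auto
  have PX: "\<Union>P = X" and P_disj: "\<And>A A'. A \<in> P \<Longrightarrow> A' \<in> P \<Longrightarrow> A \<inter> A' \<noteq> {} \<Longrightarrow> A = A'"
    and P_ne: "\<And>A. A \<in> P \<Longrightarrow> A \<noteq> {}"
    using P(1) by (auto simp: partition_on_def disjoint_def)
  have P_same: "A = A'" if "A \<in> P" "A' \<in> P" "x \<in> A" "x \<in> A'" for A A' x
    using P_disj that by blast
  obtain Z where Z: "Z \<subseteq> X" "\<And>z z'. z \<in> Z \<Longrightarrow> z' \<in> Z \<Longrightarrow> z \<noteq> z' \<Longrightarrow> d z z' > 1"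
    "\<And>x. x \<in> X \<Longrightarrow> \<exists>z\<in>Z. d x z \<le> 1"
    using ex_maximal_separated by blast
  \<comment> \<open>Each piece is assigned a centre within 1 of one of its points, so all of the
    piece lies within \<open>r + 1\<close> of that centre.\<close>
  have "\<forall>A\<in>P. \<exists>z. z \<in> Z \<and> (\<exists>a\<in>A. d a z \<le> 1)" using P_ne Z(3) PX by blast
  then obtain \<zeta> where \<zeta>: "\<forall>A\<in>P. \<zeta> A \<in> Z \<and> (\<exists>a\<in>A. d a (\<zeta> A) \<le> 1)" by (rule bchoice[THEN exE])
  define \<rho> where "\<rho> = r + 1"
  have \<rho>: "\<rho> \<ge> 0" using r by (simp add: \<rho>_def)
  define B where "B S = \<Union>{A \<in> P. \<zeta> A \<in> S}" for S
  have B_in: "x \<in> B S \<longleftrightarrow> (\<exists>A\<in>P. x \<in> A \<and> \<zeta> A \<in> S)" for x S by (auto simp: B_def)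
  have B_X: "B S \<subseteq> X" for S using PX by (auto simp: B_def)
  \<comment> \<open>Every piece is either contained in \<open>B S\<close> or disjoint from it, so
    discreteness makes unions of arbitrarily many pieces measurable.\<close>
  have B_meas: "B S \<in> \<AA>" for S
  proof (rule P_meas[OF B_X])
    fix A assume A: "A \<in> P"
    have "B S \<inter> A = (if \<zeta> A \<in> S then A else {})"
    proof (cases "\<zeta> A \<in> S")
      case False
      have "x \<notin> A" if "x \<in> B S" for x
        using that P_same[OF A] False unfolding B_in by blast
      then show ?thesis using False by auto
    qed (use A in \<open>auto simp: B_in\<close>)
    then show "B S \<inter> A \<in> \<AA>" using A P(2) empty_sets by auto
  qed
  have B_Int: "B S \<inter> B T = B (S \<inter> T)" for S T
  proof
    show "B S \<inter> B T \<subseteq> B (S \<inter> T)"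
    proof
      fix x assume "x \<in> B S \<inter> B T"
      then obtain A A' where A: "A \<in> P" "x \<in> A" "\<zeta> A \<in> S" "A' \<in> P" "x \<in> A'" "\<zeta> A' \<in> T" by (auto simp: B_in)
      then have "A = A'" using P_disj[of A A'] by blast
      then show "x \<in> B (S \<inter> T)" using A by (auto simp: B_in)
    qed
  qed (auto simp: B_in)
  have B_Un: "B (S \<union> T) = B S \<union> B T" for S T by (auto simp: B_in)
  have B_empty: "B {} = {}" by (auto simp: B_in)
  have B_UNIV: "B UNIV = X" using PX by (auto simp: B_in)
  have B_off: "B {z} = {}" if "z \<notin> Z" for z using that \<zeta> by (auto simp: B_in)
  have B_near: "d x z \<le> ennreal \<rho>" if xz: "x \<in> B {z}" for x z
  proof -
    obtain A where A: "A \<in> P" "x \<in> A" "\<zeta> A = z" using xz by (auto simp: B_in)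
    obtain a where a: "a \<in> A" "d a z \<le> 1" using \<zeta> A by blast
    have X: "x \<in> X" "a \<in> X" "z \<in> X" using A a \<zeta> Z(1) PX by auto
    have "d x a \<le> ediam d A" unfolding ediam_def using A(2) a(1) by (intro SUP_upper2[of "(x, a)"]) auto
    also have "\<dots> \<le> ennreal r" by (rule P(3)[OF A(1)])
    finally have "d x z \<le> ennreal r + 1" using d_triangle[OF X] a(2) by (meson add_mono order_trans)
    also have "\<dots> = ennreal \<rho>" using r by (simp add: \<rho>_def ennreal_plus)
    finally show ?thesis .
  qed
  have B_cover: "\<exists>z\<in>Z. x \<in> B {z}" if "x \<in> X" for x
    using that PX \<zeta> by (auto simp: B_in)
  define e where "e S = E (B S)" for S
  \<comment> \<open>The equality disjunct turns elements outside \<open>Z\<close> into isolated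
    indices with empty block, so that the whole type can serve as index set.\<close>
  define near where "near n z z' \<longleftrightarrow> z = z' \<or> z \<in> Z \<and> z' \<in> Z \<and> d z z' \<le> ennreal (real n)" for n z z'
  have E_empty: "E {} = 0" using E_disjoint_Un[of "{}" "{}"] by simp
  have E_E: "E A (E A' x) = E (A \<inter> A') x" if "A \<in> \<AA>" "A' \<in> \<AA>" for A A' x
    using E_Int[OF that] by simp
  interpret M: block_module e near
  proof
    show "projection_op (e S)" for S unfolding e_def by (rule E_projection[OF B_meas])
    show "e S o\<^sub>L e T = e (S \<inter> T)" for S T
      unfolding e_def by (simp flip: E_Int[OF B_meas B_meas] B_Int)
    show "e (S \<union> T) = e S + e T" if "S \<inter> T = {}" for S T
      unfolding e_def B_Un by (rule E_disjoint_Un[OF B_meas B_meas]) (simp add: B_Int that B_empty)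
    show "e UNIV = id_blinfun" by (simp add: e_def B_UNIV E_space)
    show "near n i i" for n i by (simp add: near_def)
    show "near n j i" if "near n i j" for n i j
    proof (cases "i = j")
      case False
      then have "i \<in> Z" "j \<in> Z" "d i j \<le> ennreal (real n)" using that by (auto simp: near_def)
      moreover from this have "d i j = d j i" using Z(1) by (intro d_commute) auto
      ultimately show ?thesis by (simp add: near_def)
    qed (simp add: near_def)
    show "near (m + n) i k" if ij: "near m i j" and jk: "near n j k" for m n i j k
    proof (cases "i = j \<or> j = k")
      case True
      have mono: "ennreal (real m) \<le> ennreal (real (m + n))" "ennreal (real n) \<le> ennreal (real (m + n))"
        by (auto intro: ennreal_leI)
      show ?thesis using True ij jk order_trans[OF _ mono(1)] order_trans[OF _ mono(2)] by (auto simp: near_def)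
    next
      case False
      then have 1: "i \<in> Z" "j \<in> Z" "k \<in> Z" "d i j \<le> ennreal (real m)" "d j k \<le> ennreal (real n)"
        using ij jk by (auto simp: near_def)
      then have "d i k \<le> d i j + d j k" using Z(1) by (intro d_triangle) auto
      also have "\<dots> \<le> ennreal (real m) + ennreal (real n)" by (intro add_mono 1)
      also have "\<dots> = ennreal (real (m + n))" by (simp add: ennreal_plus)
      finally show ?thesis using 1 by (simp add: near_def)
    qed
    show "finite {j. near n i j}" for n i
    proof (cases "i \<in> Z")
      case True
      have "{j. near n i j} \<subseteq> insert i {z \<in> Z. d i z \<le> ennreal (real n)}" by (auto simp: near_def)
      moreover have "finite {z \<in> Z. d i z \<le> ennreal (real n)}"
        by (rule finite_separated_ball[OF Z(1,2)]) (use True Z(1) in auto)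
      ultimately show ?thesis by (meson finite_insert finite_subset)
    next
      case False
      then have "{j. near n i j} = {i}" by (auto simp: near_def)
      then show ?thesis by simp
    qed
    show "\<exists>F. finite F \<and> norm (v - e F v) \<le> \<epsilon>" if "\<epsilon> > 0" for \<epsilon> v
    proof -
      \<comment> \<open>The pieces of a good partial sum belong to finitely many centres, and the
        projection over those centres fixes that partial sum.\<close>
      obtain F0 where F0: "finite F0" "F0 \<subseteq> P" "dist (\<Sum>A\<in>F0. E A v) v \<le> \<epsilon>"
        using has_sum_finite_approximation[OF P_sum \<open>\<epsilon> > 0\<close>] by blast
      let ?F = "\<zeta> ` F0" and ?w = "\<Sum>A\<in>F0. E A v"
      have "e ?F (E A v) = E A v" if A: "A \<in> F0" for A
      proof -
        have "A \<subseteq> B ?F" unfolding B_def using A F0(2) by blast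
        then have "B ?F \<inter> A = A" by blast
        then show ?thesis unfolding e_def using E_E[OF B_meas, of A ?F v] A F0(2) P(2) by auto
      qed
      then have "e ?F ?w = ?w" by (simp add: blinfun.sum_right)
      then have "v - e ?F v = (id_blinfun - e ?F) (v - ?w)" by (simp add: blinfun.diff_left blinfun.diff_right)
      then have "norm (v - e ?F v) \<le> norm (v - ?w)"
        using projection_norm_le[OF projection_compl[OF E_projection[OF B_meas[of ?F]]]] by (simp add: e_def)
      also have "\<dots> \<le> \<epsilon>" using F0(3) by (simp add: dist_norm norm_minus_commute)
      finally show ?thesis using F0(1) by blast
    qed
  qed
  have absorb: "E A (e S x) = E A x" "e S (E A x) = E A x" if "A \<in> \<AA>" "A \<subseteq> B S" for A S x
  proof -
    have "A \<inter> B S = A" "B S \<inter> A = A" using that(2) by auto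
    then show "E A (e S x) = E A x" "e S (E A x) = E A x"
      unfolding e_def using E_E[OF that(1) B_meas, of S x] E_E[OF B_meas that(1), of S x] by auto
  qed
  have 3: "ennreal a + ennreal b + ennreal c = ennreal (a + b + c)" if "a \<ge> 0" "b \<ge> 0" "c \<ge> 0" for a b c
    using that by simp
  \<comment> \<open>Replacing points by the centres of their blocks changes distances by at most
    \<open>2 * \<rho>\<close>. This translates metric bounds into \<open>near\<close> bounds, and
    \<open>near_to\<close> translates back.\<close>
  have near_of: "d z' z \<le> ennreal (\<rho> + R + \<rho>)"
    if "a \<in> B {z}" "a' \<in> B {z'}" "d a' a \<le> ennreal R" "R \<ge> 0" for a a' z z' R
  proof -
    have X: "z \<in> X" "z' \<in> X" "a \<in> X" "a' \<in> X" using that B_X B_off Z(1) by (blast | metis empty_iff subsetD)+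
    have "d z' z \<le> d z' a' + d a' z" by (rule d_triangle[OF X(2,4,1)])
    also have "\<dots> \<le> d z' a' + (d a' a + d a z)" by (intro add_mono d_triangle[OF X(4,3,1)]) simp
    also have "\<dots> \<le> ennreal \<rho> + (ennreal R + ennreal \<rho>)"
      using B_near[OF that(2)] B_near[OF that(1)] d_commute[OF X(2,4)] that(3) by (intro add_mono) auto
    also have "\<dots> = ennreal (\<rho> + R + \<rho>)" unfolding add.assoc[symmetric] by (rule 3[OF \<rho> that(4) \<rho>])
    finally show ?thesis .
  qed
  have near_to: "d a' a \<le> ennreal (\<rho> + real n + \<rho>)"
    if "a \<in> B {z}" "a' \<in> B {z'}" "near n z' z" for a a' z z' n
  proof -
    have X: "z \<in> X" "z' \<in> X" "a \<in> X" "a' \<in> X" using that B_X B_off Z(1) by (blast | metis empty_iff subsetD)+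
    have zz: "d z' z \<le> ennreal (real n)" using that(3) d_eq_0[OF X(1,1)] by (auto simp: near_def)
    have "d a' a \<le> d a' z' + d z' a" by (rule d_triangle[OF X(4,2,3)])
    also have "\<dots> \<le> d a' z' + (d z' z + d z a)" by (intro add_mono d_triangle[OF X(2,1,3)]) simp
    also have "\<dots> \<le> ennreal \<rho> + (ennreal (real n) + ennreal \<rho>)"
      using B_near[OF that(2)] B_near[OF that(1)] d_commute[OF X(1,3)] zz by (intro add_mono) auto
    also have "\<dots> = ennreal (\<rho> + real n + \<rho>)" unfolding add.assoc[symmetric] by (rule 3[OF \<rho> of_nat_0_le_iff \<rho>])
    finally show ?thesis .
  qed
  have fp: "finite_propagation d \<AA> E t \<longleftrightarrow> (\<exists>n. M.propag n t)" if t: "t \<in> bounded_ops" for t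
  proof
    assume "finite_propagation d \<AA> E t"
    then obtain R where R: "R \<ge> 0" "propagation_le d \<AA> E R t" by (auto simp: finite_propagation_def)
    obtain n :: nat where n: "\<rho> + R + \<rho> \<le> real n" using real_arch_simple by blast
    have "M.propag n t"
      unfolding M.propag_def
    proof (intro conjI allI impI t)
      fix z z' x assume far: "\<not> near n z' z"
      have "\<forall>a\<in>B {z}. \<forall>a'\<in>B {z'}. d a' a > ennreal R"
      proof (intro ballI, rule ccontr)
        fix a a' assume a: "a \<in> B {z}" "a' \<in> B {z'}" and "\<not> d a' a > ennreal R"
        then have "d z' z \<le> ennreal (\<rho> + R + \<rho>)" using near_of[OF a _ R(1)] by simp
        also have "\<dots> \<le> ennreal (real n)" by (rule ennreal_leI[OF n])
        finally show False using far a B_off by (auto simp: near_def)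
      qed
      then have "E (B {z'}) o\<^sub>L t o\<^sub>L E (B {z}) = 0"
        using R(2) B_meas unfolding propagation_le_def by blast
      then have "(E (B {z'}) o\<^sub>L t o\<^sub>L E (B {z})) x = 0" by simp
      then show "e {z'} (t (e {z} x)) = 0" by (simp add: e_def)
    qed
    then show "\<exists>n. M.propag n t" ..
  next
    assume "\<exists>n. M.propag n t"
    then obtain n where n: "M.propag n t" ..
    have "propagation_le d \<AA> E (\<rho> + real n + \<rho>) t"
      unfolding propagation_le_def
    proof (intro ballI impI)
      fix A A' assume A: "A \<in> \<AA>" "A' \<in> \<AA>" and far: "\<forall>a\<in>A. \<forall>a'\<in>A'. d a' a > ennreal (\<rho> + real n + \<rho>)"
      \<comment> \<open>\<open>A\<close> and \<open>A'\<close> are enlarged to the unions of the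
        blocks they meet; points of \<open>A\<close> and \<open>A'\<close> inside these blocks
        witness that the blocks are not near at scale \<open>n\<close>.\<close>
      define S where "S = {z. B {z} \<inter> A \<noteq> {}}"
      define T where "T = {z. B {z} \<inter> A' \<noteq> {}}"
      have "A \<subseteq> X" "A' \<subseteq> X" using A sets_into_space by auto
      have meets: "A \<subseteq> B {z. B {z} \<inter> A \<noteq> {}}" if "A \<subseteq> X" for A
      proof
        fix a assume a: "a \<in> A"
        then obtain z where z: "a \<in> B {z}" using B_cover \<open>A \<subseteq> X\<close> by blast
        then obtain C where "C \<in> P" "a \<in> C" "\<zeta> C = z" by (auto simp: B_in)
        moreover have "B {z} \<inter> A \<noteq> {}" using a z by blast
        ultimately show "a \<in> B {z. B {z} \<inter> A \<noteq> {}}" unfolding B_in by blast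
      qed
      have sub: "A \<subseteq> B S" "A' \<subseteq> B T"
        unfolding S_def T_def using meets[OF \<open>A \<subseteq> X\<close>] meets[OF \<open>A' \<subseteq> X\<close>] by simp_all
      have "e T (t (e S x)) = 0" for x
      proof (rule M.propag_far[OF n])
        fix z z' assume "z \<in> S" "z' \<in> T"
        then obtain a a' where a: "a \<in> B {z}" "a \<in> A" "a' \<in> B {z'}" "a' \<in> A'" by (auto simp: S_def T_def)
        then have "\<not> d a' a \<le> ennreal (\<rho> + real n + \<rho>)" using far by (simp add: not_le)
        then show "\<not> near n z' z" using near_to[OF a(1,3)] by blast
      qed
      then have "E A' (e T (t (e S (E A x)))) = 0" for x by simp
      then show "E A' o\<^sub>L t o\<^sub>L E A = 0"
        by (intro blinfun_eqI) (simp add: absorb[OF A(1) sub(1)] absorb[OF A(2) sub(2)])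
    qed
    moreover have "\<rho> + real n + \<rho> \<ge> 0" using \<rho> by simp
    ultimately show "finite_propagation d \<AA> E t" unfolding finite_propagation_def by blast
  qed
  have E_b: "E A \<in> bounded_ops" if "A \<in> \<AA>" for A by (rule projection_bounded[OF E_projection[OF that]])
  have lc: "locally_compact_op d \<AA> E t \<longleftrightarrow> M.lc t" for t
  proof
    assume t: "locally_compact_op d \<AA> E t"
    have "ebounded d (B {z})" for z
    proof -
      have "d (fst p) (snd p) \<le> ennreal (\<rho> + real 0 + \<rho>)" if "p \<in> B {z} \<times> B {z}" for p
        using that by (intro near_to[of _ z _ z]) (auto simp: near_def)
      then have "ediam d (B {z}) \<le> ennreal (\<rho> + real 0 + \<rho>)" unfolding ediam_def by (rule SUP_least)
      then show ?thesis unfolding ebounded_def by (rule order_le_less_trans) simp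
    qed
    then show "M.lc t" using t B_meas by (auto simp: M.lc_def locally_compact_op_def e_def)
  next
    assume t: "M.lc t"
    show "locally_compact_op d \<AA> E t"
      unfolding locally_compact_op_def
    proof (intro ballI impI)
      fix A assume A: "A \<in> \<AA>" "ebounded d A"
      \<comment> \<open>A bounded set is covered by the blocks whose centres are near that of one of
        its points, and these are finite in number.\<close>
      have "\<exists>F. finite F \<and> A \<subseteq> B F"
      proof (cases "A = {}")
        case False
        then obtain a0 where a0: "a0 \<in> A" by blast
        have AX: "A \<subseteq> X" using A(1) sets_into_space by blast
        then obtain z0 where z0: "z0 \<in> Z" "a0 \<in> B {z0}" using B_cover a0 by blast
        obtain R where R: "R \<ge> 0" "ediam d A = ennreal R"
          using A(2) by (cases "ediam d A") (auto simp: ebounded_def)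
        obtain n :: nat where n: "\<rho> + R + \<rho> \<le> real n" using real_arch_simple by blast
        have "a \<in> B {z. near n z0 z}" if a: "a \<in> A" for a
        proof -
          obtain z where z: "z \<in> Z" "a \<in> B {z}" using B_cover a AX by blast
          have "d a0 a \<le> ediam d A" unfolding ediam_def using a a0 by (intro SUP_upper2[of "(a0, a)"]) auto
          then have "d z0 z \<le> ennreal (\<rho> + R + \<rho>)" using near_of[OF z(2) z0(2) _ R(1)] R(2) by simp
          also have "\<dots> \<le> ennreal (real n)" by (rule ennreal_leI[OF n])
          finally have "near n z0 z" using z(1) z0(1) by (simp add: near_def)
          then show ?thesis using z(2) by (auto simp: B_in)
        qed
        then show ?thesis using M.near_finite[of n z0] by blast
      qed (auto intro!: exI[of _ "{}"])
      then obtain F where F: "finite F" "A \<subseteq> B F" by blast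
      have "t o\<^sub>L E A = (t o\<^sub>L e F) o\<^sub>L E A" "E A o\<^sub>L t = E A o\<^sub>L (e F o\<^sub>L t)"
        by (auto intro!: blinfun_eqI simp: absorb[OF A(1) F(2)])
      moreover have "compact_op (t o\<^sub>L e F)" "compact_op (e F o\<^sub>L t)"
        using M.compact_e_finite_right[OF _ F(1)] M.compact_e_finite_left[OF _ F(1)] t by (auto simp: M.lc_def)
      ultimately show "compact_op (t o\<^sub>L E A) \<and> compact_op (E A o\<^sub>L t)"
        using E_b[OF A(1)] by (metis compact_op_compose_left compact_op_compose_right)
    qed
  qed
  have "{t \<in> bounded_ops. finite_propagation d \<AA> E t} = {t. \<exists>n. M.propag n t}"
    using fp M.propag_bounded by blast
  moreover have "{t \<in> bounded_ops. finite_propagation d \<AA> E t \<and> locally_compact_op d \<AA> E t}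
      = {t. (\<exists>n. M.propag n t) \<and> M.lc t}"
    using fp lc M.propag_bounded by blast
  ultimately have "Cstar_cp d \<AA> E = M.cp" "Cstar_Roe d \<AA> E = M.roe"
    by (simp_all add: Cstar_cp_def Cstar_Roe_def M.cp_def M.roe_def)
  then show ?thesis using M.block_module_axioms by blast
qed

theorem corollaryJ:
  fixes X :: "'x set" and d :: "'x \<Rightarrow> 'x \<Rightarrow> ennreal" and \<AA> :: "'x set set"
    and E :: "'x set \<Rightarrow> ('h::chilbert_space \<Rightarrow>\<^sub>L 'h)"
  assumes "proper_extended_metric_space X d"
    and "discrete_coarse_module X d \<AA> E"
    and "ample_coarse_module X d \<AA> E"
  shows "(\<forall>\<Phi>. star_automorphism (Cstar_cp d \<AA> E) \<Phi> \<longrightarrow>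
             (\<exists>U. unitary_op U \<and> (\<forall>t \<in> Cstar_cp d \<AA> E. \<Phi> t = Ad U t))) \<and>
         (\<forall>\<Phi>. star_automorphism (Cstar_Roe d \<AA> E) \<Phi> \<longrightarrow>
             (\<exists>U. unitary_op U \<and> (\<forall>t \<in> Cstar_Roe d \<AA> E. \<Phi> t = Ad U t))) \<and>
         (\<forall>U. unitary_op U \<longrightarrow>
             (star_automorphism (Cstar_cp d \<AA> E) (Ad U) \<longleftrightarrow>
             star_automorphism (Cstar_Roe d \<AA> E) (Ad U)))"
proof -
  obtain e :: "'x set \<Rightarrow> ('h \<Rightarrow>\<^sub>L 'h)" and near where block: "block_module e near"
    and eq: "Cstar_cp d \<AA> E = block_module.cp e near" "Cstar_Roe d \<AA> E = block_module.roe e near"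
    using Cstar_algebras_block_module[OF assms(1,2)] by blast
  interpret block_module e near by (rule block)
  show ?thesis
    unfolding eq using cp_automorphism_spatial roe_automorphism_spatial Ad_cp_iff_Ad_roe by blast
qed

end
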